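(* Take $\theta=2$. Let $z,z'\in\mathbb{C}$ satisfy the admissibility conditions (for $\theta=2$) given in the context, let $\xi\in(0,1)$ and $\eta>0$. (A) The point process $\underline{M}_{z,z',\xi,\theta=2}$ on $\mathbb{Z}+\frac12$, i.e. the image of the mixed $z$-measure $M_{z,z',\xi,\theta=2}$ under the embedding $\lambda\mapsto X(\lambda)$, is the Pfaffian $L$-ensemble with $L=L_h$, where $$ h(x)=\begin{cases}\dfrac{[z+1]_{x-\frac12}\,[z'+1]_{x-\frac12}}{\Gamma(x+\frac12)}\,\xi^{x/2}, & x\in\mathbb{Z}_{\ge 0}+\frac12,\\[2mm] \dfrac{[-z]_{-x-\frac12}\,[-z']_{-x-\frac12}}{\Gamma(-x+\frac12)}\,\xi^{-x/2}, & x\in\mathbb{Z}_{\le 0}-\frac12.\end{cases} $$ That is, $\mathrm{Prob}(X)=\mathrm{Pf}\,L(X|X)/\mathrm{Pf}(J+L)$ for every finite $X\subset\mathbb{Z}+\frac12$. Moreover, $$\mathrm{Pf}(J+L)=(1-\xi)^{-\frac{zz'}{2}}.$$ (B) The point process $\underline{M}_{\mathrm{Pl},\eta,\theta=2}$ on $\mathbb{Z}+\frac12$, i.e. the image of the poissonized Plancherel measure $M_{\mathrm{Pl},\eta,\theta=2}$ under the same embedding $\lambda\mapsto X(\lambda)$, is the Pfaffian $L$-ensemble with $L=L_h$, where $$h(x)=\frac{(2\eta)^{\frac12|x|}}{\Gamma(|x|+\frac12)},\qquad x\in\mathbb{Z}+\tfrac12 .$$ Moreover, $\mathrm{Pf}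(J+L)=e^{\eta}$.
   Context: **Young diagrams and measures.** $\mathbb{Y}$ is the set of all Young diagrams (integer partitions), including the empty one; $|\lambda|$ is the number of boxes, $\lambda'$ the transposed diagram. For $\theta>0$, $z\in\mathbb{C}$: $$(z)_{\lambda,\theta}=\prod_{(i,j)\in\lambda}\bigl(z+(j-1)-(i-1)\theta\bigr),$$ $$H(\lambda,\theta)=\prod_{(i,j)\in\lambda}\bigl((\lambda_i-j)+(\lambda'_j-i)\theta+1\bigr),\quad H'(\lambda,\theta)=\prod_{(i,j)\in\lambda}\bigl((\lambda_i-j)+(\lambda'_j-i)\theta+\theta\bigr),$$ where $(i,j)$ is the box in row $i$, column $j$. The mixed $z$-measure with Jack parameter $\theta$ is, with $t=zz'/\theta$ and $\xi\in(0,1)$, $$M_{z,z',\xi,\theta}(\lambda)=(1-\xi)^t\,\xi^{|\lambda|}\,\frac{(z)_{\lambda,\theta}(z')_{\lambda,\theta}}{H(\lambda,\theta)H'(\lambda,\theta)},\quad \lambda\in\mathbb{Y}.$$ The poissonized Plancherel measure is, with $\eta>0$, $$M_{\mathrm{Pl},\eta,\theta}(\lambda)=e^{-\eta}\eta^{|\lambda|}\frac{\theta^{|\lambda|}}{H(\lambda,\theta)H'(\lambda,\theta)},\quad\lambda\in\mathbb{Y}.$$ Both are probability measures on $\mathbb{Y}$ (for the $z$-measure, under the following conditions). **Admissibility of $(z,z')$ for $\theta$**: one of the following holds. Principal series: $z\in\mathbb{C}\setminus(\mathbb{Z}_{\le0}+\mathbb{Z}_{\ge0}\theta)$ and $z'=\bar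 z$. Complementary series: $\theta$ is rational and $z,z'$ are real numbers both lying in one of the (open) intervals between two consecutive numbers of the lattice $\mathbb{Z}+\mathbb{Z}\theta$. Degenerate series: for some $m\in\{1,2,\dots\}$, either ($z=m\theta$, $z'>(m-1)\theta$) or ($z'=m\theta$, $z>(m-1)\theta$) or ($z=-m$, $z'<-m+1$) or ($z'=-m$, $z<-m+1$), with $z,z'$ real. **Symbol $[a]_n$.** For $a\in\mathbb{C}$: $[a]_0=1$; $[a]_n=(a+1)(a+3)\cdots(a+n-1)$ for even $n\geq 2$; $[a]_n=a(a+2)\cdots(a+n-1)$ for odd $n$. **Embedding $\lambda\mapsto X(\lambda)$.** Let $\lambda\sqcup\lambda=(\lambda_1,\lambda_1,\lambda_2,\lambda_2,\dots)$ (each row of $\lambda$ repeated twice), and let $(P_1,\dots,P_D|Q_1,\dots,Q_D)$ be its usual Frobenius coordinates: $D$ is the number of diagonal boxes of $\lambda\sqcup\lambda$, $P_i$ the number of boxes in row $i$ to the right of the diagonal, $Q_i$ the number of boxes in column $i$ below the diagonal. (If $D$ is odd then $P_D=0$.) Put $X(\lambda)=X_-\sqcup X_+$, where $X_-=\{-Q_1-\frac12,\dots,-Q_D-\frac12\}$, and $X_+=\{P_{D-1}+\frac12,P_{D-3}+\frac12,\dots,P_1+\frac12\}$ if $D$ is even, $X_+=\{\frac12,P_{D-2}+\frac12,P_{D-4}+\frac12,\dots,P_1+\frac12\}$ if $D$ is odd. This is an injective map from $\mathbb{Y}$ to the set of finite subsets of $\mathbb{Z}+\frac12$. For a probability measure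 $M$ on $\mathbb{Y}$, $\underline{M}$ denotes the point process (probability measure on finite subsets of $\mathbb{Z}+\frac12$) obtained as the image of $M$; finite subsets not in the image have probability $0$. **Pfaffian $L$-ensembles.** Let $\mathfrak{X}$ be a countable set; each $x\in\mathfrak{X}$ has two copies $x',x''$. Let $L$ be a skew-symmetric matrix with rows and columns indexed by the points $x',x''$, written in $2\times2$ blocks $$L(x,y)=\begin{bmatrix}L(x',y')&L(x',y'')\\L(x'',y')&L(x'',y'')\end{bmatrix},\quad x,y\in\mathfrak{X}.$$ For finite $X=\{x_1,\dots,x_m\}\subset\mathfrak{X}$, $L(X|X)$ is the $2m\times2m$ antisymmetric submatrix with index order $x_1',x_1'',\dots,x_m',x_m''$ (its Pfaffian does not depend on the order of the $x_i$; for $X=\emptyset$ the Pfaffian is $1$). $J$ is the block matrix with $J(x,x)=\begin{bmatrix}0&1\\-1&0\end{bmatrix}$ and $J(x,y)=0$ for $x\ne y$. Suppose $\mathrm{Pf}\,L(X|X)\ge0$ for all finite $X$ and $\sum_X\mathrm{Pf}\,L(X|X)<\infty$ (sum over all finite subsets). One defines $\mathrm{Pf}(J+L):=\sum_{X}\mathrm{Pf}\,L(X|X)$, and the Pfaffian $L$-ensemble is the point process on $\mathfrak{X}$ with $\mathrm{Prob}_L(X)=\mathrm{Pf}\,L(X|X)/\mathrm{Pf}(J+L)$ for all finite $X\subset\mathfrak{X}$. Saying that a process is the Pfaffian $L$-ensemble includes the assertion that these two conditions on $L$ hold. **The matrix $L_h$.** Let $\mathfrak{X}=\mathbb{Z}+\frac12$.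 Parity: on $\mathbb{Z}_{\ge0}+\frac12$ the point $\frac12$ is even, $\frac32$ odd, and so on alternately; on $\mathbb{Z}_{\le0}-\frac12$ the point $-\frac12$ is even, $-\frac32$ odd, and so on alternately. Let $\epsilon(x,y)=-\epsilon(y,x)$ with, for $x<y$, $\epsilon(x,y)=1$ if $x$ is odd and $y$ is even, and $\epsilon(x,y)=0$ otherwise. For a function $h$ on $\mathbb{Z}+\frac12$, according to the decomposition $\mathbb{Z}+\frac12=(\mathbb{Z}_{\le0}-\frac12)\sqcup\{\frac12\}\sqcup(\mathbb{Z}_{\ge0}+\frac32)$, $$L_h=\begin{bmatrix}\mathrm{E}&\mathrm{A}&\mathrm{B}\\-\mathrm{A}^T&0&0\\-\mathrm{B}^T&0&0\end{bmatrix},$$ with $2\times2$ block entries $$\mathrm{E}(x,y)=\begin{bmatrix}\epsilon(x,y)&0\\0&0\end{bmatrix},\ x,y\in\mathbb{Z}_{\le0}-\tfrac12;\qquad \mathrm{A}(x,y)=\begin{bmatrix}\epsilon(x,y)&0\\0&\frac{h(x)h(y)}{x-y}\end{bmatrix},\ x\in\mathbb{Z}_{\le0}-\tfrac12,\ y=\tfrac12;$$ $$\mathrm{B}(x,y)=\begin{bmatrix}0&0\\\frac{h(x)h(y)}{x-y}&\frac{h(x)h(y-1)}{x-y+1}\end{bmatrix},\ x\in\mathbb{Z}_{\le0}-\tfrac12,\ y\in\mathbb{Z}_{\ge0}+\tfrac32.$$ *)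

theory Defs
  imports "HOL-Probability.Probability"
begin

text \<open>Young diagrams, represented by the list of their nonzero row lengths.\<close>

typedef young_diagram = "{rs :: nat list. sorted_wrt (\<ge>) rs \<and> 0 \<notin> set rs}"
  morphisms row_lengths Young_Diagram
  by (rule exI[of _ "[]"]) simp

setup_lifting type_definition_young_diagram

text \<open>Rows and columns are counted from 1; \<open>row \<nu> i\<close> is $\nu_i$ and \<open>col \<nu> j\<close> is $\nu'_j$.\<close>

definition row :: "young_diagram \<Rightarrow> nat \<Rightarrow> nat" where
  "row \<nu> i = (if 1 \<le> i \<and> i \<le> length (row_lengths \<nu>) then row_lengths \<nu> ! (i - 1) else 0)"

definition boxes :: "young_diagram \<Rightarrow> (nat \<times> nat) set" where
  "boxes \<nu> = {(i, j). 1 \<le> i \<and> 1 \<le> j \<and> j \<le> row \<nu> i}"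

definition col :: "young_diagram \<Rightarrow> nat \<Rightarrow> nat" where
  "col \<nu> j = card {i. (i, j) \<in> boxes \<nu>}"

definition num_boxes :: "young_diagram \<Rightarrow> nat" where
  "num_boxes \<nu> = card (boxes \<nu>)"

definition jack_poch :: "complex \<Rightarrow> young_diagram \<Rightarrow> real \<Rightarrow> complex" where
  "jack_poch z \<nu> \<theta> =
     (\<Prod>(i, j)\<in>boxes \<nu>. z + of_real ((real j - 1) - (real i - 1) * \<theta>))"

definition hook_H :: "young_diagram \<Rightarrow> real \<Rightarrow> real" where
  "hook_H \<nu> \<theta> =
     (\<Prod>(i, j)\<in>boxes \<nu>. (real (row \<nu> i) - real j) + (real (col \<nu> j) - real i) * \<theta> + 1)"

definition hook_H' :: "young_diagram \<Rightarrow> real \<Rightarrow> real" where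
  "hook_H' \<nu> \<theta> =
     (\<Prod>(i, j)\<in>boxes \<nu>. (real (row \<nu> i) - real j) + (real (col \<nu> j) - real i) * \<theta> + \<theta>)"

definition mixed_z_weight ::
    "complex \<Rightarrow> complex \<Rightarrow> real \<Rightarrow> real \<Rightarrow> young_diagram \<Rightarrow> complex" where
  "mixed_z_weight z z' \<xi> \<theta> \<nu> =
     complex_of_real (1 - \<xi>) powr (z * z' / of_real \<theta>) * of_real (\<xi> ^ num_boxes \<nu>)
     * (jack_poch z \<nu> \<theta> * jack_poch z' \<nu> \<theta>) / of_real (hook_H \<nu> \<theta> * hook_H' \<nu> \<theta>)"

definition poissonized_plancherel_weight :: "real \<Rightarrow> real \<Rightarrow> young_diagram \<Rightarrow> real" where
  "poissonized_plancherel_weight \<eta> \<theta> \<nu> =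
     exp (- \<eta>) * \<eta> ^ num_boxes \<nu> * (\<theta> ^ num_boxes \<nu> / (hook_H \<nu> \<theta> * hook_H' \<nu> \<theta>))"

text \<open>
  A probability measure is determined by its weights. The weights are allowed to be complex,
  because the formula for the mixed $z$-measure is: the predicate then asserts that they are
  real, nonnegative and sum to 1.
\<close>

definition is_measure_with_weights :: "'a pmf \<Rightarrow> ('a \<Rightarrow> complex) \<Rightarrow> bool" where
  "is_measure_with_weights M w \<longleftrightarrow> (\<forall>x. complex_of_real (pmf M x) = w x)"

definition principal_series :: "real \<Rightarrow> complex \<Rightarrow> complex \<Rightarrow> bool" where
  "principal_series \<theta> z z' \<longleftrightarrow>
     z \<notin> {of_int a + of_nat b * of_real \<theta> | a b. a \<le> (0::int)} \<and> z' = cnj z"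

definition theta_lattice :: "real \<Rightarrow> real set" where
  "theta_lattice \<theta> = {of_int a + of_int b * \<theta> | a b. True}"

definition complementary_series :: "real \<Rightarrow> complex \<Rightarrow> complex \<Rightarrow> bool" where
  "complementary_series \<theta> z z' \<longleftrightarrow> \<theta> \<in> \<rat> \<and> z \<in> \<real> \<and> z' \<in> \<real> \<and>
     (\<exists>a\<in>theta_lattice \<theta>. \<exists>b\<in>theta_lattice \<theta>. a < b \<and> {a<..<b} \<inter> theta_lattice \<theta> = {} \<and>
        Re z \<in> {a<..<b} \<and> Re z' \<in> {a<..<b})"

definition degenerate_series :: "real \<Rightarrow> complex \<Rightarrow> complex \<Rightarrow> bool" where
  "degenerate_series \<theta> z z' \<longleftrightarrow> z \<in> \<real> \<and> z' \<in> \<real> \<and>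
     (\<exists>m::nat. m \<ge> 1 \<and>
        ((Re z = real m * \<theta> \<and> Re z' > (real m - 1) * \<theta>) \<or>
         (Re z' = real m * \<theta> \<and> Re z > (real m - 1) * \<theta>) \<or>
         (Re z = - real m \<and> Re z' < - real m + 1) \<or>
         (Re z' = - real m \<and> Re z < - real m + 1)))"

definition admissible :: "real \<Rightarrow> complex \<Rightarrow> complex \<Rightarrow> bool" where
  "admissible \<theta> z z' \<longleftrightarrow>
     principal_series \<theta> z z' \<or> complementary_series \<theta> z z' \<or> degenerate_series \<theta> z z'"

definition half_integers :: "real set" where
  "half_integers = {real_of_int n + 1 / 2 | n. True}"

lemma double_rows_closed:
  fixes rs :: "nat list"
  assumes "sorted_wrt (\<ge>) rs \<and> 0 \<notin> set rs"
  shows "sorted_wrt (\<ge>) (concat (map (\<lambda>r. [r, r]) rs)) \<and> 0 \<notin> set (concat (map (\<lambda>r. [r, r]) rs))"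
  using assms by (induction rs) auto

text \<open>\<open>double_rows \<nu>\<close> is $\nu\sqcup\nu$: each row is repeated twice.\<close>

lift_definition double_rows :: "young_diagram \<Rightarrow> young_diagram"
  is "\<lambda>rs. concat (map (\<lambda>r. [r, r]) rs)"
  by (rule double_rows_closed)

definition frob_length :: "young_diagram \<Rightarrow> nat" where
  "frob_length \<mu> = card {i. (i, i) \<in> boxes \<mu>}"

text \<open>Frobenius coordinates; meaningful for \<open>1 \<le> i \<le> frob_length \<mu>\<close>, where no truncation occurs.\<close>

definition frob_P :: "young_diagram \<Rightarrow> nat \<Rightarrow> nat" where
  "frob_P \<mu> i = row \<mu> i - i"

definition frob_Q :: "young_diagram \<Rightarrow> nat \<Rightarrow> nat" where
  "frob_Q \<mu> i = col \<mu> i - i"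

definition config_minus :: "young_diagram \<Rightarrow> real set" where
  "config_minus \<nu> = (let \<mu> = double_rows \<nu> in
     {- real (frob_Q \<mu> i) - 1 / 2 | i. 1 \<le> i \<and> i \<le> frob_length \<mu>})"

text \<open>
  The indices $D-1, D-3, \dots, 1$ (for $D$ even) and $D-2, D-4, \dots, 1$ (for $D$ odd)
  are the odd indices in the respective range.
\<close>

definition config_plus :: "young_diagram \<Rightarrow> real set" where
  "config_plus \<nu> = (let \<mu> = double_rows \<nu>; D = frob_length \<mu> in
     if even D
     then {real (frob_P \<mu> i) + 1 / 2 | i. odd i \<and> i + 1 \<le> D}
     else {1 / 2} \<union> {real (frob_P \<mu> i) + 1 / 2 | i. odd i \<and> i + 2 \<le> D})"

definition config :: "young_diagram \<Rightarrow> real set" where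
  "config \<nu> = config_minus \<nu> \<union> config_plus \<nu>"

definition point_process :: "young_diagram pmf \<Rightarrow> real set pmf" where
  "point_process M = map_pmf config M"

text \<open>The Pfaffian of a skew-symmetric \<open>2m \<times> 2m\<close> matrix with indices \<open>0, \<dots>, 2m - 1\<close>.\<close>

definition pfaffian :: "nat \<Rightarrow> (nat \<Rightarrow> nat \<Rightarrow> complex) \<Rightarrow> complex" where
  "pfaffian m A =
     (\<Sum>\<sigma> | \<sigma> permutes {..<2 * m}. of_int (sign \<sigma>) * (\<Prod>i<m. A (\<sigma> (2 * i)) (\<sigma> (2 * i + 1))))
     / (2 ^ m * fact m)"

text \<open>
  A matrix with rows and columns indexed by the points $x', x''$ is given by its
  \<open>2 \<times> 2\<close> blocks: \<open>L x y $ 1 $ 2\<close> is the entry $L(x',y'')$, and so on.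
\<close>

type_synonym 'a block_matrix = "'a \<Rightarrow> 'a \<Rightarrow> complex^2^2"

definition skew_block_matrix :: "'a set \<Rightarrow> 'a block_matrix \<Rightarrow> bool" where
  "skew_block_matrix S L \<longleftrightarrow> (\<forall>x\<in>S. \<forall>y\<in>S. L y x = - transpose (L x y))"

text \<open>
  $\mathrm{Pf}\, L(X|X)$ with index order $x_1', x_1'', \dots, x_m', x_m''$. The points are taken
  in increasing order; any other order of the points gives the same value.
\<close>

definition pf_submatrix :: "('a::linorder) block_matrix \<Rightarrow> 'a set \<Rightarrow> complex" where
  "pf_submatrix L X = (let xs = sorted_list_of_set X in
     pfaffian (card X) (\<lambda>i j. L (xs ! (i div 2)) (xs ! (j div 2))
       $ (if even i then 1 else 2) $ (if even j then 1 else 2)))"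

text \<open>$\mathrm{Pf}(J+L)$, which is by definition this sum over finite subsets.\<close>

definition pf_J_plus :: "('a::linorder) set \<Rightarrow> 'a block_matrix \<Rightarrow> complex" where
  "pf_J_plus S L = (\<Sum>\<^sub>\<infinity>X\<in>Fpow S. pf_submatrix L X)"

definition is_pfaffian_L_ensemble ::
    "('a::linorder) set \<Rightarrow> 'a block_matrix \<Rightarrow> 'a set pmf \<Rightarrow> bool" where
  "is_pfaffian_L_ensemble S L p \<longleftrightarrow>
     countable S \<and> skew_block_matrix S L \<and>
     (\<forall>X\<in>Fpow S. pf_submatrix L X \<in> \<real>\<^sub>\<ge>\<^sub>0) \<and>
     pf_submatrix L summable_on Fpow S \<and>
     set_pmf p \<subseteq> Fpow S \<and>
     (\<forall>X\<in>Fpow S. complex_of_real (pmf p X) = pf_submatrix L X / pf_J_plus S L)"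

definition bracket_symbol :: "complex \<Rightarrow> nat \<Rightarrow> complex" where
  "bracket_symbol a n =
     (if even n then (\<Prod>k<n div 2. a + of_nat (2 * k + 1))
      else (\<Prod>k<(n + 1) div 2. a + of_nat (2 * k)))"

text \<open>
  The points $\pm\frac12$ are even and the parity alternates away from them on either side.
\<close>

definition even_point :: "real \<Rightarrow> bool" where
  "even_point x \<longleftrightarrow> even \<lfloor>\<bar>x\<bar> - 1 / 2\<rfloor>"

definition parity_eps :: "real \<Rightarrow> real \<Rightarrow> complex" where
  "parity_eps x y =
     (if x < y then (if \<not> even_point x \<and> even_point y then 1 else 0)
      else if y < x then - (if \<not> even_point y \<and> even_point x then 1 else 0)
      else 0)"

definition block :: "complex \<Rightarrow> complex \<Rightarrow> complex \<Rightarrow> complex \<Rightarrow> complex^2^2" where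
  "block a b c d = vector [vector [a, b], vector [c, d]]"

definition block_E :: "real block_matrix" where
  "block_E x y = block (parity_eps x y) 0 0 0"

definition block_A :: "(real \<Rightarrow> complex) \<Rightarrow> real block_matrix" where
  "block_A h x y = block (parity_eps x y) 0 0 (h x * h y / of_real (x - y))"

definition block_B :: "(real \<Rightarrow> complex) \<Rightarrow> real block_matrix" where
  "block_B h x y =
     block 0 0 (h x * h y / of_real (x - y)) (h x * h (y - 1) / of_real (x - y + 1))"

text \<open>
  The blocks of rows and columns correspond to $x < 0$, $x = \frac12$ and
  $x \ge \frac32$; only half-integer arguments matter.
\<close>

definition L_matrix :: "(real \<Rightarrow> complex) \<Rightarrow> real block_matrix" where
  "L_matrix h x y =
     (if x < 0 then
        (if y < 0 then block_E x y else if y = 1 / 2 then block_A h x y else block_B h x y)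
      else if y < 0 then
        (if x = 1 / 2 then - transpose (block_A h y x) else - transpose (block_B h y x))
      else 0)"

definition h_z :: "complex \<Rightarrow> complex \<Rightarrow> real \<Rightarrow> real \<Rightarrow> complex" where
  "h_z z z' \<xi> x =
     (if x > 0 then
        bracket_symbol (z + 1) (nat \<lfloor>x - 1 / 2\<rfloor>) * bracket_symbol (z' + 1) (nat \<lfloor>x - 1 / 2\<rfloor>)
        / of_real (Gamma (x + 1 / 2)) * of_real (\<xi> powr (x / 2))
      else
        bracket_symbol (- z) (nat \<lfloor>- x - 1 / 2\<rfloor>) * bracket_symbol (- z') (nat \<lfloor>- x - 1 / 2\<rfloor>)
        / of_real (Gamma (- x + 1 / 2)) * of_real (\<xi> powr (- x / 2)))"

definition h_Pl :: "real \<Rightarrow> real \<Rightarrow> complex" where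
  "h_Pl \<eta> x = of_real ((2 * \<eta>) powr (\<bar>x\<bar> / 2) / Gamma (\<bar>x\<bar> + 1 / 2))"

end

(*
  In the Frobenius coordinates (P | Q) of the diagram with doubled rows, L splits into two blocks
  that do not interact. The entries epsilon give a Pfaffian that is 1 if the parities alternate and
  0 otherwise, which is the condition that all columns have even length. The remaining entries
  form a Cauchy matrix in the points -Q_i - 1/2 and P_j + 1/2: every positive point y of the
  configuration contributes the two variables y and y - 1, because doubled rows make
  P_{2k-1} = P_{2k} + 1. Up to the factorials in h, the Cauchy determinant is the reciprocal
  of the hook product of the doubled diagram, which for theta = 2 equals H H'; the remaining factors
  of h give the content products. Hence Pf L(X|X) is the unnormalized weight of the diagram.

  The total mass is computed level by level, following Kerov: removing a box from, or adding a box
  to, a diagram defines transition coefficients whose sum and whose first two moments in the content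
  of the box are divided differences of polynomials. Summing over all edges between the levels n
  and n + 1 in two ways gives (n + 1) S_{n+1} = (z z' / 2 + n) S_n, so the generating function of S_n is binomial;
  with constant content weight it is exponential.
*)
theory Submission
  imports Defs
begin

section \<open>Pfaffians as recursive expansions over lists\<close>

text \<open>That the weights sum to 1 is part of the claim, so the total mass is computed rather
  than read off a given measure. Both measures are treated through a function g of the content, g(c)
  = (z + c)(z' + c) or g = 1. Under the up coefficients the content of the added box has moments 1,
  0, 2n of orders 0, 1, 2; of a quadratic g this keeps the constant coefficient alpha and the
  leading one gamma, and the 2 in \<open>row_weight_add_box\<close> turns them into alpha/2 + n
  gamma. In the Pfaffian three signs have to cancel: that of the shuffle separating the two blocks,
  that of exchanging y and y - 1, and that of the Cauchy formula. They do so when the numbers of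
  negative and positive variables agree; otherwise the Pfaffian is zero. Configurations outside the
  image must get weight zero as well. There the parities fail to alternate, the numbers disagree, or
  a variable is repeated, and a configuration without these three defects is shown to come from a
  diagram.\<close>

definition pf_term :: "nat \<Rightarrow> (nat \<Rightarrow> nat \<Rightarrow> complex) \<Rightarrow> (nat \<Rightarrow> nat) \<Rightarrow> complex" where
  "pf_term m A \<sigma> = of_int (sign \<sigma>) * (\<Prod>i<m. A (\<sigma> (2 * i)) (\<sigma> (2 * i + 1)))"

lemma pfaffian_alt:
  "pfaffian m A = (\<Sum>\<sigma> | \<sigma> permutes {..<2 * m}. pf_term m A \<sigma>) / (2 ^ m * fact m)"
  by (simp add: pfaffian_def pf_term_def)

lemma permutes_lessThan_imp_permutation: "\<sigma> permutes {..<n::nat} \<Longrightarrow> permutation \<sigma>"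
  using permutation_permutes by blast

text \<open>Exchanging the two arguments of the k-th factor changes the sign of that factor, by
  skewness, and the sign of the permutation; the two changes cancel.\<close>

lemma pf_term_compose_pair_flip:
  assumes skew: "\<And>i j. A j i = - A i j" and \<sigma>: "permutation \<sigma>" and k: "k < m"
  shows "pf_term m A (\<sigma> \<circ> Transposition.transpose (2 * k) (2 * k + 1)) = pf_term m A \<sigma>"
proof -
  let ?\<tau> = "Transposition.transpose (2 * k) (2 * k + 1)"
  have sg: "sign (\<sigma> \<circ> ?\<tau>) = - sign \<sigma>"
    using \<sigma> by (simp add: sign_compose permutation_swap_id sign_swap_id)
  have "(\<Prod>i\<in>{..<m} - {k}. A ((\<sigma> \<circ> ?\<tau>) (2 * i)) ((\<sigma> \<circ> ?\<tau>) (2 * i + 1)))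
      = (\<Prod>i\<in>{..<m} - {k}. A (\<sigma> (2 * i)) (\<sigma> (2 * i + 1)))"
  proof (intro prod.cong refl)
    fix i assume "i \<in> {..<m} - {k}"
    then have "i \<noteq> k" by simp
    then have "2 * i \<noteq> 2 * k" "2 * i \<noteq> 2 * k + 1" "2 * i + 1 \<noteq> 2 * k" "2 * i + 1 \<noteq> 2 * k + 1"
      by presburger+
    then show "A ((\<sigma> \<circ> ?\<tau>) (2 * i)) ((\<sigma> \<circ> ?\<tau>) (2 * i + 1)) = A (\<sigma> (2 * i)) (\<sigma> (2 * i + 1))"
      by (simp add: Transposition.transpose_def)
  qed
  moreover have "A ((\<sigma> \<circ> ?\<tau>) (2 * k)) ((\<sigma> \<circ> ?\<tau>) (2 * k + 1)) = - A (\<sigma> (2 * k)) (\<sigma> (2 * k + 1))"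
    using skew[of "\<sigma> (2 * k)" "\<sigma> (2 * k + 1)"] by simp
  ultimately show ?thesis
    using k by (simp only: pf_term_def sg prod.remove[OF finite_lessThan, of k] lessThan_iff) simp
qed

text \<open>Exchanging two whole index pairs is a product of two transpositions, hence even, and it
  merely reorders the factors.\<close>

lemma pf_term_compose_block_swap:
  assumes \<sigma>: "permutation \<sigma>" and k: "k < m" "l < m" "k \<noteq> l"
  shows "pf_term m A (\<sigma> \<circ> (Transposition.transpose (2 * k) (2 * l) \<circ> Transposition.transpose (2 * k + 1) (2 * l + 1))) = pf_term m A \<sigma>"
proof -
  let ?\<tau> = "Transposition.transpose (2 * k) (2 * l) \<circ> Transposition.transpose (2 * k + 1) (2 * l + 1)"
  have pt: "permutation ?\<tau>" by (simp add: permutation_compose permutation_swap_id)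
  have "sign ?\<tau> = 1"
    using k by (simp add: sign_compose permutation_swap_id sign_swap_id)
  then have sg: "sign (\<sigma> \<circ> ?\<tau>) = sign \<sigma>"
    using \<sigma> pt sign_compose[OF \<sigma> pt] by simp
  let ?g = "\<lambda>i. A (\<sigma> (2 * i)) (\<sigma> (2 * i + 1))"
  have e: "?\<tau> (2 * i) = 2 * Transposition.transpose k l i" for i
  proof -
    have "2 * i \<noteq> 2 * k + 1" "2 * i \<noteq> 2 * l + 1" by presburger+
    then show ?thesis by (auto simp: Transposition.transpose_def)
  qed
  have o: "?\<tau> (2 * i + 1) = 2 * Transposition.transpose k l i + 1" for i
  proof -
    have "2 * i + 1 \<noteq> 2 * k" "2 * i + 1 \<noteq> 2 * l" "2 * l + 1 \<noteq> 2 * k" "2 * k + 1 \<noteq> 2 * l" by presburger+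
    then show ?thesis by (auto simp: Transposition.transpose_def)
  qed
  have "Transposition.transpose k l permutes {..<m}"
    using k by (simp add: permutes_swap_id)
  then have "(\<Prod>i<m. ?g i) = (\<Prod>i<m. (?g \<circ> Transposition.transpose k l) i)"
    by (rule prod.permute)
  also have "\<dots> = (\<Prod>i<m. A ((\<sigma> \<circ> ?\<tau>) (2 * i)) ((\<sigma> \<circ> ?\<tau>) (2 * i + 1)))"
    using e o by (intro prod.cong refl) (simp only: o_apply)
  finally show ?thesis by (simp only: pf_term_def sg)
qed

text \<open>The terms are invariant under the pair flips and block swaps above, and these move the
  position with value 2m + 1 to the last place. Hence each of the 2m + 2 positions contributes as
  much as the last one.\<close>

lemma sum_pf_term_last_fixed:
  assumes skew: "\<And>i j. A j i = - A i j"
  shows "(\<Sum>\<sigma> | \<sigma> permutes {..<2 * Suc m}. pf_term (Suc m) A \<sigma>)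
       = of_nat (2 * Suc m) * (\<Sum>\<sigma> | \<sigma> permutes {..<2 * m + 1}. pf_term (Suc m) A \<sigma>)"
proof -
  let ?N = "2 * Suc m"
  let ?P = "{\<sigma>. \<sigma> permutes {..<?N}}"
  let ?Q = "\<lambda>p. {\<sigma> \<in> ?P. \<sigma> p = 2 * m + 1}"
  let ?t = "pf_term (Suc m) A"
  have fin: "finite ?P" by (simp add: finite_permutations)
  \<comment> \<open>Composing on the right with an involution that carries p to q matches the
    permutations with value 2m + 1 at p with those having it at q.\<close>
  have move: "(\<Sum>\<sigma>\<in>?Q p. ?t \<sigma>) = (\<Sum>\<sigma>\<in>?Q q. ?t \<sigma>)"
    if \<tau>: "\<tau> permutes {..<?N}" "\<tau> p = q" "\<tau> \<circ> \<tau> = id" and t: "\<And>\<sigma>. \<sigma> \<in> ?P \<Longrightarrow> ?t (\<sigma> \<circ> \<tau>) = ?t \<sigma>" for \<tau> p q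
  proof (rule sum.reindex_bij_witness[where i = "\<lambda>\<sigma>. \<sigma> \<circ> \<tau>" and j = "\<lambda>\<sigma>. \<sigma> \<circ> \<tau>"])
    have "\<tau> q = p" using that(2,3) by (metis comp_apply id_apply)
    then show "\<sigma> \<circ> \<tau> \<in> ?Q q" if "\<sigma> \<in> ?Q p" for \<sigma>
      using that \<tau> by (auto intro: permutes_compose)
    show "\<sigma> \<circ> \<tau> \<in> ?Q p" if "\<sigma> \<in> ?Q q" for \<sigma>
      using that \<tau> by (auto intro: permutes_compose)
  qed (use \<tau> t in \<open>auto simp: o_assoc[symmetric]\<close>)
  have odd: "(\<Sum>\<sigma>\<in>?Q (2 * k + 1). ?t \<sigma>) = (\<Sum>\<sigma>\<in>?Q (2 * m + 1). ?t \<sigma>)" if "k < Suc m" for k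
  proof (cases "k = m")
    case False
    let ?\<tau> = "Transposition.transpose (2 * k) (2 * m) \<circ> Transposition.transpose (2 * k + 1) (2 * m + 1)"
    have n: "2 * k + 1 \<noteq> 2 * m" "2 * k \<noteq> 2 * m + 1" by presburger+
    show ?thesis
    proof (rule move[where \<tau> = ?\<tau>])
      show "?\<tau> permutes {..<?N}"
        using that by (intro permutes_compose permutes_swap_id) auto
      show "?\<tau> (2 * k + 1) = 2 * m + 1"
        using n by (auto simp: Transposition.transpose_def)
      show "?\<tau> \<circ> ?\<tau> = id"
        using n False by (auto simp: Transposition.transpose_def fun_eq_iff)
      show "?t (\<sigma> \<circ> ?\<tau>) = ?t \<sigma>" if "\<sigma> \<in> ?P" for \<sigma>
        using that \<open>k < Suc m\<close> False permutes_lessThan_imp_permutation[of \<sigma>]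
        by (intro pf_term_compose_block_swap) auto
    qed
  qed simp
  have even: "(\<Sum>\<sigma>\<in>?Q (2 * k). ?t \<sigma>) = (\<Sum>\<sigma>\<in>?Q (2 * k + 1). ?t \<sigma>)" if "k < Suc m" for k
  proof (rule move[where \<tau> = "Transposition.transpose (2 * k) (2 * k + 1)"])
    show "Transposition.transpose (2 * k) (2 * k + 1) permutes {..<?N}"
      using that by (intro permutes_swap_id) auto
    show "?t (\<sigma> \<circ> Transposition.transpose (2 * k) (2 * k + 1)) = ?t \<sigma>" if "\<sigma> \<in> ?P" for \<sigma>
      using that \<open>k < Suc m\<close> permutes_lessThan_imp_permutation[of \<sigma>]
      by (intro pf_term_compose_pair_flip[OF skew]) auto
  qed auto
  have all: "(\<Sum>\<sigma>\<in>?Q p. ?t \<sigma>) = (\<Sum>\<sigma>\<in>?Q (2 * m + 1). ?t \<sigma>)" if "p < ?N" for p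
  proof -
    have "\<exists>k. k < Suc m \<and> (p = 2 * k \<or> p = 2 * k + 1)" using that by presburger
    then obtain k where k: "k < Suc m" "p = 2 * k \<or> p = 2 * k + 1" by blast
    from k(2) show ?thesis
    proof
      assume "p = 2 * k"
      then show ?thesis using even[OF k(1)] odd[OF k(1)] by simp
    next
      assume "p = 2 * k + 1"
      then show ?thesis using odd[OF k(1)] by simp
    qed
  qed
  have "(\<Sum>\<sigma>\<in>?P. ?t \<sigma>) = (\<Sum>\<sigma>\<in>?P. \<Sum>p\<in>{p\<in>{..<?N}. \<sigma> p = 2 * m + 1}. ?t \<sigma>)"
  proof (intro sum.cong refl)
    fix \<sigma> assume "\<sigma> \<in> ?P"
    then have s: "\<sigma> permutes {..<?N}" by simp
    have "{p\<in>{..<?N}. \<sigma> p = 2 * m + 1} = {inv \<sigma> (2 * m + 1)}"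
    proof -
      have "\<sigma> p = 2 * m + 1 \<longleftrightarrow> p = inv \<sigma> (2 * m + 1)" for p
        using permutes_inv_eq[OF s, of "2 * m + 1" p] by auto
      moreover have "inv \<sigma> (2 * m + 1) < ?N"
        using permutes_in_image[OF permutes_inv[OF s], of "2 * m + 1"] by simp
      ultimately show ?thesis by auto
    qed
    then show "?t \<sigma> = (\<Sum>p\<in>{p\<in>{..<?N}. \<sigma> p = 2 * m + 1}. ?t \<sigma>)" by simp
  qed
  also have "\<dots> = (\<Sum>p<?N. \<Sum>\<sigma>\<in>?Q p. ?t \<sigma>)"
    by (rule sum.swap_restrict) (use fin in auto)
  also have "\<dots> = of_nat ?N * (\<Sum>\<sigma>\<in>?Q (2 * m + 1). ?t \<sigma>)"
  proof -
    have "(\<Sum>p<?N. \<Sum>\<sigma>\<in>?Q p. ?t \<sigma>) = (\<Sum>p<?N. \<Sum>\<sigma>\<in>?Q (2 * m + 1). ?t \<sigma>)"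
      by (intro sum.cong[OF refl] all) simp
    then show ?thesis by (simp only: sum_constant card_lessThan)
  qed
  also have "?Q (2 * m + 1) = {\<sigma>. \<sigma> permutes {..<2 * m + 1}}"
  proof (intro equalityI subsetI)
    fix \<sigma> assume "\<sigma> \<in> ?Q (2 * m + 1)"
    then have "\<sigma> permutes {..<?N}" "\<sigma> (2 * m + 1) = 2 * m + 1" by auto
    then show "\<sigma> \<in> {\<sigma>. \<sigma> permutes {..<2 * m + 1}}"
    proof -
      assume a: "\<sigma> permutes {..<?N}" "\<sigma> (2 * m + 1) = 2 * m + 1"
      have "\<sigma> permutes {..<2 * m + 1}"
      proof (rule permutes_superset[OF a(1)])
        fix x assume "x \<in> {..<?N} - {..<2 * m + 1}"
        then have "x = 2 * m + 1" by auto
        then show "\<sigma> x = x" using a(2) by simp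
      qed
      then show ?thesis by simp
    qed
  next
    fix \<sigma> assume a: "\<sigma> \<in> {\<sigma>. \<sigma> permutes {..<2 * m + 1}}"
    then have "\<sigma> permutes {..<?N}" by (auto intro: permutes_subset)
    moreover have "\<sigma> (2 * m + 1) = 2 * m + 1" using a by (auto intro: permutes_not_in)
    ultimately show "\<sigma> \<in> ?Q (2 * m + 1)" by auto
  qed
  finally show ?thesis .
qed

lemma pfaffian_cong:
  assumes "\<And>i j. i < 2 * m \<Longrightarrow> j < 2 * m \<Longrightarrow> A i j = B i j"
  shows "pfaffian m A = pfaffian m B"
proof -
  have "pf_term m A \<sigma> = pf_term m B \<sigma>" if "\<sigma> permutes {..<2 * m}" for \<sigma>
    unfolding pf_term_def
  proof (intro arg_cong2[where f = "(*)"] refl prod.cong assms)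
    fix i assume "i \<in> {..<m}"
    then show "\<sigma> (2 * i) < 2 * m" "\<sigma> (2 * i + 1) < 2 * m"
      using permutes_in_image[OF that, of "2 * i"] permutes_in_image[OF that, of "2 * i + 1"] by auto
  qed
  then show ?thesis unfolding pfaffian_alt by (intro arg_cong2[where f = "(/)"] sum.cong) auto
qed

text \<open>With the last index fixed, a permutation is the transposition of 2m with its value b at
  2m, composed with a permutation of the first 2m indices. Conjugating the matrix by that
  transposition puts index 2m in the place of b, so the smaller Pfaffian keeps the index set below
  2m. The factor 2m + 2 cancels against the normalisation.\<close>

lemma pfaffian_expand_last:
  assumes skew: "\<And>i j. A j i = - A i j"
  shows "pfaffian (Suc m) A = A (2 * m) (2 * m + 1) * pfaffian m A
     - (\<Sum>b<2 * m. A b (2 * m + 1) *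
          pfaffian m (\<lambda>i j. A (Transposition.transpose (2 * m) b i) (Transposition.transpose (2 * m) b j)))"
proof -
  let ?S = "{..<2 * m}"
  have ins: "{..<2 * m + 1} = insert (2 * m) ?S" by auto
  let ?tr = "\<lambda>b. Transposition.transpose (2 * m) b"
  have trm: "pf_term (Suc m) A (?tr b \<circ> q)
      = (if b = 2 * m then 1 else - 1) * A b (2 * m + 1)
        * pf_term m (\<lambda>i j. A (?tr b i) (?tr b j)) q"
    if "q permutes ?S" "b \<le> 2 * m" for b q
  proof -
    have "q (2 * m) = 2 * m" "q (2 * m + 1) = 2 * m + 1"
      using that by (auto intro: permutes_not_in)
    moreover have "Transposition.transpose (2 * m) b (Suc (2 * m)) = Suc (2 * m)" using that by (auto simp: Transposition.transpose_def)
    ultimately show ?thesis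
      using that permutes_lessThan_imp_permutation[of q]
      by (auto simp: pf_term_def sign_compose permutation_swap_id sign_swap_id)
  qed
  have "(\<Sum>\<sigma> | \<sigma> permutes {..<2 * m + 1}. pf_term (Suc m) A \<sigma>)
      = (\<Sum>b\<in>insert (2 * m) ?S. \<Sum>q | q permutes ?S. pf_term (Suc m) A (?tr b \<circ> q))"
    unfolding ins by (rule sum_over_permutations_insert) auto
  also have "\<dots> = (\<Sum>b\<in>insert (2 * m) ?S. (if b = 2 * m then 1 else - 1) * A b (2 * m + 1) *
      (\<Sum>q | q permutes ?S. pf_term m (\<lambda>i j. A (?tr b i) (?tr b j)) q))"
    unfolding sum_distrib_left mult.assoc[symmetric]
    by (intro sum.cong refl trm) auto
  also have "\<dots> = (2 ^ m * fact m) * (\<Sum>b\<in>insert (2 * m) ?S. (if b = 2 * m then 1 else - 1) *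
      A b (2 * m + 1) * pfaffian m (\<lambda>i j. A (?tr b i) (?tr b j)))"
  proof -
    have "(\<Sum>q | q permutes ?S. pf_term m B q) = (2 ^ m * fact m) * pfaffian m B" for B
      by (simp add: pfaffian_alt)
    then show ?thesis by (simp only: sum_distrib_left mult.left_commute)
  qed
  also have "(\<Sum>b\<in>insert (2 * m) ?S. (if b = 2 * m then 1 else - 1) *
      A b (2 * m + 1) * pfaffian m (\<lambda>i j. A (?tr b i) (?tr b j)))
     = A (2 * m) (2 * m + 1) * pfaffian m A
     - (\<Sum>b<2 * m. A b (2 * m + 1) * pfaffian m (\<lambda>i j. A (?tr b i) (?tr b j)))"
    by (simp add: sum_negf)
  finally have *: "(\<Sum>\<sigma> | \<sigma> permutes {..<2 * m + 1}. pf_term (Suc m) A \<sigma>)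
    = (2 ^ m * fact m) * (A (2 * m) (2 * m + 1) * pfaffian m A
     - (\<Sum>b<2 * m. A b (2 * m + 1) * pfaffian m (\<lambda>i j. A (?tr b i) (?tr b j))))" .
  show ?thesis
    unfolding pfaffian_alt[of "Suc m"] sum_pf_term_last_fixed[of A, OF skew] *
    by (simp add: field_simps del: of_nat_Suc of_nat_mult) (simp add: field_simps)
qed

lemma pfaffian_compose_transpose:
  assumes "a < 2 * m" "b < 2 * m" "a \<noteq> b"
  shows "pfaffian m (\<lambda>i j. A (Transposition.transpose a b i) (Transposition.transpose a b j)) = - pfaffian m A"
proof -
  have p: "Transposition.transpose a b permutes {..<2 * m}" using assms by (intro permutes_swap_id) auto
  have "(\<Sum>\<sigma> | \<sigma> permutes {..<2 * m}. pf_term m A \<sigma>)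
      = (\<Sum>\<sigma> | \<sigma> permutes {..<2 * m}. pf_term m A (Transposition.transpose a b \<circ> \<sigma>))"
    by (rule setum_permutations_compose_left[OF p])
  also have "\<dots> = - (\<Sum>\<sigma> | \<sigma> permutes {..<2 * m}.
      pf_term m (\<lambda>i j. A (Transposition.transpose a b i) (Transposition.transpose a b j)) \<sigma>)"
    unfolding sum_negf[symmetric]
    using assms permutes_lessThan_imp_permutation
    by (intro sum.cong refl)
       (auto simp: pf_term_def sign_compose permutation_swap_id sign_swap_id)
  finally show ?thesis by (simp add: pfaffian_alt)
qed

section \<open>Pfaffians indexed by lists\<close>

definition pf_list :: "('a \<Rightarrow> 'a \<Rightarrow> complex) \<Rightarrow> 'a list \<Rightarrow> complex" where
  "pf_list A xs = pfaffian (length xs div 2) (\<lambda>i j. A (xs ! i) (xs ! j))"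

lemma pf_list_Nil [simp]: "pf_list A [] = 1"
  by (simp add: pf_list_def pfaffian_def)

lemma pf_list_swap:
  assumes "even (length us + length vs)"
  shows "pf_list A (us @ b # c # vs) = - pf_list A (us @ c # b # vs)"
proof -
  let ?n = "length us" and ?xs = "us @ c # b # vs"
  have "(us @ b # c # vs) ! i = ?xs ! (Transposition.transpose ?n (Suc ?n) i)" for i
    by (auto simp: nth_append Transposition.transpose_def nth_Cons split: nat.splits)
  moreover have "?n < 2 * (length ?xs div 2)" "Suc ?n < 2 * (length ?xs div 2)"
    using assms by auto
  ultimately show ?thesis
    using pfaffian_compose_transpose[of ?n "length ?xs div 2" "Suc ?n" "\<lambda>i j. A (?xs ! i) (?xs ! j)"]
    by (simp add: pf_list_def)
qed

lemma pf_list_move: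
  assumes "even (length us + length ys + length vs + 1)"
  shows "pf_list A (us @ ys @ b # vs) = (- 1) ^ length ys * pf_list A (us @ b # ys @ vs)"
  using assms
proof (induction ys arbitrary: us)
  case (Cons y ys)
  have "pf_list A (us @ (y # ys) @ b # vs) = (- 1) ^ length ys * pf_list A (us @ y # b # ys @ vs)"
    using Cons.IH[of "us @ [y]"] Cons.prems by simp
  also have "\<dots> = - ((- 1) ^ length ys) * pf_list A (us @ b # y # ys @ vs)"
  proof -
    have "even (length us + Suc (length ys) + length vs + 1)" using Cons.prems by (simp only: list.size) presburger
    then have "even (length us + length (ys @ vs))" by (simp only: length_append) presburger
    then show ?thesis using pf_list_swap[of us "ys @ vs" A y b] by simp
  qed
  finally show ?case by simp
qed simp

text \<open>The index substitution of \<open>pfaffian_expand_last\<close> becomes a list update: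
  when a is matched with entry j, its former neighbour b takes that place.\<close>

lemma pf_list_expand_last:
  assumes skew: "\<And>i j. A j i = - A i j" and "even (length xs)"
  shows "pf_list A (xs @ [b, a]) = A b a * pf_list A xs
    - (\<Sum>j<length xs. A (xs ! j) a * pf_list A (xs[j := b]))"
proof -
  define m where "m = length xs div 2"
  have m: "length xs = 2 * m" using assms(2) by (auto simp: m_def)
  let ?zs = "xs @ [b, a]"
  let ?B = "\<lambda>i j. A (?zs ! i) (?zs ! j)"
  have n: "?zs ! (2 * m) = b" "?zs ! (2 * m + 1) = a" using m by (auto simp: nth_append)
  have "pfaffian (Suc m) ?B = ?B (2 * m) (2 * m + 1) * pfaffian m ?B - (\<Sum>j<2 * m. ?B j (2 * m + 1) *
          pfaffian m (\<lambda>i k. ?B (Transposition.transpose (2 * m) j i) (Transposition.transpose (2 * m) j k)))"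
    by (rule pfaffian_expand_last) (rule skew)
  also have "pfaffian m ?B = pf_list A xs"
    unfolding pf_list_def m_def[symmetric] using m by (intro pfaffian_cong) (auto simp: nth_append)
  also have "(\<Sum>j<2 * m. ?B j (2 * m + 1) *
          pfaffian m (\<lambda>i k. ?B (Transposition.transpose (2 * m) j i) (Transposition.transpose (2 * m) j k)))
      = (\<Sum>j<length xs. A (xs ! j) a * pf_list A (xs[j := b]))"
    unfolding m[symmetric]
  proof (intro sum.cong refl arg_cong2[where f = "(*)"])
    fix j assume j: "j \<in> {..<length xs}"
    then show "?B j (length xs + 1) = A (xs ! j) a" by (auto simp: nth_append)
    have "?zs ! Transposition.transpose (length xs) j i = xs[j := b] ! i" if "i < length xs" for i
      using that j by (auto simp: Transposition.transpose_def nth_append nth_list_update)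
    then show "pfaffian m (\<lambda>i k. ?B (Transposition.transpose (length xs) j i) (Transposition.transpose (length xs) j k)) = pf_list A (xs[j := b])"
      unfolding pf_list_def length_list_update m_def[symmetric] using m by (intro pfaffian_cong) auto
  qed
  finally show ?thesis
    using n m by (simp add: pf_list_def)
qed

definition remove_nth :: "nat \<Rightarrow> 'a list \<Rightarrow> 'a list" where
  "remove_nth j xs = take j xs @ drop (Suc j) xs"

lemma length_remove_nth [simp]: "j < length xs \<Longrightarrow> length (remove_nth j xs) = length xs - 1"
  by (auto simp: remove_nth_def)

lemma remove_nth_0 [simp]: "remove_nth 0 (x # xs) = xs"
  by (simp add: remove_nth_def)

lemma remove_nth_Suc [simp]: "remove_nth (Suc j) (x # xs) = x # remove_nth j xs"
  by (simp add: remove_nth_def)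

lemma remove_nth_append:
  "remove_nth j (xs @ ys) = (if j < length xs then remove_nth j xs @ ys else xs @ remove_nth (j - length xs) ys)"
  by (auto simp: remove_nth_def Suc_diff_le)

text \<open>Moving a between front and end passes an odd number of entries. Moving b from position j
  back to the end then turns \<open>zs[j := b]\<close> into the list with entry j removed, which
  produces the alternating sign.\<close>

lemma pf_list_expand_head:
  assumes skew: "\<And>i j. A j i = - A i j" and "odd (length xs)"
  shows "pf_list A (a # xs) = (\<Sum>j<length xs. (- 1) ^ j * A a (xs ! j) * pf_list A (remove_nth j xs))"
proof -
  obtain zs b where xs: "xs = zs @ [b]" using assms(2) by (cases xs rule: rev_cases) auto
  have ev: "even (length zs)" using assms(2) xs by simp
  have "pf_list A (a # xs) = - pf_list A (zs @ [b, a])"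
    using pf_list_move[of "[]" xs "[]" A a] assms(2) by (simp add: xs)
  also have "\<dots> = A a b * pf_list A zs - (\<Sum>j<length zs. A a (zs ! j) * pf_list A (zs[j := b]))"
    using skew[of a b] skew[of a] by (simp add: pf_list_expand_last[OF skew ev] sum_negf)
  also have "(\<Sum>j<length zs. A a (zs ! j) * pf_list A (zs[j := b]))
    = (\<Sum>j<length zs. - ((- 1) ^ j * A a (xs ! j) * pf_list A (remove_nth j xs)))"
  proof (intro sum.cong refl)
    fix j assume j: "j \<in> {..<length zs}"
    then have "zs[j := b] = take j zs @ b # drop (Suc j) zs" by (simp add: upd_conv_take_nth_drop)
    moreover have "remove_nth j xs = take j zs @ drop (Suc j) zs @ [b]"
      using j by (simp add: remove_nth_def xs)
    moreover have "pf_list A (take j zs @ drop (Suc j) zs @ [b])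
       = (- 1) ^ (length zs - Suc j) * pf_list A (take j zs @ b # drop (Suc j) zs)"
      using pf_list_move[of "take j zs" "drop (Suc j) zs" "[]" A b] ev j by simp
    moreover have "(- 1 :: complex) ^ j * (- 1) ^ (length zs - Suc j) = - 1"
    proof -
      have "odd (j + (length zs - Suc j))" using ev j by auto
      then show ?thesis by (simp only: power_add[symmetric]) (simp add: minus_one_power_iff)
    qed
    ultimately have "(- 1) ^ j * pf_list A (remove_nth j xs) = - pf_list A (zs[j := b])"
      by (metis mult.assoc mult_minus1)
    then show "A a (zs ! j) * pf_list A (zs[j := b]) = - ((- 1) ^ j * A a (xs ! j) * pf_list A (remove_nth j xs))"
      using j by (simp add: xs nth_append mult.left_commute[of _ "A a (zs ! j)"] mult.assoc)
  qed
  finally show ?thesis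
    using ev by (simp add: xs sum_negf remove_nth_append nth_append)
qed

text \<open>Expansion along the first index. Only entries \<open>A a b\<close> with a before b in
  the list occur, so an evaluation by induction may describe A for ordered pairs alone, as
  \<open>pf_rec_eps\<close> does.\<close>

fun pf_rec :: "('a \<Rightarrow> 'a \<Rightarrow> complex) \<Rightarrow> 'a list \<Rightarrow> complex" where
  "pf_rec A [] = 1"
| "pf_rec A (a # xs) = (\<Sum>j<length xs. (- 1) ^ j * A a (xs ! j) * pf_rec A (remove_nth j xs))"

lemma pf_list_eq_pf_rec:
  assumes skew: "\<And>a b. A b a = - A a b" and "even (length xs)"
  shows "pf_list A xs = pf_rec A xs"
  using assms
proof (induction A xs rule: pf_rec.induct)
  case (2 A a xs)
  from "2.prems"(2) have odd: "odd (length xs)" by simp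
  have "pf_list A (a # xs) = (\<Sum>j<length xs. (- 1) ^ j * A a (xs ! j) * pf_list A (remove_nth j xs))"
    by (rule pf_list_expand_head[OF "2.prems"(1) odd])
  also have "\<dots> = pf_rec A (a # xs)"
    unfolding pf_rec.simps
  proof (intro sum.cong refl arg_cong2[where f = "(*)"])
    fix j assume j: "j \<in> {..<length xs}"
    then have "even (length (remove_nth j xs))" using odd by simp
    then show "pf_list A (remove_nth j xs) = pf_rec A (remove_nth j xs)" by (rule "2.IH"[OF j "2.prems"(1)])
  qed
  finally show ?case .
qed simp

lemma minus_one_power_parity: "even m = even n \<Longrightarrow> (- 1 :: 'a::ring_1) ^ m = (- 1) ^ n"
  by (simp add: minus_one_power_iff)

lemma set_remove_nth: "set (remove_nth j xs) \<subseteq> set xs"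
  by (auto simp: remove_nth_def dest: in_set_takeD in_set_dropD)

lemma sorted_wrt_remove_nth: "sorted_wrt P xs \<Longrightarrow> sorted_wrt P (remove_nth j xs)"
proof (induction xs arbitrary: j)
  case (Cons x xs)
  then show ?case using set_remove_nth[of _ xs] by (cases j) auto
qed (simp add: remove_nth_def)

lemma map_remove_nth: "map f (remove_nth j xs) = remove_nth j (map f xs)"
  by (simp add: remove_nth_def take_map drop_map)

lemma pf_rec_cong:
  assumes "\<And>a b. a \<in> set xs \<Longrightarrow> b \<in> set xs \<Longrightarrow> A a b = B a b"
  shows "pf_rec A xs = pf_rec B xs"
  using assms
proof (induction A xs rule: pf_rec.induct)
  case (2 A a xs)
  show ?case unfolding pf_rec.simps
  proof (intro sum.cong refl arg_cong2[where f = "(*)"])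
    fix j assume j: "j \<in> {..<length xs}"
    then show "A a (xs ! j) = B a (xs ! j)" using "2.prems" by auto
    show "pf_rec A (remove_nth j xs) = pf_rec B (remove_nth j xs)"
      using set_remove_nth[of j xs] by (intro "2.IH"[OF j] "2.prems") auto
  qed
qed simp

lemma pf_rec_map: "pf_rec A (map f xs) = pf_rec (\<lambda>a b. A (f a) (f b)) xs"
proof (induction "\<lambda>a b. A (f a) (f b)" xs rule: pf_rec.induct)
  case (2 a xs)
  show ?case unfolding pf_rec.simps list.map length_map
  proof (intro sum.cong refl arg_cong2[where f = "(*)"])
    fix j assume j: "j \<in> {..<length xs}"
    then show "A (f a) (map f xs ! j) = A (f a) (f (xs ! j))" by simp
    show "pf_rec A (remove_nth j (map f xs)) = pf_rec (\<lambda>a b. A (f a) (f b)) (remove_nth j xs)"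
      using "2"[OF j] by (simp add: map_remove_nth)
  qed
qed simp

text \<open>Number of exchanges of neighbours that bring the S-entries to the front; its parity
  gives the sign of this shuffle.\<close>

fun inversions_before :: "('a \<Rightarrow> bool) \<Rightarrow> 'a list \<Rightarrow> nat" where
  "inversions_before S [] = 0"
| "inversions_before S (x # xs) = (if S x then 0 else length (filter S xs)) + inversions_before S xs"

lemma inversions_before_remove_nth_in:
  "j < length xs \<Longrightarrow> S (xs ! j) \<Longrightarrow>
    inversions_before S xs = inversions_before S (remove_nth j xs) + length (filter (\<lambda>x. \<not> S x) (take j xs))
    \<and> length (filter S xs) = Suc (length (filter S (remove_nth j xs)))
    \<and> filter (\<lambda>x. \<not> S x) (remove_nth j xs) = filter (\<lambda>x. \<not> S x) xs"
proof (induction xs arbitrary: j)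
  case (Cons x xs)
  then show ?case by (cases j) auto
qed simp

lemma inversions_before_remove_nth_out:
  "j < length xs \<Longrightarrow> \<not> S (xs ! j) \<Longrightarrow>
    inversions_before S xs + length (filter S (take j xs)) = inversions_before S (remove_nth j xs) + length (filter S xs)
    \<and> filter S (remove_nth j xs) = filter S xs"
proof (induction xs arbitrary: j)
  case (Cons x xs)
  then show ?case by (cases j) auto
qed simp

text \<open>Position j of the whole list corresponds in the filtered list to the number of S-entries
  before it. F receives this position because the sign in the expansion depends on it.\<close>

lemma sum_filter_remove_nth:
  "(\<Sum>i<length (filter S xs). F i (filter S xs ! i) (remove_nth i (filter S xs)))
   = (\<Sum>j<length xs. if S (xs ! j) then F (length (filter S (take j xs))) (xs ! j) (filter S (remove_nth j xs)) else (0::complex))"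
proof (induction xs arbitrary: F)
  case (Cons x xs)
  show ?case
  proof (cases "S x")
    case True
    then show ?thesis
      using Cons.IH[of "\<lambda>i a r. F (Suc i) a (x # r)"] by (simp add: sum.lessThan_Suc_shift del: sum.lessThan_Suc cong: if_cong)
  next
    case False
    then show ?thesis
      using Cons.IH[of F] by (simp add: sum.lessThan_Suc_shift del: sum.lessThan_Suc cong: if_cong)
  qed
qed simp

lemma length_filter_take:
  "j \<le> length xs \<Longrightarrow> length (filter S (take j xs)) + length (filter (\<lambda>x. \<not> S x) (take j xs)) = j"
  using sum_length_filter_compl[of S "take j xs"] by simp

text \<open>In the expansion along the first entry only partners of its own class survive, and
  removing such a pair leaves a shorter list that splits in the same way. What has to be checked is
  that the sign of the position in the whole list becomes the sign of the position within the
  class.\<close>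

lemma pf_rec_split:
  assumes "\<And>a b. S a \<noteq> S b \<Longrightarrow> A a b = 0"
  shows "pf_rec A xs = (- 1) ^ inversions_before S xs * pf_rec A (filter S xs) * pf_rec A (filter (\<lambda>x. \<not> S x) xs)"
  using assms
proof (induction A xs rule: pf_rec.induct)
  case (2 A a xs)
  note IH = "2.IH"[OF _ "2.prems"]
  show ?case
  proof (cases "S a")
    case True
    have "pf_rec A (a # xs) = (\<Sum>j<length xs. if S (xs ! j)
       then (- 1) ^ inversions_before S xs * ((- 1) ^ length (filter S (take j xs)) * A a (xs ! j) * pf_rec A (filter S (remove_nth j xs)))
         * pf_rec A (filter (\<lambda>x. \<not> S x) xs) else 0)"
      unfolding pf_rec.simps
    proof (intro sum.cong refl)
      fix j assume j: "j \<in> {..<length xs}"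
      show "(- 1) ^ j * A a (xs ! j) * pf_rec A (remove_nth j xs) = (if S (xs ! j)
       then (- 1) ^ inversions_before S xs * ((- 1) ^ length (filter S (take j xs)) * A a (xs ! j) * pf_rec A (filter S (remove_nth j xs)))
         * pf_rec A (filter (\<lambda>x. \<not> S x) xs) else 0)"
      proof (cases "S (xs ! j)")
        case Sj: True
        let ?b = "length (filter S (take j xs))" and ?c = "length (filter (\<lambda>x. \<not> S x) (take j xs))"
        have jb: "j = ?b + ?c" using length_filter_take[of j xs S] j by simp
        have "(- 1 :: complex) ^ j * (- 1) ^ inversions_before S (remove_nth j xs) = (- 1) ^ inversions_before S xs * (- 1) ^ ?b"
        proof -
          have "j + inversions_before S (remove_nth j xs) = inversions_before S xs + ?b"
            using inversions_before_remove_nth_in[of j xs S] j Sj jb by simp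
          then show ?thesis by (metis power_add)
        qed
        then show ?thesis
          using IH[OF j] inversions_before_remove_nth_in[of j xs S] j Sj by (simp add: algebra_simps)
      next
        case False
        then show ?thesis using True "2.prems"[of a "xs ! j"] by simp
      qed
    qed
    also have "\<dots> = (\<Sum>j<length xs. (- 1) ^ inversions_before S xs * pf_rec A (filter (\<lambda>x. \<not> S x) xs) * (if S (xs ! j)
       then (- 1) ^ length (filter S (take j xs)) * A a (xs ! j) * pf_rec A (filter S (remove_nth j xs)) else 0))"
      by (intro sum.cong refl) simp
    also have "\<dots> = (- 1) ^ inversions_before S xs * pf_rec A (filter (\<lambda>x. \<not> S x) xs) * pf_rec A (filter S (a # xs))"
      using True sum_filter_remove_nth[of "\<lambda>i b r. (- 1) ^ i * A a b * pf_rec A r" S xs]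
      by (simp add: sum_distrib_left)
    finally show ?thesis using True by simp
  next
    case False
    let ?N = "\<lambda>x. \<not> S x"
    have "pf_rec A (a # xs) = (\<Sum>j<length xs. if ?N (xs ! j)
       then (- 1) ^ inversions_before S (a # xs) * ((- 1) ^ length (filter ?N (take j xs)) * A a (xs ! j) * pf_rec A (filter ?N (remove_nth j xs)))
         * pf_rec A (filter S xs) else 0)"
      unfolding pf_rec.simps
    proof (intro sum.cong refl)
      fix j assume j: "j \<in> {..<length xs}"
      show "(- 1) ^ j * A a (xs ! j) * pf_rec A (remove_nth j xs) = (if ?N (xs ! j)
       then (- 1) ^ inversions_before S (a # xs) * ((- 1) ^ length (filter ?N (take j xs)) * A a (xs ! j) * pf_rec A (filter ?N (remove_nth j xs)))
         * pf_rec A (filter S xs) else 0)"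
      proof (cases "S (xs ! j)")
        case Sj: False
        let ?b = "length (filter S (take j xs))" and ?c = "length (filter (\<lambda>x. \<not> S x) (take j xs))"
        have jb: "j = ?b + ?c" using length_filter_take[of j xs S] j by simp
        have "(- 1 :: complex) ^ j * (- 1) ^ inversions_before S (remove_nth j xs) = (- 1) ^ inversions_before S (a # xs) * (- 1) ^ ?c"
        proof -
          \<comment> \<open>Here b and c count the entries before j inside and outside S, q counts
            the S-entries of the tail, and n and r are the inversion counts of the tail before and
            after the removal. The head lies outside S and adds q; removing entry j takes away q -
            b; so q cancels modulo 2.\<close>
          have par: "even (b + c + r) = even (i + c)" if "i = q + n" "n + b = r + q" for b c i n q r :: nat
            using that by presburger
          have "inversions_before S (a # xs) = length (filter S xs) + inversions_before S xs"
            using False by simp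
          moreover have "inversions_before S xs + ?b = inversions_before S (remove_nth j xs) + length (filter S xs)"
            using inversions_before_remove_nth_out[of j xs S] j Sj by simp
          ultimately have "even (?b + ?c + inversions_before S (remove_nth j xs)) = even (inversions_before S (a # xs) + ?c)"
            by (rule par)
          then have "even (j + inversions_before S (remove_nth j xs)) = even (inversions_before S (a # xs) + ?c)"
            by (simp only: jb[symmetric])
          then show ?thesis unfolding power_add[symmetric] by (rule minus_one_power_parity)
        qed
        then show ?thesis
          using IH[OF j] inversions_before_remove_nth_out[of j xs S] j Sj by (simp add: algebra_simps)
      next
        case True
        then show ?thesis using False "2.prems"[of a "xs ! j"] by simp
      qed
    qed
    also have "\<dots> = (\<Sum>j<length xs. (- 1) ^ inversions_before S (a # xs) * pf_rec A (filter S xs) * (if ?N (xs ! j)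
       then (- 1) ^ length (filter ?N (take j xs)) * A a (xs ! j) * pf_rec A (filter ?N (remove_nth j xs)) else 0))"
      by (intro sum.cong refl) simp
    also have "\<dots> = (- 1) ^ inversions_before S (a # xs) * pf_rec A (filter S xs) * pf_rec A (filter ?N (a # xs))"
      using False sum_filter_remove_nth[of "\<lambda>i b r. (- 1) ^ i * A a b * pf_rec A r" ?N xs]
      by (simp add: sum_distrib_left)
    finally show ?thesis using False by simp
  qed
qed simp

section \<open>The Pfaffian of the epsilon matrix\<close>

fun alternating :: "('a \<Rightarrow> bool) \<Rightarrow> 'a list \<Rightarrow> bool" where
  "alternating od [] = True"
| "alternating od [a] = False"
| "alternating od (a # b # xs) = (od a \<and> \<not> od b \<and> alternating od xs)"

context
  fixes A :: "'a \<Rightarrow> 'a \<Rightarrow> complex" and od :: "'a \<Rightarrow> bool" and R :: "'a \<Rightarrow> 'a \<Rightarrow> bool"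
  assumes R: "\<And>a b. R a b \<Longrightarrow> A a b = (if od a \<and> \<not> od b then 1 else 0)"
begin

lemma pf_rec_eps_even_head:
  assumes "sorted_wrt R (a # xs)" "\<not> od a"
  shows "pf_rec A (a # xs) = 0"
  unfolding pf_rec.simps using assms R[of a] by (intro sum.neutral) auto

text \<open>Any partner of a other than b leaves a list headed by the even entry b, whose row
  vanishes.\<close>

lemma pf_rec_eps_odd_even:
  assumes "sorted_wrt R (a # b # xs)" "od a" "\<not> od b"
  shows "pf_rec A (a # b # xs) = pf_rec A xs"
proof -
  have "pf_rec A (b # remove_nth j xs) = 0" for j
    using assms set_remove_nth[of j xs]
    by (intro pf_rec_eps_even_head) (auto simp: sorted_wrt_remove_nth)
  then show ?thesis
    using assms R[of a b]
    by (simp only: pf_rec.simps(2)[of A a] length_Cons sum.lessThan_Suc_shift) (simp del: pf_rec.simps(2) sum.lessThan_Suc)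
qed

text \<open>On the remaining entries a and b have the same row. If the next entry c is odd, a term
  either pairs a with an odd entry or leaves two odd entries in front. If c is even, the term
  pairing a with c is minus the expansion of \<open>b # ys\<close>, and the terms giving a a later
  partner, where b and c then form a pair, add up to that same expansion.\<close>

lemma pf_rec_eps_odd_odd:
  assumes "sorted_wrt R (a # b # xs)" "od a" "od b"
  shows "pf_rec A (a # b # xs) = 0"
  using assms
proof (induction "length xs" arbitrary: a b xs rule: less_induct)
  case less
  have Ra: "A a c = (if od c then 0 else 1)" if "c \<in> set (b # xs)" for c
    using less.prems that by (auto simp: R)
  show ?case
  proof (cases xs)
    case Nil
    then show ?thesis using less.prems Ra by simp
  next
    case (Cons c ys)
    have exp: "pf_rec A (a # b # xs) = - A a c * pf_rec A (b # ys)
        + (\<Sum>j<length ys. (- 1) ^ j * A a (ys ! j) * pf_rec A (b # c # remove_nth j ys))"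
      using Ra[of b] less.prems unfolding Cons
      by (simp only: pf_rec.simps(2)[of A a] length_Cons sum.lessThan_Suc_shift) (simp del: pf_rec.simps(2) sum.lessThan_Suc)
    have rem: "sorted_wrt R (b # c # remove_nth j ys)" for j
      using less.prems set_remove_nth[of j ys] unfolding Cons by (auto simp: sorted_wrt_remove_nth)
    show ?thesis
    proof (cases "od c")
      case True
      have "pf_rec A (b # c # remove_nth j ys) = 0" if "j < length ys" for j
        using that rem True less.prems Cons by (intro less.hyps) auto
      then show ?thesis using exp Ra[of c] True Cons by (simp del: pf_rec.simps(2))
    next
      case False
      have "pf_rec A (b # c # remove_nth j ys) = pf_rec A (remove_nth j ys)" for j
        using rem less.prems False by (intro pf_rec_eps_odd_even) auto
      moreover have "A a (ys ! j) = A b (ys ! j)" if "j < length ys" for j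
      proof -
        have "ys ! j \<in> set xs" using that Cons by simp
        then show ?thesis using less.prems Ra[of "ys ! j"] by (auto simp: R)
      qed
      ultimately show ?thesis using exp Ra[of c] False Cons pf_rec.simps(2)[of A b ys]
        by (simp del: pf_rec.simps(2) sum.lessThan_Suc)
    qed
  qed
qed

lemma pf_rec_eps:
  assumes "sorted_wrt R xs"
  shows "pf_rec A xs = (if alternating od xs then 1 else 0)"
  using assms
proof (induction xs rule: induct_list012)
  case (3 a b xs)
  then have "pf_rec A xs = (if alternating od xs then 1 else 0)" by simp
  consider "\<not> od a" | "od a" "od b" | "od a" "\<not> od b" by blast
  then show ?case
  proof cases
    case 1
    then show ?thesis using pf_rec_eps_even_head[OF "3.prems"] by (simp only: alternating.simps simp_thms if_False)
  next
    case 2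
    then show ?thesis using pf_rec_eps_odd_odd[OF "3.prems"] by (simp only: alternating.simps simp_thms if_False)
  next
    case 3
    then show ?thesis using pf_rec_eps_odd_even[OF "3.prems"] \<open>pf_rec A xs = _\<close> by (simp only: alternating.simps simp_thms)
  qed
qed auto

end

section \<open>Divided differences\<close>

text \<open>Lagrange form of the divided difference. On the power u^k it is the complete homogeneous
  symmetric polynomial of degree k - |X| + 1 in the nodes; degrees 0, 1 and 2 are the ones computed
  below.\<close>

definition divided_difference :: "'a::field set \<Rightarrow> ('a \<Rightarrow> 'a) \<Rightarrow> 'a" where
  "divided_difference X f = (\<Sum>x\<in>X. f x / (\<Prod>y\<in>X - {x}. x - y))"

lemma divided_difference_cmult:
  "divided_difference X (\<lambda>u. c * f u) = c * divided_difference X f"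
  by (simp add: divided_difference_def sum_distrib_left)

lemma divided_difference_diff:
  "divided_difference X (\<lambda>u. f u - g u) = divided_difference X f - divided_difference X g"
  by (simp add: divided_difference_def sum_subtractf diff_divide_distrib)

text \<open>The factor u - y annihilates the term of the node y and cancels one factor in every
  other denominator.\<close>

lemma divided_difference_node:
  assumes "finite X" "y \<in> X"
  shows "divided_difference X (\<lambda>u. (u - y) * f u) = divided_difference (X - {y}) f"
proof -
  have "divided_difference X (\<lambda>u. (u - y) * f u) = (\<Sum>x\<in>X - {y}. (x - y) * f x / (\<Prod>w\<in>X - {x}. x - w))"
    unfolding divided_difference_def using assms by (subst sum.remove[of X y]) auto
  also have "\<dots> = divided_difference (X - {y}) f"
    unfolding divided_difference_def
  proof (intro sum.cong refl)
    fix x assume x: "x \<in> X - {y}"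
    have "X - {x} - {y} = X - {y} - {x}" by auto
    then have "(\<Prod>w\<in>X - {x}. x - w) = (x - y) * (\<Prod>w\<in>X - {y} - {x}. x - w)"
      using assms x by (subst prod.remove[of "X - {x}" y]) auto
    then show "(x - y) * f x / (\<Prod>w\<in>X - {x}. x - w) = f x / (\<Prod>w\<in>X - {y} - {x}. x - w)"
      using x by simp
  qed
  finally show ?thesis .
qed

text \<open>For two nodes y and w the constant w - y is the difference of u - y and u - w, and each
  of these removes a node. What remains is a difference of two equal values: 1 if there were two
  nodes, 0 by induction otherwise.\<close>

lemma divided_difference_const:
  assumes "finite X" "card X \<ge> 2"
  shows "divided_difference X (\<lambda>u. 1) = 0"
  using assms
proof (induction "card X" arbitrary: X rule: less_induct)
  case less
  obtain y where y: "y \<in> X" using less.prems by fastforce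
  have "card (X - {y}) \<ge> 1" using less.prems y by simp
  then obtain w where w: "w \<in> X" "w \<noteq> y" by (metis Diff_iff card.empty empty_iff equals0I insertI1 not_one_le_zero)
  have *: "(\<lambda>u. (u - y) * 1 - (u - w) * 1) = (\<lambda>u. (w - y) * (1::'a))" by (simp add: fun_eq_iff)
  have "(w - y) * divided_difference X (\<lambda>u. 1) = divided_difference (X - {y}) (\<lambda>u. 1) - divided_difference (X - {w}) (\<lambda>u. 1)"
    using divided_difference_node[OF less.prems(1) y, of "\<lambda>u. 1"]
      divided_difference_node[OF less.prems(1) w(1), of "\<lambda>u. 1"]
    by (simp only: divided_difference_cmult[symmetric] *[symmetric] divided_difference_diff)
  also have "\<dots> = 0"
  proof (cases "card X = 2")
    case True
    then have "X = {y, w}" using y w less.prems(1)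
      by (metis card_2_iff doubleton_eq_iff insert_iff singletonD)
    then have "X - {y} = {w}" "X - {w} = {y}" using w by auto
    then show ?thesis by (simp add: divided_difference_def)
  next
    case False
    then have "card X > 2" using less.prems by simp
    then have "card (X - {y}) \<ge> 2 \<and> card (X - {y}) < card X" "card (X - {w}) \<ge> 2 \<and> card (X - {w}) < card X"
      using y w less.prems(1) by auto
    then show ?thesis using less.hyps[of "X - {y}"] less.hyps[of "X - {w}"] less.prems(1) by simp
  qed
  finally show ?case using w by simp
qed

text \<open>Recurrence of the complete homogeneous polynomials that separates the monomials without
  y from those divisible by y.\<close>

lemma divided_difference_Suc_power:
  assumes "finite X" "y \<in> X"
  shows "divided_difference X (\<lambda>u. u ^ Suc k)
    = divided_difference (X - {y}) (\<lambda>u. u ^ k) + y * divided_difference X (\<lambda>u. u ^ k)"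
proof -
  have "(\<lambda>u. u ^ Suc k - y * u ^ k) = (\<lambda>u::'a. (u - y) * u ^ k)" by (simp add: fun_eq_iff algebra_simps)
  then have "divided_difference X (\<lambda>u. u ^ Suc k) - y * divided_difference X (\<lambda>u. u ^ k)
     = divided_difference X (\<lambda>u. (u - y) * u ^ k)"
    by (simp only: divided_difference_cmult[symmetric] divided_difference_diff[symmetric])
  then show ?thesis using divided_difference_node[OF assms, of "\<lambda>u. u ^ k"] by (simp add: algebra_simps)
qed

lemma divided_difference_power_less:
  assumes "finite X" "k + 1 < card X"
  shows "divided_difference X (\<lambda>u. u ^ k) = 0"
  using assms
proof (induction k arbitrary: X)
  case 0
  then show ?case using divided_difference_const[of X] by simp
next
  case (Suc k)
  then obtain y where y: "y \<in> X" by fastforce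
  then show ?case
    using Suc.prems Suc.IH[of X] Suc.IH[of "X - {y}"] by (simp add: divided_difference_Suc_power[OF Suc.prems(1) y] del: power_Suc)
qed

lemma divided_difference_power_eq:
  assumes "finite X" "k + 1 = card X"
  shows "divided_difference X (\<lambda>u. u ^ k) = 1"
  using assms
proof (induction k arbitrary: X)
  case 0
  then obtain a where "X = {a}" by (metis add_0 card_1_singletonE)
  then show ?case by (simp add: divided_difference_def)
next
  case (Suc k)
  then obtain y where y: "y \<in> X" by fastforce
  then show ?case
    using Suc.prems Suc.IH[of "X - {y}"] divided_difference_power_less[of X k]
    by (simp add: divided_difference_Suc_power[OF Suc.prems(1) y] del: power_Suc)
qed

lemma divided_difference_power_h1:
  assumes "finite X" "k = card X" "X \<noteq> {}"
  shows "divided_difference X (\<lambda>u. u ^ k) = (\<Sum>x\<in>X. x)"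
  using assms
proof (induction k arbitrary: X)
  case (Suc k)
  then obtain y where y: "y \<in> X" by fastforce
  show ?case
  proof (cases "X - {y} = {}")
    case True
    then have "X = {y}" using y by auto
    then show ?thesis using Suc.prems by (simp add: divided_difference_def)
  next
    case False
    have "divided_difference (X - {y}) (\<lambda>u. u ^ k) = (\<Sum>x\<in>X. x) - y"
      using False y Suc.prems Suc.IH[of "X - {y}"] by (simp add: sum_diff1 flip: Suc.prems(2))
    moreover have "divided_difference X (\<lambda>u. u ^ k) = 1"
      using Suc.prems by (intro divided_difference_power_eq) auto
    ultimately show ?thesis
      by (simp add: divided_difference_Suc_power[OF Suc.prems(1) y] del: power_Suc)
  qed
qed simp

text \<open>In power sums, twice the complete homogeneous polynomial of degree 2 is p_1^2 +
  p_2.\<close>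

lemma divided_difference_power_h2:
  fixes X :: "'a::field_char_0 set"
  assumes "finite X" "k = card X + 1" "X \<noteq> {}"
  shows "2 * divided_difference X (\<lambda>u. u ^ k) = (\<Sum>x\<in>X. x)\<^sup>2 + (\<Sum>x\<in>X. x\<^sup>2)"
  using assms
proof (induction k arbitrary: X)
  case (Suc k)
  then obtain y where y: "y \<in> X" by fastforce
  show ?case
  proof (cases "X - {y} = {}")
    case True
    then have "X = {y}" using y by auto
    then show ?thesis using Suc.prems by (simp add: divided_difference_def power2_eq_square)
  next
    case False
    have "2 * divided_difference (X - {y}) (\<lambda>u. u ^ k) = ((\<Sum>x\<in>X. x) - y)\<^sup>2 + ((\<Sum>x\<in>X. x\<^sup>2) - y\<^sup>2)"
    proof -
      have "card X > 0" using Suc.prems by (simp add: card_gt_0_iff)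
      then have "k = card (X - {y}) + 1" using y Suc.prems by simp
      then show ?thesis using False y Suc.prems(1) Suc.IH[of "X - {y}"] by (simp add: sum_diff1)
    qed
    moreover have "divided_difference X (\<lambda>u. u ^ k) = (\<Sum>x\<in>X. x)"
      using Suc.prems by (intro divided_difference_power_h1) auto
    ultimately show ?thesis
      by (simp add: divided_difference_Suc_power[OF Suc.prems(1) y] distrib_left del: power_Suc)
         (simp add: power2_eq_square algebra_simps)
  qed
qed simp

lemma divided_difference_prod_step:
  assumes "finite J" "a \<notin> J"
  shows "divided_difference X (\<lambda>u. u ^ k * (\<Prod>j\<in>insert a J. u - b j))
    = divided_difference X (\<lambda>u. u ^ Suc k * (\<Prod>j\<in>J. u - b j))
      - b a * divided_difference X (\<lambda>u. u ^ k * (\<Prod>j\<in>J. u - b j))"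
proof -
  have "(\<lambda>u. u ^ k * (\<Prod>j\<in>insert a J. u - b j))
      = (\<lambda>u. u ^ Suc k * (\<Prod>j\<in>J. u - b j) - b a * (u ^ k * (\<Prod>j\<in>J. u - b j)))"
    using assms by (simp add: fun_eq_iff algebra_simps)
  then show ?thesis by (simp only: divided_difference_cmult divided_difference_diff)
qed

lemma divided_difference_prod_less:
  assumes "finite J" "finite X" "card J + k + 1 < card X"
  shows "divided_difference X (\<lambda>u. u ^ k * (\<Prod>j\<in>J. u - b j)) = 0"
  using assms
proof (induction J arbitrary: k rule: finite_induct)
  case empty
  then show ?case using divided_difference_power_less[of X k] by simp
next
  case (insert a J)
  then show ?case using insert.IH[of k] insert.IH[of "Suc k"]
    unfolding divided_difference_prod_step[OF insert.hyps] by simp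
qed

lemma divided_difference_prod_eq:
  assumes "finite J" "finite X" "card J + k + 1 = card X"
  shows "divided_difference X (\<lambda>u. u ^ k * (\<Prod>j\<in>J. u - b j)) = 1"
  using assms
proof (induction J arbitrary: k rule: finite_induct)
  case empty
  then show ?case using divided_difference_power_eq[of X k] by simp
next
  case (insert a J)
  then show ?case using insert.IH[of "Suc k"] divided_difference_prod_less[of J X k b]
    unfolding divided_difference_prod_step[OF insert.hyps] by simp
qed

lemma divided_difference_prod_h1:
  assumes "finite J" "finite X" "card J + k = card X" "X \<noteq> {}"
  shows "divided_difference X (\<lambda>u. u ^ k * (\<Prod>j\<in>J. u - b j)) = (\<Sum>x\<in>X. x) - (\<Sum>j\<in>J. b j)"
  using assms
proof (induction J arbitrary: k rule: finite_induct)
  case empty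
  then show ?case using divided_difference_power_h1[of X k] by simp
next
  case (insert a J)
  then show ?case using insert.IH[of "Suc k"] divided_difference_prod_eq[of J X k b]
    unfolding divided_difference_prod_step[OF insert.hyps(1,2)] by simp
qed

text \<open>The zeros \<open>b j\<close> enter as a negative alphabet: the expression is again p_1^2
  + p_2, with each power sum of the nodes diminished by that of the zeros. Peeling off one zero
  leaves a summand of the same degree and one of degree one less, which falls under
  \<open>divided_difference_prod_h1\<close>.\<close>

lemma divided_difference_prod_h2:
  fixes X :: "'a::field_char_0 set"
  assumes "finite J" "finite X" "card J + k = card X + 1" "X \<noteq> {}"
  shows "2 * divided_difference X (\<lambda>u. u ^ k * (\<Prod>j\<in>J. u - b j))
    = ((\<Sum>x\<in>X. x) - (\<Sum>j\<in>J. b j))\<^sup>2 + ((\<Sum>x\<in>X. x\<^sup>2) - (\<Sum>j\<in>J. (b j)\<^sup>2))"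
  using assms
proof (induction J arbitrary: k rule: finite_induct)
  case empty
  then show ?case using divided_difference_power_h2[of X k] by simp
next
  case (insert a J)
  have "2 * divided_difference X (\<lambda>u. u ^ Suc k * (\<Prod>j\<in>J. u - b j))
    = ((\<Sum>x\<in>X. x) - (\<Sum>j\<in>J. b j))\<^sup>2 + ((\<Sum>x\<in>X. x\<^sup>2) - (\<Sum>j\<in>J. (b j)\<^sup>2))"
    using insert.prems insert.hyps by (intro insert.IH) auto
  moreover have "divided_difference X (\<lambda>u. u ^ k * (\<Prod>j\<in>J. u - b j)) = (\<Sum>x\<in>X. x) - (\<Sum>j\<in>J. b j)"
    using insert.prems insert.hyps by (intro divided_difference_prod_h1) auto
  ultimately show ?case
    unfolding divided_difference_prod_step[OF insert.hyps(1,2)] right_diff_distrib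
    using insert.hyps
    by (simp only: mult.left_commute[of 2 "b a"] sum.insert) (simp add: power2_eq_square algebra_simps)
qed

section \<open>Cauchy Pfaffians\<close>

lemma prod_pairs_remove:
  fixes h :: "'a::linorder \<Rightarrow> 'a \<Rightarrow> 'b::comm_monoid_mult"
  assumes sym: "\<And>a b. h a b = h b a" and i: "i \<in> I" "finite I"
  shows "(\<Prod>(a, b)\<in>{(a, b). a \<in> I \<and> b \<in> I \<and> a < b}. h a b)
    = (\<Prod>(a, b)\<in>{(a, b). a \<in> I - {i} \<and> b \<in> I - {i} \<and> a < b}. h a b) * (\<Prod>k\<in>I - {i}. h i k)"
proof -
  let ?P = "\<lambda>I. {(a, b). a \<in> I \<and> b \<in> I \<and> a < (b::'a)}" and ?f = "\<lambda>(a, b). h a b"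
  have fin: "finite (?P J)" if "finite J" for J
    by (rule finite_subset[of _ "J \<times> J"]) (use that in auto)
  have e: "?P I = (?P (I - {i}) \<union> (\<lambda>k. (i, k)) ` {k \<in> I. k > i}) \<union> (\<lambda>k. (k, i)) ` {k \<in> I. k < i}"
    using i by auto
  have "prod ?f (?P I) = prod ?f (?P (I - {i}) \<union> (\<lambda>k. (i, k)) ` {k \<in> I. k > i}) * prod ?f ((\<lambda>k. (k, i)) ` {k \<in> I. k < i})"
    unfolding e by (intro prod.union_disjoint) (use i fin[of "I - {i}"] in auto)
  also have "prod ?f (?P (I - {i}) \<union> (\<lambda>k. (i, k)) ` {k \<in> I. k > i}) = prod ?f (?P (I - {i})) * prod ?f ((\<lambda>k. (i, k)) ` {k \<in> I. k > i})"
    by (intro prod.union_disjoint) (use i fin[of "I - {i}"] in auto)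
  also have "prod ?f ((\<lambda>k. (i, k)) ` {k \<in> I. k > i}) = (\<Prod>k\<in>{k \<in> I. k > i}. h i k)"
    by (subst prod.reindex) (auto intro: inj_onI)
  also have "prod ?f ((\<lambda>k. (k, i)) ` {k \<in> I. k < i}) = (\<Prod>k\<in>{k \<in> I. k < i}. h i k)"
    by (subst prod.reindex) (auto intro: inj_onI intro!: prod.cong sym)
  also have "prod ?f (?P (I - {i})) * (\<Prod>k\<in>{k \<in> I. k > i}. h i k) * (\<Prod>k\<in>{k \<in> I. k < i}. h i k)
    = prod ?f (?P (I - {i})) * (\<Prod>k\<in>{k \<in> I. k > i} \<union> {k \<in> I. k < i}. h i k)"
    using i by (subst prod.union_disjoint) (auto simp: mult.assoc)
  also have "{k \<in> I. k > i} \<union> {k \<in> I. k < i} = I - {i}" by auto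
  finally show ?thesis .
qed

definition vandermonde :: "real set \<Rightarrow> real" where
  "vandermonde S = (\<Prod>(a, b)\<in>{(a, b). a \<in> S \<and> b \<in> S \<and> a < b}. b - a)"

lemma vandermonde_remove:
  assumes "finite S" "v \<in> S"
  shows "vandermonde S = vandermonde (S - {v}) * (\<Prod>w\<in>S - {v}. \<bar>w - v\<bar>)"
proof -
  have V: "vandermonde T = (\<Prod>(a, b)\<in>{(a, b). a \<in> T \<and> b \<in> T \<and> a < b}. \<bar>b - a\<bar>)" for T
    unfolding vandermonde_def by (intro prod.cong) auto
  show ?thesis
    unfolding V by (rule prod_pairs_remove[OF _ assms(2,1)]) (rule abs_minus_commute)
qed

text \<open>The sign counts the points above \<open>vs ! l\<close>, where the absolute value in
  \<open>vandermonde_remove\<close> reverses the difference.\<close>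

lemma vandermonde_nth:
  assumes "sorted_wrt (<) vs" "l < length vs"
  shows "vandermonde (set vs) = (- 1) ^ (length vs - 1 - l) * vandermonde (set vs - {vs ! l}) * (\<Prod>w\<in>set vs - {vs ! l}. vs ! l - w)"
proof -
  let ?v = "vs ! l" and ?S = "set vs"
  have d: "distinct vs" using assms(1) strict_sorted_iff by blast
  have "{w \<in> ?S. w > ?v} = set (drop (Suc l) vs)"
  proof -
    have vs: "vs = take l vs @ ?v # drop (Suc l) vs" using assms(2) by (rule id_take_nth_drop)
    have "sorted_wrt (<) (take l vs @ ?v # drop (Suc l) vs)" using assms(1) vs by simp
    then have "\<forall>x\<in>set (take l vs). x < ?v" "\<forall>x\<in>set (drop (Suc l) vs). ?v < x"
      by (auto simp: sorted_wrt_append)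
    moreover have "?S = set (take l vs) \<union> {?v} \<union> set (drop (Suc l) vs)" by (subst vs) (auto simp del: append_take_drop_id)
    ultimately show ?thesis by fastforce
  qed
  then have c: "card {w \<in> ?S. w > ?v} = length vs - 1 - l"
    using d by (simp add: distinct_card)
  have "(\<Prod>w\<in>?S - {?v}. \<bar>w - ?v\<bar>) = (\<Prod>w\<in>?S - {?v}. (if w > ?v then - 1 else 1) * (?v - w))"
    by (intro prod.cong refl) auto
  also have "\<dots> = (\<Prod>w\<in>?S - {?v}. (if w > ?v then - 1 else 1)) * (\<Prod>w\<in>?S - {?v}. ?v - w)"
    by (rule prod.distrib)
  also have "(\<Prod>w\<in>?S - {?v}. (if w > ?v then - 1 else 1 :: real)) = (- 1) ^ card {w \<in> ?S. w > ?v}"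
  proof -
    have "(\<Prod>w\<in>?S - {?v}. (if w > ?v then - 1 else 1 :: real)) = (\<Prod>w\<in>{w \<in> ?S. w > ?v}. - 1)"
      by (rule prod.mono_neutral_cong_right) auto
    then show ?thesis by simp
  qed
  finally show ?thesis
    using vandermonde_remove[of ?S ?v] assms(2) c by simp
qed

definition cauchy_matrix :: "(real \<Rightarrow> complex) \<Rightarrow> real \<Rightarrow> real \<Rightarrow> complex" where
  "cauchy_matrix h p q = (if (p < 0) = (q < 0) then 0 else h p * h q / of_real (p - q))"

lemma divide_of_real_diff_swap: "c / complex_of_real (q - p) = - (c / of_real (p - q))"
  by (metis divide_minus_right minus_diff_eq of_real_minus)

lemma cauchy_matrix_skew: "cauchy_matrix h q p = - cauchy_matrix h p q"
  by (simp add: cauchy_matrix_def mult.commute divide_of_real_diff_swap[of _ p q] del: of_real_diff)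

lemma sum_lessThan_add: "(\<Sum>j<m + n. f j) = (\<Sum>j<m. f j) + (\<Sum>l<n. f (m + l :: nat) :: 'a::comm_monoid_add)"
  by (induction n) (auto simp: add.assoc)

lemma pf_rec_cauchy_Cons:
  assumes "\<And>x. x \<in> set xs \<Longrightarrow> x < 0" "x < 0"
  shows "pf_rec (cauchy_matrix h) ((x # xs) @ vs)
    = (\<Sum>l<length vs. (- 1) ^ (length xs + l) * cauchy_matrix h x (vs ! l) * pf_rec (cauchy_matrix h) (xs @ remove_nth l vs))"
proof -
  have "(\<Sum>j<length xs. (- 1) ^ j * cauchy_matrix h x ((xs @ vs) ! j) * pf_rec (cauchy_matrix h) (remove_nth j (xs @ vs))) = 0"
    using assms by (intro sum.neutral) (auto simp: cauchy_matrix_def nth_append)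
  then show ?thesis
    by (simp add: sum_lessThan_add remove_nth_append del: sum.lessThan_Suc)
qed

text \<open>Every negative point needs a positive partner. If positive points are left over, the
  first of them has a zero row; if a negative point finds none, its expansion is empty.\<close>

lemma pf_rec_cauchy_unbalanced:
  assumes "\<And>x. x \<in> set xs \<Longrightarrow> x < 0" "\<And>v. v \<in> set vs \<Longrightarrow> v > 0" "length xs \<noteq> length vs"
  shows "pf_rec (cauchy_matrix h) (xs @ vs) = 0"
  using assms
proof (induction xs arbitrary: vs)
  case Nil
  then obtain v ws where "vs = v # ws" by (cases vs) auto
  moreover have "cauchy_matrix h v (ws ! j) = 0" if "j < length ws" for j
    using Nil.prems(2)[of v] Nil.prems(2)[of "ws ! j"] that calculation by (auto simp: cauchy_matrix_def)
  ultimately show ?case by simp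
next
  case (Cons x xs)
  have "pf_rec (cauchy_matrix h) (xs @ remove_nth l vs) = 0" if "l < length vs" for l
    using that Cons.prems set_remove_nth[of l vs] by (intro Cons.IH) auto
  then show ?case using Cons.prems(1) by (subst pf_rec_cauchy_Cons) auto
qed

text \<open>Pfaffian form of the Cauchy determinant. Expanding along x gives, up to a common factor,
  the terms at the nodes S of a divided difference of f(u), the product of u - x' over x' in X. Its
  degree n - 1 is too small for the n + 1 nodes of \<open>insert x S\<close>, so the full divided
  difference vanishes and the sum over S equals minus the term at x.\<close>

lemma pf_rec_cauchy:
  assumes "sorted_wrt (<) xs" "sorted_wrt (<) vs" "\<And>x. x \<in> set xs \<Longrightarrow> x < 0" "\<And>v. v \<in> set vs \<Longrightarrow> v > 0" "length xs = length vs"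
  shows "pf_rec (cauchy_matrix h) (xs @ vs) = (- 1) ^ length xs * (\<Prod>x\<in>set xs. h x) * (\<Prod>v\<in>set vs. h v) *
     of_real (vandermonde (set xs) * vandermonde (set vs) / (\<Prod>x\<in>set xs. \<Prod>v\<in>set vs. v - x))"
  using assms
proof (induction xs arbitrary: vs)
  case Nil
  then show ?case by (simp add: vandermonde_def)
next
  case (Cons x xs)
  define n where "n = length vs"
  define X where "X = set xs"
  define S where "S = set vs"
  define f where "f = (\<lambda>u. \<Prod>x'\<in>X. u - x')"
  define K where "K = vandermonde X * vandermonde S / (\<Prod>x\<in>X. \<Prod>v\<in>S. v - x)"
  define H where "H = h x * (\<Prod>x\<in>X. h x) * (\<Prod>v\<in>S. h v)"
  have n: "length xs = n - 1" "n > 0" "length xs + 1 = n" using Cons.prems(5) by (auto simp: n_def)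
  have fX: "finite X" "finite S" by (auto simp: X_def S_def)
  have dX: "x \<notin> X" "distinct xs" "distinct vs" "x \<notin> S"
    using Cons.prems(1,2) strict_sorted_iff[of xs] strict_sorted_iff[of vs] Cons.prems(3)[of x] Cons.prems(4)[of x]
    by (auto simp: X_def S_def)
  have cX: "card X + 1 = n" "card S = n" using dX n by (auto simp: X_def S_def n_def distinct_card)
  have Xneg: "x' < 0" if "x' \<in> insert x X" for x' using Cons.prems(3) that by (auto simp: X_def)
  have Spos: "v > 0" if "v \<in> S" for v using Cons.prems(4) that by (auto simp: S_def)
  have ne: "v \<noteq> x'" if "v \<in> S" "x' \<in> insert x X" for v x' using Xneg[OF that(2)] Spos[OF that(1)] by simp
  have trm: "(- 1) ^ (length xs + l) * cauchy_matrix h x (vs ! l) * pf_rec (cauchy_matrix h) (xs @ remove_nth l vs)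
     = (- 1) ^ n * H * of_real (K * (f (vs ! l) / (\<Prod>w\<in>insert x S - {vs ! l}. vs ! l - w)))" if l: "l < length vs" for l
  proof -
    define v where "v = vs ! l"
    have vS: "v \<in> S" using l by (simp add: v_def S_def)
    have setr: "set (remove_nth l vs) = S - {v}"
    proof -
      have vs: "vs = take l vs @ v # drop (Suc l) vs" unfolding v_def using l by (rule id_take_nth_drop)
      have "distinct (take l vs @ v # drop (Suc l) vs)" using dX(3) vs by simp
      moreover have "S = set (take l vs @ v # drop (Suc l) vs)" using vs by (simp add: S_def)
      ultimately show ?thesis by (auto simp: remove_nth_def)
    qed
    have IH: "pf_rec (cauchy_matrix h) (xs @ remove_nth l vs) = (- 1) ^ (n - 1) * (\<Prod>x\<in>X. h x) * (\<Prod>v\<in>S - {v}. h v) *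
        of_real (vandermonde X * vandermonde (S - {v}) / (\<Prod>x\<in>X. \<Prod>v\<in>S - {v}. v - x))"
      unfolding X_def setr[symmetric] n(1)[symmetric]
      using Cons.prems l n set_remove_nth[of l vs] by (intro Cons.IH) (auto simp: sorted_wrt_remove_nth n_def)
    have V: "vandermonde S = (- 1) ^ (n - 1 - l) * vandermonde (S - {v}) * (\<Prod>w\<in>S - {v}. v - w)"
      unfolding S_def v_def n_def by (rule vandermonde_nth) (use Cons.prems l in auto)
    have hS: "(\<Prod>v\<in>S. h v) = h v * (\<Prod>v\<in>S - {v}. h v)" using vS fX by (intro prod.remove)
    have pS: "(\<Prod>x\<in>X. \<Prod>v\<in>S. v - x) = f v * (\<Prod>x\<in>X. \<Prod>v\<in>S - {v}. v - x)"
      unfolding f_def prod.distrib[symmetric] using vS fX by (intro prod.cong refl prod.remove)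
    have pw: "(\<Prod>w\<in>insert x S - {v}. v - w) = (v - x) * (\<Prod>w\<in>S - {v}. v - w)"
    proof -
      have "insert x S - {v} = insert x (S - {v})" using ne[OF vS, of x] by auto
      then show ?thesis using dX(4) fX by simp
    qed
    have nz: "f v \<noteq> 0" "v - x \<noteq> 0" "(\<Prod>w\<in>S - {v}. v - w) \<noteq> 0" "(\<Prod>x\<in>X. \<Prod>v\<in>S - {v}. v - x) \<noteq> 0"
      using ne vS fX by (auto simp: f_def)
    have C: "cauchy_matrix h x v = - (h x * h v / of_real (v - x))"
      using Xneg[of x] Spos[OF vS] divide_of_real_diff_swap[of "h x * h v" x v]
      by (simp add: cauchy_matrix_def del: of_real_diff)
    have sgn: "(- 1 :: complex) ^ (length xs + l) * (- 1) ^ (n - 1) = - ((- 1) ^ n * (- 1) ^ (n - 1 - l))"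
    proof -
      have e: "even (length xs + l + (n - 1)) = even (Suc (n + (n - 1 - l)))"
        using n l n_def by presburger
      have "(- 1 :: complex) ^ (length xs + l + (n - 1)) = (- 1) ^ (Suc (n + (n - 1 - l)))"
        by (rule minus_one_power_parity[OF e])
      then show ?thesis by (simp only: power_add power_Suc mult_minus1)
    qed
    have KV: "K * (f v / (\<Prod>w\<in>insert x S - {v}. v - w))
      = (- 1) ^ (n - 1 - l) * (vandermonde X * vandermonde (S - {v}) / (\<Prod>x\<in>X. \<Prod>v\<in>S - {v}. v - x)) / (v - x)"
      unfolding K_def V pS pw using nz by (simp add: divide_simps)
    have "(- 1) ^ (length xs + l) * cauchy_matrix h x v * pf_rec (cauchy_matrix h) (xs @ remove_nth l vs)
      = - ((- 1) ^ (length xs + l) * (- 1) ^ (n - 1)) * H *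
        of_real (vandermonde X * vandermonde (S - {v}) / (\<Prod>x\<in>X. \<Prod>v\<in>S - {v}. v - x)) / of_real (v - x)"
      unfolding C IH H_def hS by (simp add: mult_ac)
    also have "\<dots> = (- 1) ^ n * H * of_real (K * (f v / (\<Prod>w\<in>insert x S - {v}. v - w)))"
      unfolding sgn KV by (simp add: mult_ac)
    finally show ?thesis unfolding v_def .
  qed
  have "pf_rec (cauchy_matrix h) ((x # xs) @ vs) = (\<Sum>l<length vs. (- 1) ^ n * H * of_real (K * (f (vs ! l) / (\<Prod>w\<in>insert x S - {vs ! l}. vs ! l - w))))"
    using Cons.prems(3) trm by (subst pf_rec_cauchy_Cons) (auto intro!: sum.cong)
  also have "\<dots> = (- 1) ^ n * H * of_real (K * (\<Sum>l<length vs. f (vs ! l) / (\<Prod>w\<in>insert x S - {vs ! l}. vs ! l - w)))"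
    by (simp add: sum_distrib_left)
  also have "(\<Sum>l<length vs. f (vs ! l) / (\<Prod>w\<in>insert x S - {vs ! l}. vs ! l - w)) = (\<Sum>v\<in>S. f v / (\<Prod>w\<in>insert x S - {v}. v - w))"
    unfolding S_def by (rule sum.reindex_bij_betw[OF bij_betw_nth]) (use dX in auto)
  also have "\<dots> = divided_difference (insert x S) f - f x / (\<Prod>w\<in>S. x - w)"
    using dX fX by (simp add: divided_difference_def)
  also have "divided_difference (insert x S) f = 0"
    using divided_difference_prod_less[of X "insert x S" 0 "\<lambda>x. x"] dX fX cX by (simp add: f_def)
  also have "f x = (- 1) ^ card X * (\<Prod>x'\<in>X. x' - x)"
  proof -
    have "f x = (\<Prod>x'\<in>X. - 1 * (x' - x))" unfolding f_def by (intro prod.cong) auto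
    then show ?thesis unfolding prod.distrib by simp
  qed
  also have "(\<Prod>w\<in>S. x - w) = (- 1) ^ n * (\<Prod>w\<in>S. w - x)"
  proof -
    have "(\<Prod>w\<in>S. x - w) = (\<Prod>w\<in>S. - 1 * (w - x))" by (intro prod.cong) auto
    then show ?thesis unfolding prod.distrib cX(2)[symmetric] by simp
  qed
  also have "0 - (- 1) ^ card X * (\<Prod>x'\<in>X. x' - x) / ((- 1) ^ n * (\<Prod>w\<in>S. w - x)) = (\<Prod>x'\<in>X. x' - x) / (\<Prod>w\<in>S. w - x)"
    unfolding cX(1)[symmetric] by (simp add: power_add)
  also have "K * ((\<Prod>x'\<in>X. x' - x) / (\<Prod>w\<in>S. w - x)) = vandermonde (insert x X) * vandermonde S / (\<Prod>x\<in>insert x X. \<Prod>v\<in>S. v - x)"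
  proof -
    have "(\<Prod>w\<in>X. \<bar>w - x\<bar>) = (\<Prod>w\<in>X. w - x)"
      using Cons.prems(1) by (intro prod.cong) (auto simp: X_def)
    then have "vandermonde (insert x X) = vandermonde X * (\<Prod>x'\<in>X. x' - x)"
      using vandermonde_remove[of "insert x X" x] dX fX by simp
    then show ?thesis using dX fX by (simp add: K_def mult_ac)
  qed
  finally have fin: "pf_rec (cauchy_matrix h) ((x # xs) @ vs) = (- 1) ^ n * H *
      of_real (vandermonde (insert x X) * vandermonde S / (\<Prod>x\<in>insert x X. \<Prod>v\<in>S. v - x))" .
  have "length (x # xs) = n" "(\<Prod>x\<in>insert x X. h x) * (\<Prod>v\<in>S. h v) = H"
    using n dX fX by (simp_all add: H_def)
  then show ?case
    unfolding fin list.set X_def[symmetric] S_def[symmetric] by (simp only: mult.assoc)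
qed

lemma pf_rec_swap:
  assumes "\<And>a b. A b a = - A a b" "even (length us + length vs)"
  shows "pf_rec A (us @ b # c # vs) = - pf_rec A (us @ c # b # vs)"
proof -
  have "pf_list A (us @ b # c # vs) = - pf_list A (us @ c # b # vs)"
    using assms(2) by (rule pf_list_swap)
  moreover have "pf_list A (us @ b # c # vs) = pf_rec A (us @ b # c # vs)"
    by (rule pf_list_eq_pf_rec[OF assms(1)]) (use assms(2) in simp)
  moreover have "pf_list A (us @ c # b # vs) = pf_rec A (us @ c # b # vs)"
    by (rule pf_list_eq_pf_rec[OF assms(1)]) (use assms(2) in simp)
  ultimately show ?thesis by simp
qed

text \<open>Two positive points at distance 1 share a variable, since y = (y + 1) - 1; this gives
  their configuration weight zero.\<close>

lemma pf_rec_adjacent_eq: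
  assumes "\<And>a b. A b a = - A a b" "even (length us + length vs)"
  shows "pf_rec A (us @ b # b # vs) = 0"
proof -
  have "pf_rec A (us @ b # b # vs) = - pf_rec A (us @ b # b # vs)"
    by (rule pf_rec_swap[OF assms])
  then show ?thesis by simp
qed

text \<open>The index order y', y'' yields the variables y, y - 1, while
  \<open>pf_rec_cauchy\<close> expects an increasing list.\<close>

lemma pf_rec_swap_pairs:
  assumes "\<And>a b. A b a = - A a b" "even (length us)"
  shows "pf_rec A (us @ concat (map (\<lambda>y. [f y, g y]) ys)) = (- 1) ^ length ys * pf_rec A (us @ concat (map (\<lambda>y. [g y, f y]) ys))"
  using assms(2)
proof (induction ys arbitrary: us)
  case (Cons y ys)
  have l: "even (length (concat (map (\<lambda>y. [g y, f y]) ys)))" by (induction ys) auto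
  have "pf_rec A (us @ concat (map (\<lambda>y. [f y, g y]) (y # ys))) = pf_rec A ((us @ [f y, g y]) @ concat (map (\<lambda>y. [f y, g y]) ys))"
    by simp
  also have "\<dots> = (- 1) ^ length ys * pf_rec A ((us @ [f y, g y]) @ concat (map (\<lambda>y. [g y, f y]) ys))"
    using Cons.prems by (intro Cons.IH) simp
  also have "(us @ [f y, g y]) @ concat (map (\<lambda>y. [g y, f y]) ys) = us @ f y # g y # concat (map (\<lambda>y. [g y, f y]) ys)"
    by simp
  also have "pf_rec A \<dots> = - pf_rec A (us @ g y # f y # concat (map (\<lambda>y. [g y, f y]) ys))"
    by (rule pf_rec_swap[OF assms(1)]) (use Cons.prems l in simp)
  finally show ?case by simp
qed simp

section \<open>The Pfaffian of the matrix L\<close>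

definition split_matrix :: "'a block_matrix \<Rightarrow> 'a \<times> bool \<Rightarrow> 'a \<times> bool \<Rightarrow> complex" where
  "split_matrix L = (\<lambda>(x, s) (y, t). L x y $ (if s then 2 else 1) $ (if t then 2 else 1))"

definition primed_list :: "'a list \<Rightarrow> ('a \<times> bool) list" where
  "primed_list xs = concat (map (\<lambda>x. [(x, False), (x, True)]) xs)"

lemma length_primed_list [simp]: "length (primed_list xs) = 2 * length xs"
  by (induction xs) (auto simp: primed_list_def)

lemma primed_list_nth: "i < 2 * length xs \<Longrightarrow> primed_list xs ! i = (xs ! (i div 2), odd i)"
proof (induction xs arbitrary: i)
  case (Cons x xs)
  show ?case
  proof (cases "i < 2")
    case True
    then have "i = 0 \<or> i = 1" by auto
    then show ?thesis by (auto simp: primed_list_def)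
  next
    case False
    then obtain k where k: "i = Suc (Suc k)" by (metis add_2_eq_Suc le_Suc_ex not_less)
    then show ?thesis using Cons.IH[of k] Cons.prems by (simp add: primed_list_def)
  qed
qed simp

lemma pf_submatrix_eq_pf_rec:
  assumes "\<And>x y. L y x = - transpose (L x y)" "finite X"
  shows "pf_submatrix L X = pf_rec (split_matrix L) (primed_list (sorted_list_of_set X))"
proof -
  let ?xs = "sorted_list_of_set X"
  have len: "length ?xs = card X" using assms(2) by simp
  have "pf_submatrix L X = pf_list (split_matrix L) (primed_list ?xs)"
    unfolding pf_submatrix_def pf_list_def Let_def length_primed_list len
    by (simp, intro pfaffian_cong) (auto simp: primed_list_nth len split_matrix_def)
  also have "\<dots> = pf_rec (split_matrix L) (primed_list ?xs)"
  proof (rule pf_list_eq_pf_rec)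
    fix a b :: "'a \<times> bool"
    obtain x s y t where "a = (x, s)" "b = (y, t)" by (metis surj_pair)
    then show "split_matrix L b a = - split_matrix L a b"
      using assms(1)[of y x] by (simp add: split_matrix_def transpose_def)
  qed simp
  finally show ?thesis .
qed

lemma block_nth [simp]:
  "block a b c d $ 1 $ 1 = a" "block a b c d $ 1 $ 2 = b" "block a b c d $ 2 $ 1 = c" "block a b c d $ 2 $ 2 = d"
  by (simp_all add: block_def)

lemma parity_eps_skew: "parity_eps y x = - parity_eps x y"
  by (auto simp: parity_eps_def)

lemma L_matrix_skew: "L_matrix h y x = - transpose (L_matrix h x y)"
proof -
  have "block_E y x = - transpose (block_E x y)"
    by (simp add: vec_eq_iff forall_2 transpose_def block_E_def parity_eps_skew[of y x])
  moreover have "- transpose (- transpose B) = B" for B :: "complex^2^2"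
    by (simp add: vec_eq_iff transpose_def)
  ultimately show ?thesis
    by (auto simp: L_matrix_def) (simp_all add: vec_eq_iff transpose_def)
qed

definition small_point :: "real \<Rightarrow> bool" where
  "small_point x \<longleftrightarrow> x < 0 \<or> x = 1 / 2"

text \<open>
  The entries of \<open>L\<close> between the indices $x'$ with $x < 0$ or $x = \frac12$ (the first class) and all
  other indices vanish.
\<close>

definition class_one :: "real \<times> bool \<Rightarrow> bool" where
  "class_one = (\<lambda>(x, s). \<not> s \<and> small_point x)"

lemma split_matrix_class_one:
  assumes "class_one a \<noteq> class_one b"
  shows "split_matrix (L_matrix h) a b = 0"
proof -
  obtain x s y t where "a = (x, s)" "b = (y, t)" by (metis surj_pair)
  then show ?thesis
    using assms
    by (auto simp: split_matrix_def class_one_def small_point_def L_matrix_def block_E_def block_A_def block_B_def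
        transpose_def split: if_splits)
qed

lemma filter_class_one: "filter class_one (primed_list xs) = map (\<lambda>x. (x, False)) (filter small_point xs)"
  by (induction xs) (auto simp: primed_list_def class_one_def)

text \<open>The inversions are the pairs in which x'' of a small point precedes the first copy of a
  later small point. The points of \<open>ys\<close> come last and have no copy in the first
  class.\<close>

lemma inversions_before_primed:
  assumes "\<And>x. x \<in> set xs \<Longrightarrow> small_point x" "\<And>y. y \<in> set ys \<Longrightarrow> \<not> small_point y"
  shows "2 * inversions_before class_one (primed_list (xs @ ys)) = length xs * (length xs - 1)"
  using assms(1)
proof (induction xs)
  case Nil
  have "inversions_before class_one (primed_list ys) = 0"
    using assms(2)
  proof (induction ys)
    case (Cons y ys)
    have "filter class_one (primed_list ys) = []" using Cons.prems by (simp add: filter_class_one filter_empty_conv)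
    then show ?case using Cons by (auto simp: primed_list_def class_one_def)
  qed (simp add: primed_list_def)
  then show ?case by simp
next
  case (Cons x xs)
  have f: "filter class_one (primed_list (xs @ ys)) = map (\<lambda>x. (x, False)) xs"
    unfolding filter_class_one using Cons.prems assms(2) by simp
  have "inversions_before class_one (primed_list ((x # xs) @ ys)) = length xs + inversions_before class_one (primed_list (xs @ ys))"
    using f Cons.prems[of x] by (simp add: primed_list_def class_one_def)
  then have "2 * inversions_before class_one (primed_list ((x # xs) @ ys)) = 2 * length xs + length xs * (length xs - 1)"
    using Cons by simp
  then show ?case by (cases xs) auto
qed

text \<open>
  On the second class \<open>L\<close> is a Cauchy matrix: $x''$ (for $x < 0$ or $x = \frac12$) and $y'$ stand for the
  variable at the point itself, and $y''$ for the variable $y - 1$.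
\<close>

definition position :: "real \<times> bool \<Rightarrow> real" where
  "position = (\<lambda>(x, s). if small_point x \<or> \<not> s then x else x - 1)"

text \<open>The conditions on the first components keep the variable y - 1 positive for y > 1, so
  that the zero blocks of the two matrices agree.\<close>

lemma split_matrix_class_two:
  assumes "\<not> class_one a" "\<not> class_one b" "fst a < 0 \<or> fst a = 1 / 2 \<or> fst a > 1" "fst b < 0 \<or> fst b = 1 / 2 \<or> fst b > 1"
  shows "split_matrix (L_matrix h) a b = cauchy_matrix h (position a) (position b)"
proof -
  obtain x s y t where ab: "a = (x, s)" "b = (y, t)" by (metis surj_pair)
  show ?thesis
    using assms unfolding ab
    by (auto simp: split_matrix_def class_one_def small_point_def L_matrix_def block_E_def block_A_def block_B_def
        transpose_def cauchy_matrix_def position_def mult.commute algebra_simps)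
      (simp_all only: minus_divide_right minus_diff_eq)
qed

lemma map_position_primed:
  assumes "\<And>x. x \<in> set xs \<Longrightarrow> small_point x" "\<And>y. y \<in> set ys \<Longrightarrow> \<not> small_point y"
  shows "map position (filter (\<lambda>a. \<not> class_one a) (primed_list (xs @ ys))) = xs @ concat (map (\<lambda>y. [y, y - 1]) ys)"
  using assms(1)
proof (induction xs)
  case Nil
  show ?case using assms(2)
    by (induction ys) (auto simp: primed_list_def class_one_def position_def)
next
  case (Cons x xs)
  then show ?case by (auto simp: primed_list_def class_one_def position_def)
qed

text \<open>The exponent collects the shuffle of the two classes, m (m - 1) / 2 for m small points,
  and one exchange of y and y - 1 for every point of \<open>ys\<close>. Exchanging these pairs
  without further signs requires an even number of small points, which alternation provides.\<close>

theorem pf_submatrix_L_matrix: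
  assumes X: "finite X" "sorted_list_of_set X = ns @ hs @ ys"
    and ns: "\<And>x. x \<in> set ns \<Longrightarrow> x < 0" and hs: "hs = [] \<or> hs = [1 / 2]" and ys: "\<And>y. y \<in> set ys \<Longrightarrow> y > 1"
  shows "pf_submatrix (L_matrix h) X = (if alternating (\<lambda>x. \<not> even_point x) (ns @ hs) then
    (- 1) ^ (length (ns @ hs) * (length (ns @ hs) - 1) div 2 + length ys)
      * pf_rec (cauchy_matrix h) (ns @ hs @ concat (map (\<lambda>y. [y - 1, y]) ys)) else 0)"
proof -
  let ?A = "split_matrix (L_matrix h)" and ?zs = "primed_list ((ns @ hs) @ ys)"
  let ?od = "\<lambda>x. \<not> even_point x"
  have sm: "\<And>x. x \<in> set (ns @ hs) \<Longrightarrow> small_point x" using ns hs by (auto simp: small_point_def)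
  have lg: "\<And>y. y \<in> set ys \<Longrightarrow> \<not> small_point y" using ys by (force simp: small_point_def)
  have sorted: "sorted_wrt (<) (ns @ hs @ ys)" using X strict_sorted_list_of_set[of X] by simp
  have "pf_submatrix (L_matrix h) X = pf_rec ?A ?zs"
    using X pf_submatrix_eq_pf_rec[OF L_matrix_skew X(1)] by simp
  also have "\<dots> = (- 1) ^ inversions_before class_one ?zs * pf_rec ?A (filter class_one ?zs) * pf_rec ?A (filter (\<lambda>a. \<not> class_one a) ?zs)"
    by (rule pf_rec_split) (rule split_matrix_class_one)
  also have "inversions_before class_one ?zs = length (ns @ hs) * (length (ns @ hs) - 1) div 2"
  proof -
    have "2 * inversions_before class_one ?zs = length (ns @ hs) * (length (ns @ hs) - 1)"
      by (rule inversions_before_primed) (use sm lg in blast)+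
    then show ?thesis by presburger
  qed
  also have "pf_rec ?A (filter class_one ?zs) = (if alternating ?od (ns @ hs) then 1 else 0)"
  proof -
    have "filter small_point ((ns @ hs) @ ys) = ns @ hs" using sm lg by (simp add: filter_empty_conv filter_id_conv)
    then have "pf_rec ?A (filter class_one ?zs) = pf_rec (\<lambda>a b. ?A (a, False) (b, False)) (ns @ hs)"
      unfolding filter_class_one by (simp only: pf_rec_map)
    also have "\<dots> = (if alternating ?od (ns @ hs) then 1 else 0)"
    \<comment> \<open>Since 1/2 is the largest small point, the smaller of two small points is
      negative, and the entry lies in block E or A, where it is epsilon. The relation records
      this.\<close>
    proof (rule pf_rec_eps[where R = "\<lambda>a b. a < b \<and> a < 0 \<and> small_point b"])
      show "?A (a, False) (b, False) = (if ?od a \<and> \<not> ?od b then 1 else 0)" if "a < b \<and> a < 0 \<and> small_point b" for a b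
        using that by (auto simp: split_matrix_def L_matrix_def small_point_def block_E_def block_A_def parity_eps_def)
      have "sorted_wrt (<) (ns @ hs)" using sorted by (simp add: sorted_wrt_append)
      then show "sorted_wrt (\<lambda>a b. a < b \<and> a < 0 \<and> small_point b) (ns @ hs)"
        using ns hs sm by (auto simp: sorted_wrt_append small_point_def intro: sorted_wrt_mono_rel[rotated])
    qed
    finally show ?thesis .
  qed
  also have "pf_rec ?A (filter (\<lambda>a. \<not> class_one a) ?zs) = pf_rec (cauchy_matrix h) (ns @ hs @ concat (map (\<lambda>y. [y, y - 1]) ys))"
  proof -
    have "pf_rec ?A (filter (\<lambda>a. \<not> class_one a) ?zs) = pf_rec (\<lambda>a b. cauchy_matrix h (position a) (position b)) (filter (\<lambda>a. \<not> class_one a) ?zs)"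
    proof (rule pf_rec_cong)
      have "fst a < 0 \<or> fst a = 1 / 2 \<or> fst a > 1" if "a \<in> set ?zs" for a
      proof -
        have "fst a \<in> set (ns @ hs @ ys)" using that by (auto simp: primed_list_def)
        then show ?thesis using ns hs ys by auto
      qed
      then show "?A a b = cauchy_matrix h (position a) (position b)"
        if "a \<in> set (filter (\<lambda>a. \<not> class_one a) ?zs)" "b \<in> set (filter (\<lambda>a. \<not> class_one a) ?zs)" for a b
        using that by (intro split_matrix_class_two) auto
    qed
    also have "\<dots> = pf_rec (cauchy_matrix h) ((ns @ hs) @ concat (map (\<lambda>y. [y, y - 1]) ys))"
    proof -
      have "map position (filter (\<lambda>a. \<not> class_one a) ?zs) = (ns @ hs) @ concat (map (\<lambda>y. [y, y - 1]) ys)"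
        by (rule map_position_primed) (use sm lg in blast)+
      then show ?thesis by (simp only: pf_rec_map[symmetric])
    qed
    finally show ?thesis by simp
  qed
  finally have *: "pf_submatrix (L_matrix h) X = (- 1) ^ (length (ns @ hs) * (length (ns @ hs) - 1) div 2)
    * (if alternating ?od (ns @ hs) then 1 else 0) * pf_rec (cauchy_matrix h) (ns @ hs @ concat (map (\<lambda>y. [y, y - 1]) ys))" .
  have ev: "even (length xs)" if "alternating od xs" for od and xs :: "real list"
    using that by (induction xs rule: induct_list012) auto
  show ?thesis
  proof (cases "alternating ?od (ns @ hs)")
    case True
    have "pf_rec (cauchy_matrix h) ((ns @ hs) @ concat (map (\<lambda>y. [y, y - 1]) ys))
      = (- 1) ^ length ys * pf_rec (cauchy_matrix h) ((ns @ hs) @ concat (map (\<lambda>y. [y - 1, y]) ys))"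
      by (rule pf_rec_swap_pairs[OF cauchy_matrix_skew ev[OF True]])
    then show ?thesis using * True by (simp add: power_add)
  qed (simp add: *)
qed

lemma sorted_not_strict_adjacent:
  fixes vs :: "'a::linorder list"
  assumes "sorted vs" "\<not> sorted_wrt (<) vs"
  obtains us b ws where "vs = us @ b # b # ws"
  using assms
proof (induction vs arbitrary: thesis rule: induct_list012)
  case (3 x y zs)
  show ?case
  proof (cases "x = y")
    case True
    then show ?thesis using "3.prems"(1)[of "[]"] by simp
  next
    case False
    then have "x < y" using "3.prems"(2) by (auto simp: less_le)
    then have "\<not> sorted_wrt (<) (y # zs)" using "3.prems"(3) by (auto intro: order.strict_trans[of x y])
    then obtain us b ws where "y # zs = us @ b # b # ws"
      using "3.IH"(2) "3.prems"(2) by (metis sorted_simps(2))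
    then show ?thesis using "3.prems"(1)[of "x # us" b ws] by simp
  qed
qed auto

definition paired_points :: "real list \<Rightarrow> real list" where
  "paired_points ys = concat (map (\<lambda>y. [y - 1, y]) ys)"

lemma length_paired_points [simp]: "length (paired_points ys) = 2 * length ys"
  by (induction ys) (auto simp: paired_points_def)

lemma set_paired_points: "set (paired_points ys) = (\<Union>y\<in>set ys. {y - 1, y})"
  by (induction ys) (auto simp: paired_points_def)

lemma half_integers_less_imp:
  assumes "x \<in> half_integers" "y \<in> half_integers" "x < y"
  shows "x + 1 \<le> y"
proof -
  obtain m n where "x = real_of_int m + 1 / 2" "y = real_of_int n + 1 / 2"
    using assms by (auto simp: half_integers_def)
  then show ?thesis using assms(3) by simp
qed

text \<open>Distinct half-integers differ by at least 1, so y' - 1 is never below the previous point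
  y; equality can occur, hence the weak order.\<close>

lemma sorted_paired_points:
  assumes "sorted_wrt (<) ys" "set ys \<subseteq> half_integers"
  shows "sorted (paired_points ys)"
  using assms
proof (induction ys)
  case (Cons y ys)
  have "y \<le> w" if w: "w \<in> set (paired_points ys)" for w
  proof -
    obtain y' where y': "y' \<in> set ys" "w = y' - 1 \<or> w = y'" using w by (auto simp: set_paired_points)
    then have "y + 1 \<le> y'" using Cons.prems by (intro half_integers_less_imp) auto
    then show ?thesis using y' by auto
  qed
  then show ?case using Cons by (fastforce simp: paired_points_def)
qed (simp add: paired_points_def)

text \<open>Failure of alternation kills the epsilon block, failure of either of the other two
  conditions the Cauchy block. When all three hold, the signs cancel and leave a product of values
  of h with a positive real number.\<close>

theorem pf_submatrix_L_matrix_eq: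
  fixes ns hs ys :: "real list"
  assumes X: "finite X" "X \<subseteq> half_integers" "sorted_list_of_set X = ns @ hs @ ys"
    and ns: "\<And>x. x \<in> set ns \<Longrightarrow> x < 0" and hs: "hs = [] \<or> hs = [1 / 2]" and ys: "\<And>y. y \<in> set ys \<Longrightarrow> y > 1"
  defines "vs \<equiv> hs @ paired_points ys"
  shows "pf_submatrix (L_matrix h) X =
    (if alternating (\<lambda>x. \<not> even_point x) (ns @ hs) \<and> length ns = length vs \<and> sorted_wrt (<) vs
     then (\<Prod>x\<in>set ns. h x) * (\<Prod>v\<in>set vs. h v) *
        of_real (vandermonde (set ns) * vandermonde (set vs) / (\<Prod>x\<in>set ns. \<Prod>v\<in>set vs. v - x))
     else 0)"
proof (cases "alternating (\<lambda>x. \<not> even_point x) (ns @ hs)")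
  case True
  let ?m = "length (ns @ hs)"
  have pf: "pf_submatrix (L_matrix h) X = (- 1) ^ (?m * (?m - 1) div 2 + length ys) * pf_rec (cauchy_matrix h) (ns @ vs)"
    using pf_submatrix_L_matrix[OF X(1,3) ns hs ys, of h] True by (simp add: vs_def paired_points_def)
  have sX: "sorted_wrt (<) (ns @ hs @ ys)" using X strict_sorted_list_of_set[of X] by simp
  have setX: "set (ns @ hs @ ys) = X" using X by (metis set_sorted_list_of_set)
  have ysh: "set ys \<subseteq> half_integers" using setX X(2) by auto
  have y32: "3 / 2 \<le> y" if "y \<in> set ys" for y
  proof -
    have "1 / 2 \<in> half_integers" by (auto simp: half_integers_def intro: exI[of _ 0])
    then show ?thesis using half_integers_less_imp[of "1 / 2" y] ys[OF that] ysh that by auto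
  qed
  have vpos: "v \<ge> 1 / 2" if "v \<in> set vs" for v
    using that hs y32 by (fastforce simp: vs_def set_paired_points)
  then have vpos': "v > 0" if "v \<in> set vs" for v using that by fastforce
  have svs: "sorted vs"
  proof -
    have "sorted_wrt (<) ys" using sX by (simp add: sorted_wrt_append)
    then have "sorted (paired_points ys)" using ysh by (rule sorted_paired_points)
    moreover have "1 / 2 \<le> v" if "v \<in> set (paired_points ys)" for v
      using vpos that by (simp add: vs_def)
    ultimately show ?thesis using hs by (auto simp: vs_def)
  qed
  have ev: "even ?m"
  proof -
    have "even (length xs)" if "alternating od xs" for od and xs :: "real list"
      using that by (induction xs rule: induct_list012) auto
    then show ?thesis using True by blast
  qed
  consider "length ns \<noteq> length vs" | "length ns = length vs" "\<not> sorted_wrt (<) vs" | "length ns = length vs" "sorted_wrt (<) vs"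
    by blast
  then show ?thesis
  proof cases
    case 1
    then have "pf_rec (cauchy_matrix h) (ns @ vs) = 0" using ns vpos' by (intro pf_rec_cauchy_unbalanced) auto
    then show ?thesis using pf 1 by simp
  next
    case 2
    obtain us b ws where vs: "vs = us @ b # b # ws" using sorted_not_strict_adjacent[OF svs 2(2)] .
    have "even (length ns + length vs)" using 2 by simp
    then have "pf_rec (cauchy_matrix h) ((ns @ us) @ b # b # ws) = 0"
      unfolding vs by (intro pf_rec_adjacent_eq[OF cauchy_matrix_skew]) auto
    then show ?thesis using pf 2 by (simp add: vs)
  next
    case 3
    have "sorted_wrt (<) ns" using sX by (simp add: sorted_wrt_append)
    then have C: "pf_rec (cauchy_matrix h) (ns @ vs) = (- 1) ^ length ns * (\<Prod>x\<in>set ns. h x) * (\<Prod>v\<in>set vs. h v) *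
        of_real (vandermonde (set ns) * vandermonde (set vs) / (\<Prod>x\<in>set ns. \<Prod>v\<in>set vs. v - x))"
      using 3 ns vpos' by (intro pf_rec_cauchy) auto
    \<comment> \<open>The number |ns| + |hs| equals 2p, and the total exponent of -1 becomes 2 (p^2
      + |ys|).\<close>
    define p where "p = length hs + length ys"
    have "length ns = length hs + 2 * length ys" using 3 by (simp add: vs_def)
    then have "?m = 2 * p" "length ns + length ys = p + 2 * length ys" by (simp_all add: p_def)
    moreover have "?m * (?m - 1) div 2 = p * (2 * p - 1)" unfolding calculation(1) by simp
    ultimately have "?m * (?m - 1) div 2 + length ys + length ns = p * (2 * p - 1) + p + 2 * length ys" by linarith
    moreover have "p * (2 * p - 1) + p = 2 * (p * p)" by (cases p) (auto simp: algebra_simps)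
    ultimately have "?m * (?m - 1) div 2 + length ys + length ns = 2 * (p * p + length ys)" by (simp only: distrib_left)
    then have "even (?m * (?m - 1) div 2 + length ys + length ns)" by (metis dvd_triv_left)
    then have "(- 1 :: complex) ^ (?m * (?m - 1) div 2 + length ys) * (- 1) ^ length ns = 1"
      unfolding power_add[symmetric] by (rule neg_one_even_power)
    then show ?thesis
      unfolding pf C using 3 True by (simp only: mult.assoc[symmetric] if_True simp_thms mult_1_left)
  qed
qed (use pf_submatrix_L_matrix[OF X(1,3) ns hs ys, of h] in simp)

section \<open>Hook products\<close>

lemma down_closed_eq_atLeastAtMost:
  assumes "finite S" "0 \<notin> S" "\<And>i k. i \<in> S \<Longrightarrow> 1 \<le> k \<Longrightarrow> k \<le> i \<Longrightarrow> k \<in> S"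
  shows "S = {1..card S}"
proof (cases "S = {}")
  case False
  define M where "M = Max S"
  have "M \<in> S" "\<And>i. i \<in> S \<Longrightarrow> i \<le> M" using assms(1) False by (auto simp: M_def)
  then have "S = {1..M}" using assms(2,3) by (auto simp: Suc_le_eq intro: gr0I)
  then show ?thesis by simp
qed simp

lemma row_eq_0: "i > length (row_lengths \<nu>) \<Longrightarrow> row \<nu> i = 0" "row \<nu> 0 = 0"
  by (auto simp: row_def)

lemma row_antimono: "1 \<le> i \<Longrightarrow> i \<le> k \<Longrightarrow> row \<nu> k \<le> row \<nu> i"
proof -
  assume ik: "1 \<le> i" "i \<le> k"
  have "sorted_wrt (\<ge>) (row_lengths \<nu>)" using row_lengths[of \<nu>] by auto
  then show ?thesis using ik sorted_wrt_nth_less[of "(\<ge>)" "row_lengths \<nu>" "i - 1" "k - 1"]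
    by (cases "i = k") (auto simp: row_def)
qed

lemma finite_column: "finite {i. 1 \<le> i \<and> 1 \<le> j \<and> j \<le> row \<nu> i}"
proof (rule finite_subset)
  show "{i. 1 \<le> i \<and> 1 \<le> j \<and> j \<le> row \<nu> i} \<subseteq> {..length (row_lengths \<nu>)}"
    by (auto simp: not_less[symmetric] row_eq_0)
qed simp

lemma le_col_iff:
  assumes "1 \<le> i" "1 \<le> j"
  shows "i \<le> col \<nu> j \<longleftrightarrow> j \<le> row \<nu> i"
proof -
  let ?S = "{i. 1 \<le> i \<and> 1 \<le> j \<and> j \<le> row \<nu> i}"
  have "?S = {1..card ?S}"
    by (rule down_closed_eq_atLeastAtMost[OF finite_column]) (use row_antimono[of _ _ \<nu>] in \<open>auto intro: order_trans\<close>)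
  moreover have "card ?S = col \<nu> j" by (simp add: col_def boxes_def)
  ultimately have "?S = {1..col \<nu> j}" by simp
  then have "i \<in> ?S \<longleftrightarrow> i \<in> {1..col \<nu> j}" by simp
  then show ?thesis using assms by simp
qed

lemma finite_boxes [simp]: "finite (boxes \<nu>)"
proof (rule finite_subset)
  have "i \<le> length (row_lengths \<nu>)" if "1 \<le> j" "j \<le> row \<nu> i" for i j
    using that row_eq_0(1)[of \<nu> i] by (cases "i \<le> length (row_lengths \<nu>)") auto
  then show "boxes \<nu> \<subseteq> (SIGMA i:{..length (row_lengths \<nu>)}. {..row \<nu> i})"
    by (auto simp: boxes_def)
qed auto

text \<open>Transposition as a Galois-type relation: symmetric in r and c, and meaningful for
  arbitrary functions, so a candidate for the columns can be tested against it as in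
  \<open>col_double_rows\<close>.\<close>

definition conjugate :: "(nat \<Rightarrow> nat) \<Rightarrow> (nat \<Rightarrow> nat) \<Rightarrow> bool" where
  "conjugate r c \<longleftrightarrow> (\<forall>i\<ge>1. \<forall>j\<ge>1. i \<le> c j \<longleftrightarrow> j \<le> r i)"

lemma conjugate_row_col: "conjugate (row \<nu>) (col \<nu>)"
  by (simp add: conjugate_def le_col_iff)

lemma conjugate_sym: "conjugate r c \<Longrightarrow> conjugate c r"
  by (auto simp: conjugate_def)

lemma conjugateD: "conjugate r c \<Longrightarrow> 1 \<le> i \<Longrightarrow> 1 \<le> j \<Longrightarrow> i \<le> c j \<longleftrightarrow> j \<le> r i"
  by (auto simp: conjugate_def)

lemma conjugate_antimono: "conjugate r c \<Longrightarrow> 1 \<le> i \<Longrightarrow> i \<le> k \<Longrightarrow> r k \<le> r i"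
  using conjugateD[of r c i "r k"] conjugateD[of r c k "r k"] by (cases "r k = 0") auto

lemma conjugate_unique:
  assumes "conjugate r c" "conjugate r c'" "1 \<le> j"
  shows "c j = c' j"
proof -
  have "i \<le> c j \<longleftrightarrow> i \<le> c' j" if "1 \<le> i" for i using assms that by (simp add: conjugate_def)
  from this[of "c j"] this[of "c' j"] show ?thesis by (cases "c j = 0"; cases "c' j = 0") auto
qed

text \<open>
  The hook lengths in row \<open>i\<close> and the differences of the shifted row lengths
  \<open>r k - k\<close> below it partition the interval \<open>{1..r i + N - i}\<close>.
\<close>

lemma hook_row_product:
  fixes r c :: "nat \<Rightarrow> nat"
  assumes rc: "\<And>k j. 1 \<le> k \<Longrightarrow> k \<le> N \<Longrightarrow> 1 \<le> j \<Longrightarrow> k \<le> c j \<longleftrightarrow> j \<le> r k"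
    and cN: "\<And>j. 1 \<le> j \<Longrightarrow> c j \<le> N" and i: "1 \<le> i" "i \<le> N"
  shows "(\<Prod>j=1..r i. (r i - j) + (c j - i) + 1) * (\<Prod>k=i+1..N. (r i - r k) + (k - i)) = fact (r i + N - i)"
proof -
  define f where "f = (\<lambda>j. (r i - j) + (c j - i) + 1)"
  define g where "g = (\<lambda>k. (r i - r k) + (k - i))"
  let ?J = "{1..r i}" and ?K = "{i+1..N}"
  have ci: "i \<le> c j" if "j \<in> ?J" for j using that rc[of i j] i by auto
  have rmono: "r k' \<le> r k" if "1 \<le> k" "k \<le> k'" "k' \<le> N" for k k'
    using rc[of k "r k'"] rc[of k' "r k'"] that by (cases "r k' = 0") auto
  have cmono: "c j' \<le> c j" if "1 \<le> j" "j \<le> j'" for j j'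
    using rc[of "c j'" j] rc[of "c j'" j'] cN[of j'] that by (cases "c j' = 0") auto
  have f_less: "f j' < f j" if "j \<in> ?J" "j' \<in> ?J" "j < j'" for j j'
    using cmono[of j j'] that ci[of j'] by (auto simp: f_def)
  have g_less: "g k < g k'" if "k \<in> ?K" "k' \<in> ?K" "k < k'" for k k'
    using rmono[of k k'] rmono[of i k'] rmono[of i k] that i by (auto simp: g_def)
  \<comment> \<open>Whether the box (k, j) belongs to the diagram decides the order: f j exceeds g k
    if it does and is smaller if it does not.\<close>
  have disj: "f j \<noteq> g k" if "j \<in> ?J" "k \<in> ?K" for j k
  proof (cases "k \<le> c j")
    case True
    then have "j \<le> r k" using rc[of k j] that by auto
    then show ?thesis using True that rmono[of i k] i by (auto simp: f_def g_def)
  next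
    case False
    then have "r k < j" using rc[of k j] that by auto
    then show ?thesis using False that ci[of j] by (auto simp: f_def g_def)
  qed
  have inj: "inj_on f ?J" "inj_on g ?K"
    by (intro inj_onI; metis f_less nat_neq_iff) (intro inj_onI; metis g_less nat_neq_iff)
  have sub: "f ` ?J \<union> g ` ?K \<subseteq> {1..r i + N - i}"
  proof -
    have "f j \<in> {1..r i + N - i}" if "j \<in> ?J" for j
      using that cN[of j] ci[of j] by (auto simp: f_def)
    moreover have "g k \<in> {1..r i + N - i}" if "k \<in> ?K" for k
      using that rmono[of i k] i by (auto simp: g_def)
    ultimately show ?thesis by blast
  qed
  have dj: "f ` ?J \<inter> g ` ?K = {}" using disj by (auto; metis)
  have "card (f ` ?J \<union> g ` ?K) = r i + (N - i)"
    using inj dj by (subst card_Un_disjoint) (auto simp: card_image)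
  then have eq: "f ` ?J \<union> g ` ?K = {1..r i + N - i}"
    using i by (intro card_subset_eq sub) auto
  have "(\<Prod>j\<in>?J. f j) * (\<Prod>k\<in>?K. g k) = \<Prod>(f ` ?J) * \<Prod>(g ` ?K)"
    using inj by (simp add: prod.reindex)
  also have "\<dots> = \<Prod>(f ` ?J \<union> g ` ?K)" using dj by (subst prod.union_disjoint) auto
  also have "\<dots> = fact (r i + N - i)" unfolding eq by (simp add: fact_prod)
  finally show ?thesis by (simp add: f_def g_def)
qed

lemma prod_swap_image: "prod F (prod.swap ` S) = (\<Prod>x\<in>S. F (snd x, fst x))"
  by (subst prod.reindex) (auto simp: swap_inj_on intro!: prod.cong)

text \<open>D is the side of the Durfee square. The assumptions are invariant under exchanging rows
  and columns (\<open>flip\<close>), so statements about legs follow from those about arms.\<close>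

locale frobenius =
  fixes r c :: "nat \<Rightarrow> nat" and D :: nat
  assumes conj: "conjugate r c" and D_iff: "\<And>i. 1 \<le> i \<Longrightarrow> i \<le> D \<longleftrightarrow> i \<le> r i"
begin

lemma D_iff_col: "1 \<le> i \<Longrightarrow> i \<le> D \<longleftrightarrow> i \<le> c i"
  using D_iff conjugateD[OF conj, of i i] by simp

lemma flip: "frobenius c r D"
  using D_iff_col conj by unfold_locales (auto intro: conjugate_sym)

lemma row_ge: "1 \<le> i \<Longrightarrow> i \<le> D \<Longrightarrow> D \<le> r i"
  using conjugate_antimono[OF conj, of i D] D_iff[of D] by auto

lemma col_beyond: "D < j \<Longrightarrow> c j \<le> D"
proof (rule ccontr)
  assume "D < j" "\<not> c j \<le> D"
  then have "j \<le> r (Suc D)" using conjugateD[OF conj, of "Suc D" j] by simp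
  then show False using D_iff[of "Suc D"] \<open>D < j\<close> by simp
qed

text \<open>The part to the right of the Durfee square is a diagram with at most D rows, so
  \<open>hook_row_product\<close> applies to it with N = D. Its differences of shifted rows are the
  differences of the coordinates r i - i.\<close>

lemma right_hooks:
  assumes "1 \<le> i" "i \<le> D"
  shows "(\<Prod>j=D+1..r i. (r i - j) + (c j - i) + 1) * (\<Prod>k=i+1..D. (r i - i) - (r k - k)) = fact (r i - i)"
proof -
  have "(\<Prod>j=1..r i - D. ((r i - D) - j) + (c (j + D) - i) + 1) * (\<Prod>k=i+1..D. ((r i - D) - (r k - D)) + (k - i))
    = fact (r i - D + D - i)"
  proof (rule hook_row_product)
    fix k j :: nat assume "1 \<le> k" "k \<le> D" "1 \<le> j"
    then show "(k \<le> c (j + D)) = (j \<le> r k - D)"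
      using conjugateD[OF conj, of k "j + D"] by auto
  next
    fix j :: nat assume "1 \<le> j"
    then show "c (j + D) \<le> D" by (intro col_beyond) auto
  qed (use assms in auto)
  moreover have "(\<Prod>k=i+1..D. ((r i - D) - (r k - D)) + (k - i)) = (\<Prod>k=i+1..D. (r i - i) - (r k - k))"
  proof (intro prod.cong refl)
    fix k assume "k \<in> {i+1..D}"
    then have "r k \<le> r i" "D \<le> r k" "i \<le> k" "k \<le> D" using row_ge[of k] conjugate_antimono[OF conj, of i k] assms by auto
    then show "((r i - D) - (r k - D)) + (k - i) = (r i - i) - (r k - k)" by simp
  qed
  moreover have "(\<Prod>j=1..r i - D. ((r i - D) - j) + (c (j + D) - i) + 1) = (\<Prod>j=D+1..r i. (r i - j) + (c j - i) + 1)"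
    by (rule prod.reindex_bij_witness[where i = "\<lambda>j. j - D" and j = "\<lambda>j. j + D"]) auto
  ultimately show ?thesis using row_ge[OF assms] assms by simp
qed

definition diagram :: "(nat \<times> nat) set" where
  "diagram = {(i, j). 1 \<le> i \<and> 1 \<le> j \<and> j \<le> r i}"

lemma diagram_split:
  "diagram = ({1..D} \<times> {1..D} \<union> (SIGMA i:{1..D}. {D+1..r i})) \<union> prod.swap ` (SIGMA j:{1..D}. {D+1..c j})" (is "_ = ?R")
proof (intro set_eqI)
  fix x :: "nat \<times> nat"
  obtain i j where x: "x = (i, j)" by (metis surj_pair)
  have sw: "(i, j) \<in> prod.swap ` S \<longleftrightarrow> (j, i) \<in> S" for S by (metis (no_types) image_iff prod.swap_def pair_in_swap_image)
  show "x \<in> diagram \<longleftrightarrow> x \<in> ?R"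
  proof (cases "1 \<le> i \<and> 1 \<le> j")
    case True
    have "j \<le> r i" if "i \<le> D" "j \<le> D" using row_ge[of i] True that by simp
    moreover have "False" if "D < i" "D < j" "j \<le> r i" using col_beyond[of j] conjugateD[OF conj, of i j] that by auto
    moreover have "i \<le> c j \<longleftrightarrow> j \<le> r i" using True by (intro conjugateD[OF conj]) auto
    ultimately show ?thesis using True unfolding x Un_iff sw
      by (cases "i \<le> D"; cases "j \<le> D") (auto simp: diagram_def not_le)
  qed (use sw in \<open>auto simp: x diagram_def\<close>)
qed

lemma diagram_diagonal_split:
  "diagram = (SIGMA i:{1..D}. {i..r i}) \<union> prod.swap ` (SIGMA j:{1..D}. {j+1..c j})" (is "_ = ?R")
proof (intro set_eqI)
  fix x :: "nat \<times> nat"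
  obtain i j where x: "x = (i, j)" by (metis surj_pair)
  have sw: "(i, j) \<in> prod.swap ` S \<longleftrightarrow> (j, i) \<in> S" for S by (metis (no_types) image_iff prod.swap_def pair_in_swap_image)
  show "x \<in> diagram \<longleftrightarrow> x \<in> ?R"
  proof (cases "1 \<le> i \<and> 1 \<le> j")
    case True
    have "i \<le> D" if "i \<le> j" "j \<le> r i" using D_iff[of i] True that by simp
    moreover have "j \<le> D" if "j < i" "i \<le> c j" using D_iff_col[of j] True that by simp
    moreover have "i \<le> c j \<longleftrightarrow> j \<le> r i" using True by (intro conjugateD[OF conj]) auto
    ultimately show ?thesis using True unfolding x Un_iff sw
      by (cases "i \<le> j") (auto simp: diagram_def not_le)
  qed (use sw in \<open>auto simp: x diagram_def\<close>)
qed

lemma prod_diagram_diagonal: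
  fixes F :: "nat \<times> nat \<Rightarrow> 'a::comm_monoid_mult"
  shows "(\<Prod>x\<in>diagram. F x) = (\<Prod>i=1..D. \<Prod>j=i..r i. F (i, j)) * (\<Prod>j=1..D. \<Prod>i=j+1..c j. F (i, j))"
proof -
  have "(\<Prod>x\<in>diagram. F x) = (\<Prod>x\<in>(SIGMA i:{1..D}. {i..r i}). F x) * (\<Prod>x\<in>prod.swap ` (SIGMA j:{1..D}. {j+1..c j}). F x)"
    unfolding diagram_diagonal_split by (intro prod.union_disjoint) auto
  then show ?thesis by (simp add: prod.Sigma prod_swap_image split_def)
qed

lemma card_diagram: "card diagram = (\<Sum>i=1..D. (r i - i) + (c i - i) + 1)"
proof -
  have "card diagram = (\<Sum>i=1..D. card {i..r i}) + (\<Sum>j=1..D. card {j+1..c j})"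
    unfolding diagram_diagonal_split by (subst card_Un_disjoint) (auto simp: card_image)
  also have "\<dots> = (\<Sum>i=1..D. (r i - i) + (c i - i) + 1)"
    using row_ge unfolding sum.distrib[symmetric] by (intro sum.cong refl) (fastforce)
  finally show ?thesis .
qed

text \<open>Inside the Durfee square the hook length at (i, j) is (r i - i) + (c j - j) + 1; the two
  outer parts are evaluated by \<open>right_hooks\<close> and its transpose. The identity is
  multiplied out to remain in the natural numbers.\<close>

lemma hook_product:
  "(\<Prod>(i, j)\<in>diagram. (r i - j) + (c j - i) + 1)
     * ((\<Prod>i=1..D. \<Prod>k=i+1..D. (r i - i) - (r k - k)) * (\<Prod>i=1..D. \<Prod>k=i+1..D. (c i - i) - (c k - k)))
   = (\<Prod>i=1..D. \<Prod>j=1..D. (r i - i) + (c j - j) + 1) * ((\<Prod>i=1..D. fact (r i - i)) * (\<Prod>j=1..D. fact (c j - j)))"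
proof -
  let ?h = "\<lambda>(i, j). (r i - j) + (c j - i) + 1"
  have "prod ?h diagram = prod ?h ({1..D} \<times> {1..D} \<union> (SIGMA i:{1..D}. {D+1..r i})) * prod ?h (prod.swap ` (SIGMA j:{1..D}. {D+1..c j}))"
    unfolding diagram_split by (intro prod.union_disjoint) auto
  also have "prod ?h ({1..D} \<times> {1..D} \<union> (SIGMA i:{1..D}. {D+1..r i})) = prod ?h ({1..D} \<times> {1..D}) * prod ?h (SIGMA i:{1..D}. {D+1..r i})"
    by (intro prod.union_disjoint) auto
  also have "prod ?h ({1..D} \<times> {1..D}) = (\<Prod>i=1..D. \<Prod>j=1..D. (r i - i) + (c j - j) + 1)"
  proof -
    have "?h (i, j) = (r i - i) + (c j - j) + 1" if "i \<in> {1..D}" "j \<in> {1..D}" for i j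
      using row_ge[of i] frobenius.row_ge[OF flip, of j] that by auto
    then show ?thesis unfolding prod.cartesian_product by (intro prod.cong refl) auto
  qed
  also have "prod ?h (SIGMA i:{1..D}. {D+1..r i}) = (\<Prod>i=1..D. \<Prod>j=D+1..r i. ?h (i, j))"
    by (subst prod.Sigma) auto
  also have "prod ?h (prod.swap ` (SIGMA j:{1..D}. {D+1..c j})) = (\<Prod>j=1..D. \<Prod>i=D+1..c j. (c j - i) + (r i - j) + 1)"
    unfolding prod_swap_image by (subst prod.Sigma) (auto simp: add.commute intro!: prod.cong)
  finally have H: "prod ?h diagram = (\<Prod>i=1..D. \<Prod>j=1..D. (r i - i) + (c j - j) + 1)
     * (\<Prod>i=1..D. \<Prod>j=D+1..r i. (r i - j) + (c j - i) + 1) * (\<Prod>j=1..D. \<Prod>i=D+1..c j. (c j - i) + (r i - j) + 1)"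
    by simp
  have R: "(\<Prod>i=1..D. \<Prod>j=D+1..r i. (r i - j) + (c j - i) + 1) * (\<Prod>i=1..D. \<Prod>k=i+1..D. (r i - i) - (r k - k)) = (\<Prod>i=1..D. fact (r i - i))"
    unfolding prod.distrib[symmetric] using right_hooks by (intro prod.cong refl) auto
  have C: "(\<Prod>i=1..D. \<Prod>j=D+1..c i. (c i - j) + (r j - i) + 1) * (\<Prod>i=1..D. \<Prod>k=i+1..D. (c i - i) - (c k - k)) = (\<Prod>i=1..D. fact (c i - i))"
    unfolding prod.distrib[symmetric] using frobenius.right_hooks[OF flip] by (intro prod.cong refl) auto
  show ?thesis unfolding H R[symmetric] C[symmetric] by (simp only: mult_ac)
qed

end

section \<open>Diagrams with doubled rows\<close>

lemma row_double_rows: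
  assumes "1 \<le> i"
  shows "row (double_rows \<nu>) i = row \<nu> ((i + 1) div 2)"
proof -
  let ?rs = "row_lengths \<nu>"
  have e: "row_lengths (double_rows \<nu>) = map fst (primed_list ?rs)"
    by (simp add: double_rows.rep_eq primed_list_def map_concat comp_def)
  have "(i - 1) div 2 = (i + 1) div 2 - 1" using assms by (cases i) auto
  moreover have "i \<le> 2 * length ?rs \<longleftrightarrow> (i + 1) div 2 \<le> length ?rs" by auto
  ultimately show ?thesis using assms by (auto simp: row_def e primed_list_nth)
qed

lemma col_double_rows: "1 \<le> j \<Longrightarrow> col (double_rows \<nu>) j = 2 * col \<nu> j"
proof (rule conjugate_unique[OF conjugate_row_col])
  show "conjugate (row (double_rows \<nu>)) (\<lambda>j. 2 * col \<nu> j)"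
    unfolding conjugate_def
  proof (intro allI impI)
    fix i j :: nat assume ij: "1 \<le> i" "1 \<le> j"
    have "i \<le> 2 * col \<nu> j \<longleftrightarrow> (i + 1) div 2 \<le> col \<nu> j" by auto
    also have "\<dots> \<longleftrightarrow> j \<le> row \<nu> ((i + 1) div 2)" using ij by (intro le_col_iff) auto
    finally show "i \<le> 2 * col \<nu> j \<longleftrightarrow> j \<le> row (double_rows \<nu>) i" using row_double_rows[OF ij(1)] by simp
  qed
qed

lemma frobenius_frob_length: "frobenius (row \<mu>) (col \<mu>) (frob_length \<mu>)"
proof
  show "conjugate (row \<mu>) (col \<mu>)" by (rule conjugate_row_col)
  let ?S = "{i. (i, i) \<in> boxes \<mu>}"
  have "?S = {1..card ?S}"
  proof (rule down_closed_eq_atLeastAtMost)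
    show "finite ?S" by (rule finite_subset[of _ "fst ` boxes \<mu>"]) (auto intro: image_eqI[rotated])
    show "k \<in> ?S" if "i \<in> ?S" "1 \<le> k" "k \<le> i" for i k
      using that row_antimono[of k i \<mu>] by (auto simp: boxes_def)
  qed (auto simp: boxes_def)
  then have S: "?S = {1..frob_length \<mu>}" unfolding frob_length_def .
  have "i \<in> ?S \<longleftrightarrow> i \<in> {1..frob_length \<mu>}" for i unfolding S by (rule refl)
  then show "i \<le> frob_length \<mu> \<longleftrightarrow> i \<le> row \<mu> i" if "1 \<le> i" for i
    using that by (auto simp: boxes_def)
qed

lemma prod_boxes_double_rows:
  fixes F :: "nat \<times> nat \<Rightarrow> 'a::comm_monoid_mult"
  shows "prod F (boxes (double_rows \<nu>)) = (\<Prod>(i, j)\<in>boxes \<nu>. F (2 * i - 1, j) * F (2 * i, j))"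
proof -
  let ?o = "\<lambda>(i, j). (2 * i - 1, j)" and ?e = "\<lambda>(i, j). (2 * i, j)"
  let ?B = "boxes \<nu>"
  have in_iff: "(i, j) \<in> boxes (double_rows \<nu>) \<longleftrightarrow> 1 \<le> i \<and> ((i + 1) div 2, j) \<in> ?B" for i j
    by (auto simp: boxes_def row_double_rows)
  have eq: "boxes (double_rows \<nu>) = ?o ` ?B \<union> ?e ` ?B"
  proof (intro equalityI subsetI)
    fix x assume x: "x \<in> boxes (double_rows \<nu>)"
    obtain i j where ij: "x = (i, j)" by (metis surj_pair)
    have "i = 2 * ((i + 1) div 2) - 1 \<or> i = 2 * ((i + 1) div 2)" by presburger
    then show "x \<in> ?o ` ?B \<union> ?e ` ?B" using x unfolding ij in_iff by (force simp: image_iff)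
  next
    fix x assume "x \<in> ?o ` ?B \<union> ?e ` ?B"
    then obtain i j where ij: "(i, j) \<in> ?B" "x = (2 * i - 1, j) \<or> x = (2 * i, j)" by auto
    moreover have "1 \<le> i" using ij by (auto simp: boxes_def)
    moreover have "(2 * i - 1 + 1) div 2 = i" "(2 * i + 1) div 2 = i" using \<open>1 \<le> i\<close> by auto
    ultimately show "x \<in> boxes (double_rows \<nu>)" by (auto simp: in_iff)
  qed
  have pos: "1 \<le> i" if "(i, j) \<in> ?B" for i j using that by (auto simp: boxes_def)
  have "i = i'" if "(i, j) \<in> ?B" "(i', j') \<in> ?B" "2 * i - 1 = 2 * i' - 1" for i j i' j'
    using pos[OF that(1)] pos[OF that(2)] that(3) by arith
  then have "inj_on ?o ?B" by (auto simp: inj_on_def)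
  moreover have "inj_on ?e ?B" by (auto simp: inj_on_def)
  moreover have "?o ` ?B \<inter> ?e ` ?B = {}"
  proof -
    have False if "(i, j) \<in> ?B" "2 * i - 1 = 2 * k" for i j k :: nat
      using pos[OF that(1)] that(2) by presburger
    then show ?thesis by auto
  qed
  ultimately have "prod F (boxes (double_rows \<nu>)) = (\<Prod>x\<in>?B. F (?o x)) * (\<Prod>x\<in>?B. F (?e x))"
    unfolding eq by (simp add: prod.union_disjoint prod.reindex)
  also have "\<dots> = (\<Prod>(i, j)\<in>?B. F (2 * i - 1, j) * F (2 * i, j))"
    by (simp add: prod.distrib split_def)
  finally show ?thesis .
qed

lemma card_boxes_double_rows: "card (boxes (double_rows \<nu>)) = 2 * num_boxes \<nu>"
proof -
  \<comment> \<open>Counting is written as a product of factors 2 so that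
    \<open>prod_boxes_double_rows\<close> applies.\<close>
  have "2 ^ card (boxes (double_rows \<nu>)) = (\<Prod>x\<in>boxes (double_rows \<nu>). 2 :: nat)" by simp
  also have "\<dots> = 2 ^ (2 * num_boxes \<nu>)"
    unfolding prod_boxes_double_rows by (simp add: num_boxes_def split_def power_mult)
  finally show ?thesis by (simp only: power_inject_exp)
qed

text \<open>Over a box with arm a and leg l, the boxes in rows 2i - 1 and 2i keep the arm a and have
  legs 2l + 1 and 2l. Their hook lengths a + 2l + 2 and a + 2l + 1 are the factors of
  \<open>hook_H'\<close> and \<open>hook_H\<close> at theta = 2.\<close>

lemma hook_H_double_rows:
  "hook_H \<nu> 2 * hook_H' \<nu> 2
   = real (\<Prod>(i, j)\<in>boxes (double_rows \<nu>). (row (double_rows \<nu>) i - j) + (col (double_rows \<nu>) j - i) + 1)"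
proof -
  have "real (\<Prod>(i, j)\<in>boxes (double_rows \<nu>). (row (double_rows \<nu>) i - j) + (col (double_rows \<nu>) j - i) + 1)
      = (\<Prod>(i, j)\<in>boxes (double_rows \<nu>). real ((row (double_rows \<nu>) i - j) + (col (double_rows \<nu>) j - i) + 1))"
    by (simp add: split_def)
  also have "\<dots> = (\<Prod>(i, j)\<in>boxes \<nu>. ((real (row \<nu> i) - real j) + (real (col \<nu> j) - real i) * 2 + 2)
      * ((real (row \<nu> i) - real j) + (real (col \<nu> j) - real i) * 2 + 1))"
    unfolding prod_boxes_double_rows
  proof (intro prod.cong refl)
    fix x assume x: "x \<in> boxes \<nu>"
    obtain i j where ij: "x = (i, j)" by (metis surj_pair)
    have b: "1 \<le> i" "1 \<le> j" "j \<le> row \<nu> i" "i \<le> col \<nu> j"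
      using x le_col_iff[of i j \<nu>] by (auto simp: ij boxes_def)
    have "row (double_rows \<nu>) (2 * i - 1) = row \<nu> i" "row (double_rows \<nu>) (2 * i) = row \<nu> i" "col (double_rows \<nu>) j = 2 * col \<nu> j"
      using b by (simp_all add: row_double_rows col_double_rows)
    then show "(case x of (i, j) \<Rightarrow> (case (2 * i - 1, j) of (i, j) \<Rightarrow> real ((row (double_rows \<nu>) i - j) + (col (double_rows \<nu>) j - i) + 1))
       * (case (2 * i, j) of (i, j) \<Rightarrow> real ((row (double_rows \<nu>) i - j) + (col (double_rows \<nu>) j - i) + 1)))
      = (case x of (i, j) \<Rightarrow> ((real (row \<nu> i) - real j) + (real (col \<nu> j) - real i) * 2 + 2)
      * ((real (row \<nu> i) - real j) + (real (col \<nu> j) - real i) * 2 + 1))"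
      using b by (simp add: ij of_nat_diff) (simp add: algebra_simps)
  qed
  also have "\<dots> = hook_H' \<nu> 2 * hook_H \<nu> 2"
    by (simp add: hook_H_def hook_H'_def split_def prod.distrib)
  finally show ?thesis by simp
qed

text \<open>
  For $g(c) = (z + c)(z' + c)$ these are $[z+1]_n [z'+1]_n$ and $[-z]_n [-z']_n$. The products run over
  every second content, since only the odd rows of the doubled diagram carry a factor.
\<close>

definition arm_product :: "(int \<Rightarrow> complex) \<Rightarrow> nat \<Rightarrow> complex" where
  "arm_product g n = (\<Prod>k | k \<in> {1..n} \<and> even (n - k). g (int k))"

definition leg_product :: "(int \<Rightarrow> complex) \<Rightarrow> nat \<Rightarrow> complex" where
  "leg_product g n = (\<Prod>k | k < n \<and> odd (n - k). g (- int k))"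

text \<open>Consecutive arm products run over the two parity classes. The arms in a pair of equal
  rows are consecutive, so together they restore a full range of contents.\<close>

lemma arm_product_Suc: "arm_product g (Suc n) * arm_product g n = (\<Prod>k=1..Suc n. g (int k))"
proof -
  have "{1..Suc n} = {k. k \<in> {1..Suc n} \<and> even (Suc n - k)} \<union> {k. k \<in> {1..n} \<and> even (n - k)}"
  proof (intro set_eqI)
    fix k show "k \<in> {1..Suc n} \<longleftrightarrow> k \<in> {k. k \<in> {1..Suc n} \<and> even (Suc n - k)} \<union> {k. k \<in> {1..n} \<and> even (n - k)}"
      by (cases "k = Suc n"; cases "k \<le> n") (auto simp: Suc_diff_le)
  qed
  moreover have "{k. k \<in> {1..Suc n} \<and> even (Suc n - k)} \<inter> {k. k \<in> {1..n} \<and> even (n - k)} = {}"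
    by (auto simp: Suc_diff_le)
  ultimately show ?thesis
    unfolding arm_product_def by (metis (no_types, lifting) finite_Un finite_atLeastAtMost prod.union_disjoint)
qed

lemma arm_product_0 [simp]: "arm_product g 0 = 1"
proof -
  have "{k. k \<in> {1..0 :: nat} \<and> even (0 - k)} = {}" by auto
  then show ?thesis unfolding arm_product_def by (simp only: prod.empty)
qed

lemma prod_pairs: "(\<Prod>i=1..2 * e. F i) = (\<Prod>k=1..e. F (2 * k - 1) * F (2 * k :: nat) :: 'a::comm_monoid_mult)"
  by (induction e) (auto simp: mult.assoc)

context
  fixes \<nu> :: young_diagram
begin

interpretation frobenius "row (double_rows \<nu>)" "col (double_rows \<nu>)" "frob_length (double_rows \<nu>)" by (rule frobenius_frob_length)

lemma diagram_boxes: "diagram = boxes (double_rows \<nu>)"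
  by (simp add: diagram_def boxes_def)

lemma frob_P_decreasing:
  assumes "1 \<le> i" "i < k" "k \<le> frob_length (double_rows \<nu>)"
  shows "frob_P (double_rows \<nu>) k < frob_P (double_rows \<nu>) i"
  using row_antimono[of i k "double_rows \<nu>"] row_ge[of k] row_ge[of i] assms by (simp add: frob_P_def)

lemma frob_Q_decreasing:
  assumes "1 \<le> i" "i < k" "k \<le> frob_length (double_rows \<nu>)"
  shows "frob_Q (double_rows \<nu>) k < frob_Q (double_rows \<nu>) i"
  using conjugate_antimono[OF conjugate_sym[OF conjugate_row_col], of i k "double_rows \<nu>"] frobenius.row_ge[OF flip, of k]
    frobenius.row_ge[OF flip, of i] assms by (simp add: frob_Q_def)

lemma frob_P_pair:
  assumes "odd i" "i + 1 \<le> frob_length (double_rows \<nu>)"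
  shows "frob_P (double_rows \<nu>) i = Suc (frob_P (double_rows \<nu>) (i + 1))"
proof -
  have "row (double_rows \<nu>) (i + 1) = row (double_rows \<nu>) i" using assms by (auto simp: row_double_rows elim!: oddE)
  moreover have "i + 1 \<le> row (double_rows \<nu>) (i + 1)" using D_iff[of "i + 1"] assms by simp
  ultimately show ?thesis by (simp add: frob_P_def)
qed

text \<open>For odd D the rows D and D + 1 have equal length, and the absence of a diagonal box in
  row D + 1 bounds it by D.\<close>

lemma frob_P_last:
  assumes "odd (frob_length (double_rows \<nu>))"
  shows "frob_P (double_rows \<nu>) (frob_length (double_rows \<nu>)) = 0"
proof -
  have "row (double_rows \<nu>) ((frob_length (double_rows \<nu>)) + 1) = row (double_rows \<nu>) (frob_length (double_rows \<nu>))" using assms by (auto simp: row_double_rows elim!: oddE)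
  then show ?thesis using D_iff[of "(frob_length (double_rows \<nu>)) + 1"] by (simp add: frob_P_def)
qed

lemma even_frob_Q:
  assumes "1 \<le> i" "i \<le> frob_length (double_rows \<nu>)"
  shows "even (frob_Q (double_rows \<nu>) i) = even i"
proof -
  have "i \<le> col (double_rows \<nu>) i" using D_iff_col[of i] assms by simp
  moreover have "even (col (double_rows \<nu>) i)" using assms by (simp add: col_double_rows)
  ultimately show ?thesis by (simp add: frob_Q_def)
qed

lemma arm_product_rows:
  "(\<Prod>i=1..frob_length (double_rows \<nu>). arm_product g (frob_P (double_rows \<nu>) i)) = (\<Prod>i=1..frob_length (double_rows \<nu>). if odd i then \<Prod>k=1..frob_P (double_rows \<nu>) i. g (int k) else 1)" (is "?L (frob_length (double_rows \<nu>)) = ?R (frob_length (double_rows \<nu>))")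
proof -
  have ev: "?L (2 * e) = ?R (2 * e)" if "2 * e \<le> frob_length (double_rows \<nu>)" for e
    unfolding prod_pairs
  proof (intro prod.cong refl)
    fix k assume k: "k \<in> {1..e}"
    then have "frob_P (double_rows \<nu>) (2 * k - 1) = Suc (frob_P (double_rows \<nu>) (2 * k))"
      using frob_P_pair[of "2 * k - 1"] that by auto
    then show "arm_product g (frob_P (double_rows \<nu>) (2 * k - 1)) * arm_product g (frob_P (double_rows \<nu>) (2 * k)) =
      (if odd (2 * k - 1) then \<Prod>k=1..frob_P (double_rows \<nu>) (2 * k - 1). g (int k) else 1) * (if odd (2 * k) then \<Prod>k=1..frob_P (double_rows \<nu>) (2 * k). g (int k) else 1)"
      using k arm_product_Suc[of g "frob_P (double_rows \<nu>) (2 * k)"] by auto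
  qed
  show ?thesis
  proof (cases "even (frob_length (double_rows \<nu>))")
    case True
    then show ?thesis using ev[of "frob_length (double_rows \<nu>) div 2"] by simp
  next
    case False
    then have "{1..frob_length (double_rows \<nu>)} = insert (frob_length (double_rows \<nu>)) {1..2 * ((frob_length (double_rows \<nu>)) div 2)}" "(frob_length (double_rows \<nu>)) \<notin> {1..2 * ((frob_length (double_rows \<nu>)) div 2)}" by (auto; presburger)+
    then show ?thesis using ev[of "frob_length (double_rows \<nu>) div 2"] frob_P_last False by simp
  qed
qed

lemma content_product:
  "(\<Prod>(i, j)\<in>boxes \<nu>. g (int j - 1 - 2 * (int i - 1)))
   = (\<Prod>i=1..frob_length (double_rows \<nu>). arm_product g (frob_P (double_rows \<nu>) i) * leg_product g (frob_Q (double_rows \<nu>) i))"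
proof -
  \<comment> \<open>A box (i, j) of \<nu> has the content (j - 1) - 2 (i - 1), which is the ordinary
    content of the box (2i - 1, j) of the doubled diagram; the even rows receive the factor
    1.\<close>
  define F where "F = (\<lambda>(i, j). if odd i then g (int j - int i) else 1)"
  have "(\<Prod>(i, j)\<in>boxes \<nu>. g (int j - 1 - 2 * (int i - 1))) = prod F (boxes (double_rows \<nu>))"
    unfolding prod_boxes_double_rows
  proof (intro prod.cong refl)
    fix x assume x: "x \<in> boxes \<nu>"
    obtain i j where ij: "x = (i, j)" by (metis surj_pair)
    have "1 \<le> i" using x ij by (auto simp: boxes_def)
    then have "odd (2 * i - 1)" "int (2 * i - 1) = 2 * int i - 1" by auto
    then show "(case x of (i, j) \<Rightarrow> g (int j - 1 - 2 * (int i - 1))) = (case x of (i, j) \<Rightarrow> F (2 * i - 1, j) * F (2 * i, j))"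
      by (simp add: ij F_def algebra_simps)
  qed
  also have "\<dots> = (\<Prod>i=1..frob_length (double_rows \<nu>). \<Prod>j=i..row (double_rows \<nu>) i. F (i, j)) * (\<Prod>j=1..frob_length (double_rows \<nu>). \<Prod>i=j+1..col (double_rows \<nu>) j. F (i, j))"
    unfolding diagram_boxes[symmetric] by (rule prod_diagram_diagonal)
  also have "(\<Prod>i=1..frob_length (double_rows \<nu>). \<Prod>j=i..row (double_rows \<nu>) i. F (i, j)) = (\<Prod>i=1..frob_length (double_rows \<nu>). (if odd i then g 0 else 1) * (if odd i then \<Prod>k=1..frob_P (double_rows \<nu>) i. g (int k) else 1))"
  proof (intro prod.cong refl)
    fix i assume "i \<in> {1..frob_length (double_rows \<nu>)}"
    then have i: "i \<le> row (double_rows \<nu>) i" using D_iff[of i] by simp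
    have "(\<Prod>j=i..row (double_rows \<nu>) i. g (int j - int i)) = (\<Prod>k=0..frob_P (double_rows \<nu>) i. g (int k))"
      by (rule prod.reindex_bij_witness[where i = "\<lambda>k. k + i" and j = "\<lambda>j. j - i"]) (use i in \<open>auto simp: frob_P_def of_nat_diff\<close>)
    also have "\<dots> = g 0 * (\<Prod>k=1..frob_P (double_rows \<nu>) i. g (int k))" by (simp add: prod.atLeast_Suc_atMost)
    finally show "(\<Prod>j=i..row (double_rows \<nu>) i. F (i, j)) = (if odd i then g 0 else 1) * (if odd i then \<Prod>k=1..frob_P (double_rows \<nu>) i. g (int k) else 1)"
      by (simp add: F_def)
  qed
  also have "\<dots> = (\<Prod>i=1..frob_length (double_rows \<nu>). if odd i then g 0 else 1) * (\<Prod>i=1..frob_length (double_rows \<nu>). arm_product g (frob_P (double_rows \<nu>) i))"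
    by (simp only: prod.distrib arm_product_rows)
  finally have *: "(\<Prod>(i, j)\<in>boxes \<nu>. g (int j - 1 - 2 * (int i - 1)))
    = (\<Prod>i=1..frob_length (double_rows \<nu>). arm_product g (frob_P (double_rows \<nu>) i)) * (\<Prod>j=1..frob_length (double_rows \<nu>). (if odd j then g 0 else 1) * (\<Prod>i=j+1..col (double_rows \<nu>) j. F (i, j)))"
    by (simp add: prod.distrib mult_ac)
  \<comment> \<open>The diagonal factor g 0 of an odd row is the k = 0 term of the leg product,
    present exactly when the leg, which has the parity of j, is odd. Below the diagonal, row j + k
    is odd iff k and the leg differ in parity.\<close>
  have "(if odd j then g 0 else 1) * (\<Prod>i=j+1..col (double_rows \<nu>) j. F (i, j)) = leg_product g (frob_Q (double_rows \<nu>) j)" if "j \<in> {1..frob_length (double_rows \<nu>)}" for j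
  proof -
    let ?Q = "frob_Q (double_rows \<nu>) j"
    have j: "j \<le> col (double_rows \<nu>) j" using D_iff_col[of j] that by simp
    have par: "even ?Q = even j" using even_frob_Q[of j] that by simp
    have "(\<Prod>i=j+1..col (double_rows \<nu>) j. F (i, j)) = (\<Prod>k=1..?Q. if odd (k + j) then g (- int k) else 1)"
      by (rule prod.reindex_bij_witness[where i = "\<lambda>k. k + j" and j = "\<lambda>i. i - j"]) (use j in \<open>auto simp: frob_Q_def F_def of_nat_diff\<close>)
    also have "\<dots> = (\<Prod>k\<in>{k. k < ?Q \<and> odd (?Q - k)} - {0}. g (- int k))"
    proof (rule prod.mono_neutral_cong_right)
      show "{k. k < ?Q \<and> odd (?Q - k)} - {0} \<subseteq> {1..?Q}" by auto
      show "\<forall>k\<in>{1..?Q} - ({k. k < ?Q \<and> odd (?Q - k)} - {0}). (if odd (k + j) then g (- int k) else 1) = 1"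
        using par by (auto simp: le_less)
    qed (use par in auto)
    finally have e: "(\<Prod>i=j+1..col (double_rows \<nu>) j. F (i, j)) = (\<Prod>k\<in>{k. k < ?Q \<and> odd (?Q - k)} - {0}. g (- int k))" .
    show ?thesis
    proof (cases "odd j")
      case True
      then have "0 \<in> {k. k < ?Q \<and> odd (?Q - k)}" using par by (auto intro: gr0I)
      then have "leg_product g ?Q = g (- int 0) * (\<Prod>k\<in>{k. k < ?Q \<and> odd (?Q - k)} - {0}. g (- int k))"
        unfolding leg_product_def by (intro prod.remove) auto
      then show ?thesis using True unfolding e by simp
    next
      case False
      then have "{k. k < ?Q \<and> odd (?Q - k)} - {0} = {k. k < ?Q \<and> odd (?Q - k)}" using par by auto
      then show ?thesis using False unfolding e leg_product_def by simp
    qed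
  qed
  then show ?thesis unfolding * prod.distrib[symmetric] by (intro prod.cong refl) auto
qed

end

section \<open>Configurations\<close>

lemma config_minus_image:
  "config_minus \<nu> = (\<lambda>i. - real (frob_Q (double_rows \<nu>) i) - 1 / 2) ` {1..frob_length (double_rows \<nu>)}"
  by (auto simp: config_minus_def Let_def)

lemma config_plus_image:
  "config_plus \<nu> = (if odd (frob_length (double_rows \<nu>)) then {1 / 2} else {}) \<union>
     (\<lambda>i. real (frob_P (double_rows \<nu>) i) + 1 / 2) ` {i. odd i \<and> i + 1 \<le> frob_length (double_rows \<nu>)}"
proof -
  have "i + 2 \<le> d \<longleftrightarrow> i + 1 \<le> d" if "odd d" "odd i" for d i :: nat
    using that by presburger
  then show ?thesis by (auto simp: config_plus_def Let_def)
qed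

lemma odd_indices: "{i :: nat. odd i \<and> i + 1 \<le> d} = (\<lambda>k. 2 * k + 1) ` {..<d div 2}"
proof (intro equalityI subsetI)
  fix i assume "i \<in> {i :: nat. odd i \<and> i + 1 \<le> d}"
  then have "odd i" "i + 1 \<le> d" by auto
  then have "i = 2 * (i div 2) + 1" "i div 2 < d div 2" by presburger+
  then show "i \<in> (\<lambda>k. 2 * k + 1) ` {..<d div 2}" by blast
qed auto

lemma even_point_pos [simp]: "even_point (real n + 1 / 2) = even n"
  by (simp add: even_point_def)

lemma even_point_neg [simp]: "even_point (- real n - 1 / 2) = even n"
proof -
  have "\<bar>- real n - 1 / 2\<bar> - 1 / 2 = real n" by simp
  then show ?thesis by (simp add: even_point_def)
qed

lemma half_integer_pos: "real n + 1 / 2 \<in> half_integers"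
  by (auto simp: half_integers_def intro: exI[of _ "int n"])

lemma half_integer_neg: "- real n - 1 / 2 \<in> half_integers"
  by (auto simp: half_integers_def intro: exI[of _ "- int n - 1"])

lemma alternating_append:
  "alternating od xs \<Longrightarrow> alternating od (xs @ ys) = alternating od ys"
  by (induction xs rule: induct_list012) auto

lemma alternating_map_upt:
  assumes "\<And>i. 1 \<le> i \<Longrightarrow> i \<le> 2 * m \<Longrightarrow> od (f i) = odd i"
  shows "alternating od (map f [1..<Suc (2 * m)])"
  using assms
proof (induction m)
  case (Suc m)
  have "[1..<Suc (2 * Suc m)] = [1..<Suc (2 * m)] @ [Suc (2 * m), Suc (Suc (2 * m))]" by simp
  then have "map f [1..<Suc (2 * Suc m)] = map f [1..<Suc (2 * m)] @ [f (Suc (2 * m)), f (Suc (Suc (2 * m)))]"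
    by (simp only: map_append list.map)
  moreover have "alternating od (map f [1..<Suc (2 * m)])" by (rule Suc.IH) (use Suc.prems in simp)
  moreover have "alternating od [f (Suc (2 * m)), f (Suc (Suc (2 * m)))]" using Suc.prems by simp
  ultimately show ?case by (simp only: alternating_append)
qed simp

lemma alternating_nth:
  "alternating od xs \<Longrightarrow> n < length xs \<Longrightarrow> od (xs ! n) = even n"
proof (induction xs arbitrary: n rule: induct_list012)
  case (3 a b xs)
  show ?case
  proof (cases "n < 2")
    case True
    then have "n = 0 \<or> n = 1" by auto
    then show ?thesis using "3.prems" by auto
  next
    case False
    then obtain k where "n = Suc (Suc k)" by (metis add_2_eq_Suc le_Suc_ex not_less)
    then show ?thesis using "3.prems" "3.IH"(1)[of k] by simp
  qed
qed auto

lemma sorted_map_upt: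
  fixes f :: "nat \<Rightarrow> real"
  assumes "\<And>i k. 1 \<le> i \<Longrightarrow> i < k \<Longrightarrow> k \<le> D \<Longrightarrow> f i < f k"
  shows "sorted_wrt (<) (map f [1..<Suc D])"
  using assms by (auto simp: sorted_wrt_iff_nth_less nth_append)

lemma strictly_increasing_image_unique:
  fixes f g :: "nat \<Rightarrow> real"
  assumes "\<And>i k. 1 \<le> i \<Longrightarrow> i < k \<Longrightarrow> k \<le> D \<Longrightarrow> f i < f k" "\<And>i k. 1 \<le> i \<Longrightarrow> i < k \<Longrightarrow> k \<le> D \<Longrightarrow> g i < g k"
    and "f ` {1..D} = g ` {1..D}" and i: "1 \<le> i" "i \<le> D"
  shows "f i = g i"
proof -
  have "sorted_wrt (<) (map f [1..<Suc D])" "sorted_wrt (<) (map g [1..<Suc D])"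
    using assms(1,2) by (blast intro: sorted_map_upt)+
  moreover have "set (map f [1..<Suc D]) = set (map g [1..<Suc D])"
    using assms(3) by (simp only: set_map atLeastLessThanSuc_atLeastAtMost set_upt)
  ultimately have "map f [1..<Suc D] = map g [1..<Suc D]" by (metis strict_sorted_equal)
  then show ?thesis using i by (auto simp del: upt_Suc)
qed

lemma vandermonde_increasing:
  fixes f :: "nat \<Rightarrow> real" and D :: nat
  assumes "\<And>i k. 1 \<le> i \<Longrightarrow> i < k \<Longrightarrow> k \<le> D \<Longrightarrow> f i < f k"
  shows "vandermonde (f ` {1..D}) = (\<Prod>i=1..D. \<Prod>k=i+1..D. f k - f i)"
proof -
  have less_iff: "f i < f k \<longleftrightarrow> i < k" if "i \<in> {1..D}" "k \<in> {1..D}" for i k :: nat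
    using assms[of i k] assms[of k i] that by (cases i k rule: linorder_cases) auto
  have inj: "inj_on f {1..D}"
    using less_iff by (intro inj_onI) (metis less_irrefl nat_neq_iff)
  let ?S = "SIGMA i:{1..D}. {i+1..D}"
  have img: "{(a, b). a \<in> f ` {1..D} \<and> b \<in> f ` {1..D} \<and> a < b} = (\<lambda>(i, k). (f i, f k)) ` ?S" (is "?T = _")
  proof (intro equalityI subsetI)
    fix p assume "p \<in> ?T"
    then obtain i k where ik: "i \<in> {1..D}" "k \<in> {1..D}" "p = (f i, f k)" "f i < f k" by auto
    then have "(i, k) \<in> ?S" using less_iff[of i k] by auto
    then show "p \<in> (\<lambda>(i, k). (f i, f k)) ` ?S" using ik(3) by (intro image_eqI[of _ _ "(i, k)"]) auto
  next
    fix p assume "p \<in> (\<lambda>(i, k). (f i, f k)) ` ?S"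
    then show "p \<in> ?T" using less_iff by auto
  qed
  have injS: "inj_on (\<lambda>(i, k). (f i, f k)) ?S"
  proof (rule inj_onI)
    fix p p' assume "p \<in> ?S" "p' \<in> ?S" "(case p of (i, k) \<Rightarrow> (f i, f k)) = (case p' of (i, k) \<Rightarrow> (f i, f k))"
    then show "p = p'"
      using inj_onD[OF inj, of "fst p" "fst p'"] inj_onD[OF inj, of "snd p" "snd p'"]
      by (cases p; cases p') auto
  qed
  have "vandermonde (f ` {1..D}) = (\<Prod>(i, k)\<in>?S. f k - f i)"
    unfolding vandermonde_def img prod.reindex[OF injS] by (intro prod.cong) auto
  also have "\<dots> = (\<Prod>i=1..D. \<Prod>k=i+1..D. f k - f i)"
    by (subst prod.Sigma) auto
  finally show ?thesis .
qed

lemma vandermonde_decreasing: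
  fixes f :: "nat \<Rightarrow> real" and D :: nat
  assumes "\<And>i k. 1 \<le> i \<Longrightarrow> i < k \<Longrightarrow> k \<le> D \<Longrightarrow> f k < f i"
  shows "vandermonde (f ` {1..D}) = (\<Prod>i=1..D. \<Prod>k=i+1..D. f i - f k)"
proof -
  have "vandermonde (uminus ` S) = vandermonde S" for S
    unfolding vandermonde_def
    by (rule prod.reindex_bij_witness[where i = "\<lambda>(a, b). (- b, - a)" and j = "\<lambda>(a, b). (- b, - a)"]) auto
  then have "vandermonde (f ` {1..D}) = vandermonde ((\<lambda>i. - f i) ` {1..D})"
    by (metis image_image)
  also have "\<dots> = (\<Prod>i=1..D. \<Prod>k=i+1..D. - f k - - f i)"
    by (rule vandermonde_increasing) (use assms in simp)
  finally show ?thesis by simp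
qed

lemma row_lengths_nth: "i < length (row_lengths \<nu>) \<Longrightarrow> row_lengths \<nu> ! i = row \<nu> (Suc i) \<and> row \<nu> (Suc i) \<noteq> 0"
  using row_lengths[of \<nu>] by (auto simp: row_def) (metis gr0I nth_mem)

lemma young_diagram_eqI:
  assumes "\<And>i. 1 \<le> i \<Longrightarrow> row \<nu> i = row \<nu>' i"
  shows "\<nu> = \<nu>'"
proof -
  have le: "length (row_lengths \<kappa>) \<le> length (row_lengths \<kappa>')" if "\<And>i. 1 \<le> i \<Longrightarrow> row \<kappa> i = row \<kappa>' i" for \<kappa> \<kappa>'
  proof (rule ccontr)
    assume "\<not> ?thesis"
    then have "row \<kappa> (Suc (length (row_lengths \<kappa>'))) \<noteq> 0" using row_lengths_nth[of "length (row_lengths \<kappa>')" \<kappa>] by simp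
    then show False using that[of "Suc (length (row_lengths \<kappa>'))"] row_eq_0(1)[of \<kappa>'] by simp
  qed
  have "row_lengths \<nu> = row_lengths \<nu>'"
  proof (rule nth_equalityI)
    show len: "length (row_lengths \<nu>) = length (row_lengths \<nu>')"
      using le[OF assms] le[OF assms[symmetric]] by simp
    show "row_lengths \<nu> ! i = row_lengths \<nu>' ! i" if "i < length (row_lengths \<nu>)" for i
      using that row_lengths_nth[of i \<nu>] row_lengths_nth[of i \<nu>'] assms[of "Suc i"] len by simp
  qed
  then show ?thesis by (simp add: row_lengths_inject)
qed

lemma young_diagram_exists:
  fixes f :: "nat \<Rightarrow> nat"
  assumes "\<And>i k. 1 \<le> i \<Longrightarrow> i \<le> k \<Longrightarrow> f k \<le> f i" "\<And>i. i > N \<Longrightarrow> f i = 0"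
  obtains \<nu> where "\<And>i. 1 \<le> i \<Longrightarrow> row \<nu> i = f i"
proof -
  let ?S = "{i. 1 \<le> i \<and> f i \<noteq> 0}"
  define M where "M = card ?S"
  have S: "?S = {1..M}"
    unfolding M_def
  proof (rule down_closed_eq_atLeastAtMost)
    show "finite ?S" by (rule finite_subset[of _ "{..N}"]) (use assms(2) not_less in auto)
    show "k \<in> ?S" if "i \<in> ?S" "1 \<le> k" "k \<le> i" for i k using assms(1)[of k i] that by auto
  qed auto
  let ?rs = "map f [1..<Suc M]"
  have nz: "f i \<noteq> 0 \<longleftrightarrow> i \<le> M" if "1 \<le> i" for i
  proof -
    have "i \<in> ?S \<longleftrightarrow> i \<in> {1..M}" unfolding S by (rule refl)
    then show ?thesis using that by simp
  qed
  have "sorted_wrt (\<ge>) ?rs" using assms(1) by (auto simp: sorted_wrt_iff_nth_less simp del: upt_Suc)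
  moreover have "0 \<notin> set ?rs" using nz by (force simp del: upt_Suc)
  ultimately have e: "row_lengths (Young_Diagram ?rs) = ?rs" by (intro Young_Diagram_inverse) blast
  show ?thesis
  proof (rule that)
    fix i :: nat assume "1 \<le> i"
    then show "row (Young_Diagram ?rs) i = f i"
      using nz[of i] unfolding row_def e by (auto simp del: upt_Suc)
  qed
qed

text \<open>g is a function of the content: (z + c)(z' + c) gives the z-measure and 1 the Plancherel
  measure, up to the power q^|\<nu>| and the normalisation.\<close>

definition box_weight :: "(int \<Rightarrow> complex) \<Rightarrow> young_diagram \<Rightarrow> complex" where
  "box_weight g \<nu> = (\<Prod>(i, j)\<in>boxes \<nu>. g (int j - 1 - 2 * (int i - 1))) / of_real (hook_H \<nu> 2 * hook_H' \<nu> 2)"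

section \<open>The sorted configuration of one diagram and its Pfaffian\<close>

context
  fixes \<nu> :: young_diagram and \<mu> :: young_diagram and D :: nat and P Q :: "nat \<Rightarrow> nat" and ns hs ys :: "real list"
  defines "\<mu> \<equiv> double_rows \<nu>" and "D \<equiv> frob_length \<mu>" and "P \<equiv> frob_P \<mu>" and "Q \<equiv> frob_Q \<mu>"
    and "ns \<equiv> map (\<lambda>i. - real (frob_Q (double_rows \<nu>) i) - 1 / 2) [1..<Suc (frob_length (double_rows \<nu>))]"
    and "hs \<equiv> if odd (frob_length (double_rows \<nu>)) then [1 / 2] else []"
    and "ys \<equiv> sorted_list_of_set ((\<lambda>i. real (frob_P (double_rows \<nu>) i) + 1 / 2) ` {i. odd i \<and> i + 1 \<le> frob_length (double_rows \<nu>)})"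
begin

interpretation frobenius "row \<mu>" "col \<mu>" D unfolding D_def by (rule frobenius_frob_length)

lemma P_dec: "1 \<le> i \<Longrightarrow> i < k \<Longrightarrow> k \<le> D \<Longrightarrow> P k < P i"
  unfolding P_def D_def \<mu>_def by (rule frob_P_decreasing)

lemma Q_dec: "1 \<le> i \<Longrightarrow> i < k \<Longrightarrow> k \<le> D \<Longrightarrow> Q k < Q i"
  unfolding Q_def D_def \<mu>_def by (rule frob_Q_decreasing)

lemma inj_P_points: "inj_on (\<lambda>i. real (P i) + 1 / 2) {1..D}"
proof (rule inj_onI)
  fix i k assume "i \<in> {1..D}" "k \<in> {1..D}" "real (P i) + 1 / 2 = real (P k) + 1 / 2"
  then show "i = k" using P_dec[of i k] P_dec[of k i] by (cases i k rule: linorder_cases) auto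
qed

lemma inj_Q_points: "inj_on (\<lambda>i. - real (Q i) - 1 / 2) {1..D}"
proof (rule inj_onI)
  fix i k assume "i \<in> {1..D}" "k \<in> {1..D}" "- real (Q i) - 1 / 2 = - real (Q k) - 1 / 2"
  then show "i = k" using Q_dec[of i k] Q_dec[of k i] by (cases i k rule: linorder_cases) auto
qed

lemma P_pair: "odd i \<Longrightarrow> i + 1 \<le> D \<Longrightarrow> P i = Suc (P (i + 1))"
  unfolding P_def D_def \<mu>_def by (rule frob_P_pair)

lemma P_last: "odd D \<Longrightarrow> P D = 0"
  unfolding P_def D_def \<mu>_def by (rule frob_P_last)

lemma Q_parity: "1 \<le> i \<Longrightarrow> i \<le> D \<Longrightarrow> even (Q i) = even i"
  unfolding Q_def D_def \<mu>_def by (rule even_frob_Q)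

lemmas abbr = \<mu>_def[symmetric] D_def[symmetric] P_def[symmetric] Q_def[symmetric]

lemma finite_odd_image: "finite ((\<lambda>i. real (P i) + 1 / 2) ` {i. odd i \<and> i + 1 \<le> D})"
  unfolding odd_indices by simp

lemma set_ys: "set ys = (\<lambda>i. real (P i) + 1 / 2) ` {i. odd i \<and> i + 1 \<le> D}"
  unfolding ys_def abbr using finite_odd_image by simp

lemma set_hs: "set hs = (if odd D then {1 / 2} else {})"
  unfolding hs_def abbr by (cases "odd D") simp_all

lemma set_ns: "set ns = (\<lambda>i. - real (Q i) - 1 / 2) ` {1..D}"
  unfolding ns_def abbr by (simp only: set_map set_upt atLeastLessThanSuc_atLeastAtMost)

lemma ys_gt_1: "y \<in> set ys \<Longrightarrow> y > 1"
  using P_pair by (auto simp: set_ys)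

lemma length_ys: "length ys = D div 2"
proof -
  have "inj_on (\<lambda>i. real (P i) + 1 / 2) {i. odd i \<and> i + 1 \<le> D}"
    by (rule inj_on_subset[OF inj_P_points]) (auto simp: Suc_le_eq odd_pos)
  then have "length ys = card {i. odd i \<and> i + 1 \<le> D}"
    unfolding ys_def abbr using finite_odd_image by (simp add: card_image)
  also have "\<dots> = D div 2" unfolding odd_indices by (simp add: card_image inj_on_def)
  finally show ?thesis .
qed

lemma length_ns: "length ns = D" unfolding ns_def abbr by simp

lemma set_config: "set (ns @ hs @ ys) = config \<nu>"
  unfolding config_def config_minus_image config_plus_image set_append set_ns set_ys
  unfolding set_hs abbr by (simp only: Un_assoc)

lemma sorted_config: "sorted_wrt (<) (ns @ hs @ ys)"
proof -
  have "sorted_wrt (<) ns" unfolding ns_def abbr by (rule sorted_map_upt) (use Q_dec in force)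
  moreover have "sorted_wrt (<) ys" unfolding ys_def by (rule strict_sorted_list_of_set)
  moreover have "x < 0" if "x \<in> set ns" for x using that by (auto simp: set_ns)
  ultimately show ?thesis using ys_gt_1 unfolding hs_def by (fastforce simp: sorted_wrt_append)
qed

lemma sorted_list_config: "sorted_list_of_set (config \<nu>) = ns @ hs @ ys"
proof -
  have "set (sorted_list_of_set (config \<nu>)) = set (ns @ hs @ ys)"
    unfolding set_config[symmetric] by simp
  then show ?thesis using sorted_config strict_sorted_list_of_set by (metis strict_sorted_equal)
qed

lemma config_subset: "config \<nu> \<subseteq> half_integers" "finite (config \<nu>)"
proof -
  have "1 / 2 \<in> half_integers" using half_integer_pos[of 0] by simp
  then show "config \<nu> \<subseteq> half_integers"
    unfolding set_config[symmetric] set_append set_ns set_ys set_hs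
    using half_integer_pos half_integer_neg by auto
  show "finite (config \<nu>)" unfolding set_config[symmetric] by simp
qed

text \<open>The points of \<open>ys\<close> have odd index, and y - 1 supplies the following even
  index because P drops by one within a pair. For odd D the last coordinate is 0 and gives
  1/2.\<close>

lemma set_positive_points: "set (hs @ paired_points ys) = (\<lambda>i. real (P i) + 1 / 2) ` {1..D}"
proof -
  have "set (paired_points ys) = (\<Union>i\<in>{i. odd i \<and> i + 1 \<le> D}. {real (P (i + 1)) + 1 / 2, real (P i) + 1 / 2})"
    unfolding set_paired_points set_ys using P_pair by auto
  also have "\<dots> = (\<lambda>i. real (P i) + 1 / 2) ` {1..2 * (D div 2)}" (is "?L = ?R")
  proof (intro equalityI subsetI)
    fix x assume "x \<in> ?L"
    then obtain i where i: "odd i" "i + 1 \<le> D" "x = real (P (i + 1)) + 1 / 2 \<or> x = real (P i) + 1 / 2" by auto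
    have "1 \<le> i" "i \<le> 2 * (D div 2)" "i + 1 \<le> 2 * (D div 2)" using i(1,2) by presburger+
    then have "i \<in> {1..2 * (D div 2)}" "i + 1 \<in> {1..2 * (D div 2)}" by auto
    then show "x \<in> ?R" using i(3) by blast
  next
    fix x assume "x \<in> ?R"
    then obtain i where i: "1 \<le> i" "i \<le> 2 * (D div 2)" "x = real (P i) + 1 / 2" by auto
    show "x \<in> ?L"
    proof (cases "odd i")
      case True
      then have "i + 1 \<le> D" using i by presburger
      then show ?thesis using True i by auto
    next
      case False
      then have "odd (i - 1)" "i - 1 + 1 = i" "i \<le> D" using i by auto
      then show ?thesis using i by (intro UN_I[of "i - 1"]) auto
    qed
  qed
  finally have pp: "set (paired_points ys) = (\<lambda>i. real (P i) + 1 / 2) ` {1..2 * (D div 2)}" .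
  show ?thesis
  proof (cases "odd D")
    case True
    then have e: "{1..D} = insert D {1..2 * (D div 2)}" by (auto; presburger)
    have "real (P D) + 1 / 2 = 1 / 2" using P_last[OF True] by simp
    then show ?thesis unfolding set_append pp set_hs e image_insert using True by simp
  next
    case False
    then have "2 * (D div 2) = D" by presburger
    then show ?thesis unfolding set_append pp set_hs using False by simp
  qed
qed

text \<open>D entries with D different values leave no room for a repetition.\<close>

lemma sorted_positive_points: "sorted_wrt (<) (hs @ paired_points ys)"
proof -
  let ?vs = "hs @ paired_points ys"
  have "card (set ?vs) = D"
  proof -
    show ?thesis unfolding set_positive_points using inj_P_points by (simp add: card_image)
  qed
  moreover have "length ?vs = D" using length_ys by (simp add: hs_def abbr)
  ultimately have "distinct ?vs" by (intro card_distinct) simp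
  moreover have "sorted ?vs"
  proof -
    have "sorted (paired_points ys)"
      using sorted_config config_subset set_config by (intro sorted_paired_points) (auto simp: sorted_wrt_append)
    moreover have "1 / 2 \<le> v" if "v \<in> set ?vs" for v using that unfolding set_positive_points by auto
    ultimately show ?thesis by (auto simp: hs_def)
  qed
  ultimately show ?thesis using strict_sorted_iff by blast
qed

text \<open>\<open>Q i\<close> has the parity of i, and for odd D the even point 1/2 fills place D +
  1.\<close>

lemma alternating_config: "alternating (\<lambda>x. \<not> even_point x) (ns @ hs)"
proof -
  have "alternating (\<lambda>x. \<not> even_point x) (map (\<lambda>i. if i \<le> D then - real (Q i) - 1 / 2 else 1 / 2) [1..<Suc (2 * ((D + 1) div 2))])"
  proof (rule alternating_map_upt)
    fix i assume i: "1 \<le> i" "i \<le> 2 * ((D + 1) div 2)"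
    have "odd D \<and> i = D + 1" if "\<not> i \<le> D" using i that by presburger
    moreover have "even_point (1 / 2)" using even_point_pos[of 0] by simp
    ultimately show "(\<not> even_point (if i \<le> D then - real (Q i) - 1 / 2 else 1 / 2)) = odd i"
      using Q_parity[of i] i by auto
  qed
  also have "map (\<lambda>i. if i \<le> D then - real (Q i) - 1 / 2 else 1 / 2) [1..<Suc (2 * ((D + 1) div 2))] = ns @ hs"
  proof (cases "odd D")
    case True
    then have "[1..<Suc (2 * ((D + 1) div 2))] = [1..<Suc D] @ [Suc D]" by auto
    then show ?thesis using True unfolding ns_def hs_def abbr by (simp del: upt_Suc)
  next
    case False
    then have "[1..<Suc (2 * ((D + 1) div 2))] = [1..<Suc D]" by auto
    then show ?thesis using False unfolding ns_def hs_def abbr by (simp del: upt_Suc)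
  qed
  finally show ?thesis .
qed

text \<open>All factors come from the coordinates: the Vandermonde products are those of the
  \<open>Q i\<close> and the \<open>P i\<close>, and v - x is P i + Q j + 1. This is
  \<open>hook_product\<close> solved for the reciprocal hook product.\<close>

lemma hook_vandermonde:
  "vandermonde (set ns) * vandermonde (set (hs @ paired_points ys)) / (\<Prod>x\<in>set ns. \<Prod>v\<in>set (hs @ paired_points ys). v - x)
   = (\<Prod>i=1..D. fact (P i) * fact (Q i)) / (hook_H \<nu> 2 * hook_H' \<nu> 2)"
proof -
  have VQ: "vandermonde (set ns) = (\<Prod>i=1..D. \<Prod>k=i+1..D. real (Q i - Q k))"
    unfolding set_ns using Q_dec
    by (subst vandermonde_increasing) (auto intro!: prod.cong simp: of_nat_diff less_imp_le)
  have VP: "vandermonde (set (hs @ paired_points ys)) = (\<Prod>i=1..D. \<Prod>k=i+1..D. real (P i - P k))"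
    unfolding set_positive_points using P_dec
    by (subst vandermonde_decreasing) (auto intro!: prod.cong simp: of_nat_diff less_imp_le)
  have C: "(\<Prod>x\<in>set ns. \<Prod>v\<in>set (hs @ paired_points ys). v - x) = (\<Prod>i=1..D. \<Prod>j=1..D. real (P i + Q j + 1))"
    unfolding set_ns set_positive_points prod.reindex[OF inj_Q_points] prod.reindex[OF inj_P_points] comp_def
    by (subst prod.swap) (auto intro!: prod.cong)
  have "real (\<Prod>(i, j)\<in>diagram. (row \<mu> i - j) + (col \<mu> j - i) + 1)
     * (real (\<Prod>i=1..D. \<Prod>k=i+1..D. P i - P k) * real (\<Prod>i=1..D. \<Prod>k=i+1..D. Q i - Q k))
   = real (\<Prod>i=1..D. \<Prod>j=1..D. P i + Q j + 1) * (real (\<Prod>i=1..D. fact (P i)) * real (\<Prod>j=1..D. fact (Q j)))"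
    using hook_product unfolding P_def Q_def frob_P_def frob_Q_def of_nat_mult[symmetric] by (simp only:)
  moreover have "diagram = boxes \<mu>" by (simp add: diagram_def boxes_def)
  ultimately have H: "(hook_H \<nu> 2 * hook_H' \<nu> 2) * (vandermonde (set (hs @ paired_points ys)) * vandermonde (set ns))
     = (\<Prod>x\<in>set ns. \<Prod>v\<in>set (hs @ paired_points ys). v - x) * (\<Prod>i=1..D. fact (P i) * fact (Q i))"
    unfolding VP VQ C hook_H_double_rows \<mu>_def[symmetric] by (simp add: prod.distrib)
  have "(\<Prod>x\<in>set ns. \<Prod>v\<in>set (hs @ paired_points ys). v - x) \<noteq> 0"
    unfolding C by (simp add: prod_zero_iff)
  moreover have "hook_H \<nu> 2 * hook_H' \<nu> 2 \<noteq> 0"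
    using H calculation by auto
  ultimately show ?thesis using H by (simp add: field_simps)
qed

text \<open>The factorials in h cancel those of \<open>hook_vandermonde\<close>, and the exponents
  |x|/2 add up to half the number of boxes of the doubled diagram, that is |\<nu>|.\<close>

theorem pf_submatrix_config:
  assumes hP: "\<And>n. h (real n + 1 / 2) = arm_product g n / fact n * of_real (q powr ((real n + 1 / 2) / 2))"
    and hQ: "\<And>n. h (- real n - 1 / 2) = leg_product g n / fact n * of_real (q powr ((real n + 1 / 2) / 2))"
    and q: "q > 0"
  shows "pf_submatrix (L_matrix h) (config \<nu>) = of_real (q ^ num_boxes \<nu>) * box_weight g \<nu>"
proof -
  let ?vs = "hs @ paired_points ys"
  have len: "length ns = length ?vs" using length_ns length_ys by (simp add: hs_def abbr)
  have "pf_submatrix (L_matrix h) (config \<nu>) = (\<Prod>x\<in>set ns. h x) * (\<Prod>v\<in>set ?vs. h v) *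
     of_real (vandermonde (set ns) * vandermonde (set ?vs) / (\<Prod>x\<in>set ns. \<Prod>v\<in>set ?vs. v - x))"
  proof -
    have "x < 0" if "x \<in> set ns" for x using that by (auto simp: set_ns)
    moreover have "hs = [] \<or> hs = [1 / 2]" by (simp add: hs_def)
    ultimately show ?thesis
      using pf_submatrix_L_matrix_eq[OF config_subset(2,1) sorted_list_config _ _ ys_gt_1, of h]
        alternating_config len sorted_positive_points by (simp only: if_True simp_thms)
  qed
  also have "\<dots> = (\<Prod>i=1..D. h (- real (Q i) - 1 / 2) * h (real (P i) + 1 / 2)) * of_real ((\<Prod>i=1..D. fact (P i) * fact (Q i)) / (hook_H \<nu> 2 * hook_H' \<nu> 2))"
    unfolding hook_vandermonde unfolding set_ns set_positive_points prod.reindex[OF inj_Q_points] prod.reindex[OF inj_P_points]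
    by (simp add: prod.distrib)
  also have "\<dots> = (\<Prod>i=1..D. h (- real (Q i) - 1 / 2) * h (real (P i) + 1 / 2) * (fact (P i) * fact (Q i))) / of_real (hook_H \<nu> 2 * hook_H' \<nu> 2)"
    by (simp add: prod.distrib)
  also have "(\<Prod>i=1..D. h (- real (Q i) - 1 / 2) * h (real (P i) + 1 / 2) * (fact (P i) * fact (Q i)))
     = (\<Prod>i=1..D. (arm_product g (P i) * leg_product g (Q i)) * of_real (q powr (real (P i + Q i + 1) / 2)))"
  proof (intro prod.cong refl)
    fix i
    have "q powr ((real (Q i) + 1 / 2) / 2) * q powr ((real (P i) + 1 / 2) / 2) = q powr (real (P i + Q i + 1) / 2)"
      unfolding powr_add[symmetric] by (rule arg_cong[where f = "\<lambda>t. q powr t"]) (simp add: field_simps)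
    then have *: "complex_of_real (q powr ((real (Q i) + 1 / 2) / 2)) * of_real (q powr ((real (P i) + 1 / 2) / 2)) = of_real (q powr (real (P i + Q i + 1) / 2))"
      unfolding of_real_mult[symmetric] by (rule arg_cong)
    show "h (- real (Q i) - 1 / 2) * h (real (P i) + 1 / 2) * (fact (P i) * fact (Q i)) = (arm_product g (P i) * leg_product g (Q i)) * of_real (q powr (real (P i + Q i + 1) / 2))"
      unfolding hP hQ *[symmetric] by (simp add: field_simps)
  qed
  also have "\<dots> = (\<Prod>(i, j)\<in>boxes \<nu>. g (int j - 1 - 2 * (int i - 1))) * of_real (\<Prod>i=1..D. q powr (real (P i + Q i + 1) / 2))"
    unfolding prod.distrib[of "\<lambda>i. arm_product g (P i) * leg_product g (Q i)"] of_real_prod content_product abbr ..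
  also have "(\<Prod>i=1..D. q powr (real (P i + Q i + 1) / 2)) = q ^ num_boxes \<nu>"
  proof -
    have "(\<Prod>i=1..D. q powr (real (P i + Q i + 1) / 2)) = q powr (\<Sum>i=1..D. real (P i + Q i + 1) / 2)"
      using q by (simp add: powr_sum)
    also have "(\<Sum>i=1..D. real (P i + Q i + 1) / 2) = real (\<Sum>i=1..D. P i + Q i + 1) / 2"
      by (simp add: sum_divide_distrib)
    also have "(\<Sum>i=1..D. P i + Q i + 1) = card diagram" unfolding card_diagram P_def Q_def frob_P_def frob_Q_def ..
    also have "diagram = boxes \<mu>" by (simp add: diagram_def boxes_def)
    also have "card (boxes \<mu>) = 2 * num_boxes \<nu>" unfolding \<mu>_def by (rule card_boxes_double_rows)
    finally show ?thesis using q by (simp add: powr_realpow)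
  qed
  finally show ?thesis by (simp add: box_weight_def)
qed

end

section \<open>Injectivity and image of the embedding\<close>

lemma row_eq_of_frobenius:
  assumes D: "frob_length \<mu> = frob_length \<mu>'"
    and P: "\<And>i. 1 \<le> i \<Longrightarrow> i \<le> frob_length \<mu> \<Longrightarrow> frob_P \<mu> i = frob_P \<mu>' i"
    and Q: "\<And>i. 1 \<le> i \<Longrightarrow> i \<le> frob_length \<mu> \<Longrightarrow> frob_Q \<mu> i = frob_Q \<mu>' i"
    and i: "1 \<le> i"
  shows "row \<mu> i = row \<mu>' i"
proof -
  interpret f: frobenius "row \<mu>" "col \<mu>" "frob_length \<mu>" by (rule frobenius_frob_length)
  interpret f': frobenius "row \<mu>'" "col \<mu>'" "frob_length \<mu>" unfolding D by (rule frobenius_frob_length)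
  show ?thesis
  proof (cases "i \<le> frob_length \<mu>")
    case True
    then show ?thesis using P[OF i True] f.D_iff[OF i] f'.D_iff[OF i] by (simp add: frob_P_def)
  next
    case False
    have iff: "j \<le> row \<mu> i \<longleftrightarrow> j \<le> row \<mu>' i" if j: "1 \<le> j" for j
    proof (cases "j \<le> frob_length \<mu>")
      case True
      have "col \<mu> j = col \<mu>' j"
        using Q[OF j True] f.D_iff_col[OF j] f'.D_iff_col[OF j] True by (simp add: frob_Q_def)
      then show ?thesis using le_col_iff[OF i j, of \<mu>] le_col_iff[OF i j, of \<mu>'] by simp
    next
      case False
      then have "\<not> j \<le> row \<mu> i" "\<not> j \<le> row \<mu>' i"
        using f.col_beyond[of j] f'.col_beyond[of j] \<open>\<not> i \<le> frob_length \<mu>\<close> le_col_iff[OF i j, of \<mu>] le_col_iff[OF i j, of \<mu>'] by auto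
      then show ?thesis by simp
    qed
    show ?thesis using iff[of "row \<mu> i"] iff[of "row \<mu>' i"] by (cases "row \<mu> i = 0"; cases "row \<mu>' i = 0") auto
  qed
qed

lemma double_rows_inj:
  assumes "\<And>i. 1 \<le> i \<Longrightarrow> row (double_rows \<nu>) i = row (double_rows \<nu>') i"
  shows "\<nu> = \<nu>'"
proof (rule young_diagram_eqI)
  fix i :: nat assume "1 \<le> i"
  then show "row \<nu> i = row \<nu>' i" using assms[of "2 * i"] by (simp add: row_double_rows)
qed

text \<open>The negative points determine D and all Q-coordinates. D decides whether 1/2 is listed
  separately, which isolates the remaining points; by \<open>set_positive_points\<close> these
  determine the set of P-coordinates, and monotonicity recovers their indices.\<close>

theorem inj_config: "inj config"
proof (rule injI)
  fix \<nu> \<nu>' assume eq: "config \<nu> = config \<nu>'"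
  define N where "N = (\<lambda>\<nu>. map (\<lambda>i. - real (frob_Q (double_rows \<nu>) i) - 1 / 2) [1..<Suc (frob_length (double_rows \<nu>))])"
  define hs where "hs = (\<lambda>\<nu>. if odd (frob_length (double_rows \<nu>)) then [1 / 2 :: real] else [])"
  define Y where "Y = (\<lambda>\<nu>. sorted_list_of_set ((\<lambda>i. real (frob_P (double_rows \<nu>) i) + 1 / 2) ` {i. odd i \<and> i + 1 \<le> frob_length (double_rows \<nu>)}))"
  have L: "sorted_list_of_set (config \<kappa>) = N \<kappa> @ hs \<kappa> @ Y \<kappa>" for \<kappa>
    unfolding N_def hs_def Y_def by (rule sorted_list_config)
  have "filter (\<lambda>x. x < 0) (N \<kappa> @ hs \<kappa> @ Y \<kappa>) = N \<kappa>" for \<kappa>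
  proof -
    have "x < 0" if "x \<in> set (N \<kappa>)" for x using that by (auto simp: N_def)
    moreover have "\<not> x < 0" if "x \<in> set (Y \<kappa>)" for x using ys_gt_1[of x \<kappa>] that unfolding Y_def by auto
    moreover have "\<not> x < 0" if "x \<in> set (hs \<kappa>)" for x using that by (auto simp: hs_def split: if_splits)
    ultimately show ?thesis by (simp add: filter_id_conv filter_empty_conv)
  qed
  then have N: "N \<nu> = N \<nu>'" by (metis L eq)
  then have "length (N \<nu>) = length (N \<nu>')" by simp
  then have D: "frob_length (double_rows \<nu>) = frob_length (double_rows \<nu>')" by (simp add: N_def del: upt_Suc)
  have Y: "Y \<nu> = Y \<nu>'"
  proof -
    have "hs \<nu> = hs \<nu>'" using D by (simp add: hs_def)
    then show ?thesis using L[of \<nu>] L[of \<nu>'] eq N by simp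
  qed
  have Q: "frob_Q (double_rows \<nu>) i = frob_Q (double_rows \<nu>') i" if "1 \<le> i" "i \<le> frob_length (double_rows \<nu>)" for i
  proof -
    have "N \<nu> ! (i - 1) = N \<nu>' ! (i - 1)" using N by simp
    then show ?thesis using that D unfolding N_def by (simp del: upt_Suc)
  qed
  have img: "(\<lambda>i. real (frob_P (double_rows \<nu>) i) + 1 / 2) ` {1..frob_length (double_rows \<nu>)}
      = (\<lambda>i. real (frob_P (double_rows \<nu>') i) + 1 / 2) ` {1..frob_length (double_rows \<nu>)}"
    using set_positive_points[of \<nu>] set_positive_points[of \<nu>'] Y D unfolding Y_def by simp
  have P: "frob_P (double_rows \<nu>) i = frob_P (double_rows \<nu>') i" if "1 \<le> i" "i \<le> frob_length (double_rows \<nu>)" for i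
  proof -
    have "- (real (frob_P (double_rows \<nu>) i) + 1 / 2) = - (real (frob_P (double_rows \<nu>') i) + 1 / 2)"
    proof (rule strictly_increasing_image_unique[where D = "frob_length (double_rows \<nu>)"
          and f = "\<lambda>i. - (real (frob_P (double_rows \<nu>) i) + 1 / 2)" and g = "\<lambda>i. - (real (frob_P (double_rows \<nu>') i) + 1 / 2)"])
      show "(\<lambda>i. - (real (frob_P (double_rows \<nu>) i) + 1 / 2)) ` {1..frob_length (double_rows \<nu>)}
        = (\<lambda>i. - (real (frob_P (double_rows \<nu>') i) + 1 / 2)) ` {1..frob_length (double_rows \<nu>)}"
        using arg_cong[OF img, of "\<lambda>S. uminus ` S"] by (simp only: image_image)
    qed (use frob_P_decreasing[of _ _ \<nu>] frob_P_decreasing[of _ _ \<nu>'] D that in simp_all)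
    then show ?thesis by simp
  qed
  show "\<nu> = \<nu>'"
    by (rule double_rows_inj) (rule row_eq_of_frobenius[OF D P Q])
qed

text \<open>
  Inverts \<open>\<lambda> \<mapsto> \<lambda> \<squnion> \<lambda>\<close> in Frobenius coordinates: the parity conditions say
  exactly that the rows of the diagram with coordinates \<open>(P | Q)\<close> come in equal pairs.
\<close>

lemma frobenius_coordinates_exist:
  fixes P Q :: "nat \<Rightarrow> nat"
  assumes P_dec: "\<And>i k. 1 \<le> i \<Longrightarrow> i < k \<Longrightarrow> k \<le> D \<Longrightarrow> P k < P i"
    and Q_dec: "\<And>i k. 1 \<le> i \<Longrightarrow> i < k \<Longrightarrow> k \<le> D \<Longrightarrow> Q k < Q i"
    and P_pair: "\<And>i. odd i \<Longrightarrow> i + 1 \<le> D \<Longrightarrow> P i = Suc (P (i + 1))"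
    and P_last: "odd D \<Longrightarrow> P D = 0"
    and Q_par: "\<And>i. 1 \<le> i \<Longrightarrow> i \<le> D \<Longrightarrow> even (Q i) = even i"
  obtains \<nu> where "frob_length (double_rows \<nu>) = D"
    "\<And>i. 1 \<le> i \<Longrightarrow> i \<le> D \<Longrightarrow> frob_P (double_rows \<nu>) i = P i"
    "\<And>i. 1 \<le> i \<Longrightarrow> i \<le> D \<Longrightarrow> frob_Q (double_rows \<nu>) i = Q i"
proof -
  have dec: "F k + k \<le> F i + i" if F: "\<And>i k. 1 \<le> i \<Longrightarrow> i < k \<Longrightarrow> k \<le> D \<Longrightarrow> F k < F i" and "1 \<le> i" "i \<le> k" "k \<le> D" for F :: "nat \<Rightarrow> nat" and i k
    using \<open>i \<le> k\<close> \<open>k \<le> D\<close>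
  proof (induction k rule: dec_induct)
    case (step n)
    then have "F (Suc n) < F n" using F[of n "Suc n"] \<open>1 \<le> i\<close> by simp
    then show ?case using step by simp
  qed simp
  have decP: "P k + k \<le> P i + i" if "1 \<le> i" "i \<le> k" "k \<le> D" for i k
    by (rule dec) (use P_dec that in blast)+
  have decQ: "Q k + k \<le> Q i + i" if "1 \<le> i" "i \<le> k" "k \<le> D" for i k
    by (rule dec) (use Q_dec that in blast)+
  \<comment> \<open>Column j should have length Q j + j, so for i > D row i consists of the columns
    in \<open>S i\<close>.\<close>
  define S where "S = (\<lambda>i. {j \<in> {1..D}. i \<le> Q j + j})"
  define r where "r = (\<lambda>i. if i \<le> D then P i + i else card (S i))"
  have S: "S i = {1..card (S i)}" for i
    by (rule down_closed_eq_atLeastAtMost) (use decQ in \<open>force simp: S_def\<close>)+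
  have in_S: "j \<in> S i \<longleftrightarrow> j \<le> card (S i)" if "1 \<le> j" for i j
  proof -
    have "j \<in> S i \<longleftrightarrow> j \<in> {1..card (S i)}" by (subst S) (rule refl)
    then show ?thesis using that by simp
  qed
  have card_S: "card (S i) \<le> D" for i
  proof -
    have "card (S i) \<le> card {1..D}" by (rule card_mono) (auto simp: S_def)
    then show ?thesis by simp
  qed
  have r_ge: "D \<le> r i" if "1 \<le> i" "i \<le> D" for i
    using decP[of i D] that by (auto simp: r_def)
  have r_mono: "r k \<le> r i" if "1 \<le> i" "i \<le> k" for i k
  proof -
    consider "k \<le> D" | "i \<le> D" "D < k" | "D < i" by linarith
    then show ?thesis
    proof cases
      case 1
      then show ?thesis using decP[of i k] that by (simp add: r_def)
    next
      case 2
      then show ?thesis using r_ge[of i] card_S[of k] that by (simp add: r_def)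
    next
      case 3
      have "S k \<subseteq> S i" "finite (S i)" using that by (auto simp: S_def)
      then show ?thesis using 3 that by (simp add: r_def card_mono)
    qed
  qed
  have r_pair: "r (2 * k - 1) = r (2 * k)" if k: "1 \<le> k" for k
  proof -
    consider "2 * k \<le> D" | "2 * k - 1 = D" | "D < 2 * k - 1" by linarith
    then show ?thesis
    proof cases
      case 1
      then show ?thesis using P_pair[of "2 * k - 1"] k by (simp add: r_def)
    next
      case 2
      then have odd: "odd D" using k by auto
      \<comment> \<open>Row D has length D because P D = 0. The odd number Q D is positive, so each
        of the first D columns reaches row D + 1 = 2k.\<close>
      have "S (2 * k) = {1..D}"
      proof -
        have "2 * k \<le> Q j + j" if "1 \<le> j" "j \<le> D" for j
        proof -
          have "odd (Q D)" using Q_par[of D] odd that by simp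
          then have "D + 1 \<le> Q D + D" by (auto intro: Suc_leI odd_pos)
          then show ?thesis using decQ[of j D] that 2 k by linarith
        qed
        then show ?thesis by (auto simp: S_def)
      qed
      then have "card (S (2 * k)) = D" by simp
      then show ?thesis using 2 k P_last[OF odd] by (auto simp: r_def)
    next
      case 3
      have "2 * k - 1 \<le> Q j + j \<longleftrightarrow> 2 * k \<le> Q j + j" if "1 \<le> j" "j \<le> D" for j
      proof -
        have "even (Q j + j)" using Q_par[OF that] by simp
        then show ?thesis using k by presburger
      qed
      then have "S (2 * k - 1) = S (2 * k)" by (auto simp: S_def)
      then show ?thesis using 3 by (simp add: r_def)
    qed
  qed
  obtain \<nu> where \<nu>: "\<And>k. 1 \<le> k \<Longrightarrow> row \<nu> k = r (2 * k)"
  proof (rule young_diagram_exists[of "\<lambda>k. r (2 * k)" "D + (\<Sum>j=1..D. Q j + j)"])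
    show "r (2 * k) \<le> r (2 * i)" if "1 \<le> i" "i \<le> k" for i k using that by (intro r_mono) auto
    show "r (2 * k) = 0" if "D + (\<Sum>j=1..D. Q j + j) < k" for k
    proof -
      have "Q j + j \<le> (\<Sum>j=1..D. Q j + j)" if "j \<in> {1..D}" for j
        using that by (intro member_le_sum) auto
      then have "S (2 * k) = {}" using that by (fastforce simp: S_def)
      then show ?thesis using that by (simp add: r_def)
    qed
  qed (rule that)
  let ?\<mu> = "double_rows \<nu>"
  have row: "row ?\<mu> i = r i" if "1 \<le> i" for i
  proof (cases "even i")
    case True
    then have "1 \<le> (i + 1) div 2" "2 * ((i + 1) div 2) = i" using that by auto
    then show ?thesis using \<nu> row_double_rows[OF that] by simp
  next
    case False
    define k where "k = (i + 1) div 2"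
    have "1 \<le> k" "2 * k - 1 = i" using False that by (auto simp: k_def)
    then show ?thesis using \<nu>[of k] row_double_rows[OF that] r_pair[of k] by (simp add: k_def)
  qed
  interpret frobenius "row ?\<mu>" "col ?\<mu>" "frob_length ?\<mu>" by (rule frobenius_frob_length)
  have "i \<le> frob_length ?\<mu> \<longleftrightarrow> i \<le> D" if "1 \<le> i" for i
  proof (cases "i \<le> D")
    case True
    then show ?thesis using D_iff[OF that] row[OF that] r_ge[OF that] by simp
  next
    case False
    then show ?thesis using D_iff[OF that] row[OF that] card_S[of i] by (simp add: r_def)
  qed
  from this[of D] this[of "frob_length ?\<mu>"] have D: "frob_length ?\<mu> = D"
    by (cases "D = 0"; cases "frob_length ?\<mu> = 0") auto
  have P: "frob_P ?\<mu> i = P i" if "1 \<le> i" "i \<le> D" for i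
    using row[OF that(1)] that by (simp add: frob_P_def r_def)
  have Q: "frob_Q ?\<mu> j = Q j" if j: "1 \<le> j" "j \<le> D" for j
  proof -
    have "i \<le> Q j + j \<longleftrightarrow> i \<le> col ?\<mu> j" if i: "1 \<le> i" for i
    proof (cases "i \<le> D")
      case True
      then have "i \<le> Q j + j" using decQ[of j D] j by simp
      moreover have "j \<le> row ?\<mu> i" using r_ge[OF i True] row[OF i] j by simp
      ultimately show ?thesis using le_col_iff[OF i j(1)] by simp
    next
      case False
      have "i \<le> Q j + j \<longleftrightarrow> j \<in> S i" using j by (simp add: S_def)
      also have "\<dots> \<longleftrightarrow> j \<le> row ?\<mu> i" using in_S[OF j(1)] row[OF i] False by (simp add: r_def)
      finally show ?thesis using le_col_iff[OF i j(1)] by simp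
    qed
    from this[of "Q j + j"] this[of "col ?\<mu> j"] have "col ?\<mu> j = Q j + j" using j by (cases "col ?\<mu> j = 0") auto
    then show ?thesis by (simp add: frob_Q_def)
  qed
  show ?thesis by (rule that[OF D P Q])
qed

lemma paired_points_nth:
  assumes "t < length ys"
  shows "paired_points ys ! (2 * t) = ys ! t - 1" "paired_points ys ! (2 * t + 1) = ys ! t"
proof -
  have "paired_points ys ! (2 * t) = ys ! t - 1 \<and> paired_points ys ! (2 * t + 1) = ys ! t"
    using assms
  proof (induction ys arbitrary: t)
    case (Cons y ys)
    then show ?case by (cases t) (auto simp: paired_points_def)
  qed simp
  then show "paired_points ys ! (2 * t) = ys ! t - 1" "paired_points ys ! (2 * t + 1) = ys ! t" by auto
qed

text \<open>The conditions under which the Pfaffian survives are those of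
  \<open>frobenius_coordinates_exist\<close>: equal lengths give as many P i as Q i, strict order
  makes the P i decrease, each point of \<open>ys\<close> brings two consecutive coordinates, and
  alternation fixes the parity of the Q i.\<close>

theorem pf_submatrix_nonzero_imp_config:
  assumes X: "finite X" "X \<subseteq> half_integers" and nz: "pf_submatrix (L_matrix h) X \<noteq> 0"
  shows "X \<in> range config"
proof -
  define ns where "ns = sorted_list_of_set {x \<in> X. x < 0}"
  define hs where "hs = (if 1 / 2 \<in> X then [1 / 2 :: real] else [])"
  define ys where "ys = sorted_list_of_set {x \<in> X. x > 1}"
  define vs where "vs = hs @ paired_points ys"
  define D where "D = length ns"
  have set_ns: "set ns = {x \<in> X. x < 0}" and set_ys: "set ys = {x \<in> X. x > 1}"
    using X(1) by (simp_all add: ns_def ys_def)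
  have set_hs: "set hs = X \<inter> {1 / 2}" by (cases "1 / 2 \<in> X") (simp_all add: hs_def)
  have pos: "x = 1 / 2 \<or> x > 1" if "x \<in> X" "\<not> x < 0" for x
  proof -
    have "x \<in> half_integers" using X(2) that(1) by blast
    then obtain n where n: "x = real_of_int n + 1 / 2" by (auto simp: half_integers_def)
    then have "n \<ge> 0" using that(2) by linarith
    then have "n = 0 \<or> n \<ge> 1" by linarith
    then show ?thesis using n by auto
  qed
  have set_X: "set (ns @ hs @ ys) = X"
  proof (intro equalityI subsetI)
    fix x assume "x \<in> X"
    then show "x \<in> set (ns @ hs @ ys)" using pos[of x] by (cases "x < 0") (auto simp: set_ns set_ys set_hs)
  qed (auto simp: set_ns set_ys set_hs)
  have srt: "sorted_wrt (<) ns" "sorted_wrt (<) ys" by (simp_all add: ns_def ys_def)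
  then have "sorted_wrt (<) (ns @ hs @ ys)"
    using set_ns set_ys by (auto simp: sorted_wrt_append hs_def)
  then have L: "sorted_list_of_set X = ns @ hs @ ys"
    using set_X X(1) strict_sorted_list_of_set[of X] by (metis set_sorted_list_of_set strict_sorted_equal)
  have "pf_submatrix (L_matrix h) X = (if alternating (\<lambda>x. \<not> even_point x) (ns @ hs) \<and> length ns = length vs \<and> sorted_wrt (<) vs
     then (\<Prod>x\<in>set ns. h x) * (\<Prod>v\<in>set vs. h v) *
        of_real (vandermonde (set ns) * vandermonde (set vs) / (\<Prod>x\<in>set ns. \<Prod>v\<in>set vs. v - x))
     else 0)"
    unfolding vs_def
    by (rule pf_submatrix_L_matrix_eq[OF X L]) (auto simp: set_ns set_ys hs_def)
  then have alt: "alternating (\<lambda>x. \<not> even_point x) (ns @ hs)" and len: "length vs = D" and svs: "sorted_wrt (<) vs"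
    using nz by (auto simp: D_def split: if_splits)
  define Q where "Q = (\<lambda>i. nat \<lfloor>- ns ! (i - 1) - 1 / 2\<rfloor>)"
  \<comment> \<open>The list \<open>vs\<close> increases while P must decrease, so it is read from
    the end.\<close>
  define P where "P = (\<lambda>i. nat \<lfloor>vs ! (D - i) - 1 / 2\<rfloor>)"
  have Q: "ns ! (i - 1) = - real (Q i) - 1 / 2" if "1 \<le> i" "i \<le> D" for i
  proof -
    have "ns ! (i - 1) \<in> set ns" using that by (simp add: D_def)
    then have "ns ! (i - 1) < 0" "ns ! (i - 1) \<in> half_integers" using set_ns X(2) by auto
    then obtain n where n: "ns ! (i - 1) = real_of_int n + 1 / 2" "n < 0" by (auto simp: half_integers_def)
    then have "- ns ! (i - 1) - 1 / 2 = real_of_int (- n - 1)" by simp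
    then have "Q i = nat (- n - 1)" by (simp only: Q_def floor_of_int)
    then show ?thesis using n by simp
  qed
  have vhalf: "\<exists>n::nat. v = real n + 1 / 2" if "v \<in> set vs" for v
  proof -
    have "v = 1 / 2 \<or> (\<exists>y. y \<in> X \<and> y > 1 \<and> (v = y - 1 \<or> v = y))"
      using that set_hs set_ys by (auto simp: vs_def set_paired_points)
    then have "\<exists>n. v = real_of_int n + 1 / 2 \<and> v > 0"
    proof
      assume "v = 1 / 2"
      then show ?thesis by (intro exI[of _ 0]) simp
    next
      assume "\<exists>y. y \<in> X \<and> y > 1 \<and> (v = y - 1 \<or> v = y)"
      then obtain y where y: "y \<in> X" "y > 1" "v = y - 1 \<or> v = y" by blast
      have "y \<in> half_integers" using X(2) y(1) by blast
      then obtain m where m: "y = real_of_int m + 1 / 2" by (auto simp: half_integers_def)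
      from y(3) show ?thesis
      proof
        assume "v = y - 1"
        then show ?thesis using m y(2) by (intro exI[of _ "m - 1"]) simp
      next
        assume "v = y"
        then show ?thesis using m y(2) by (intro exI[of _ m]) simp
      qed
    qed
    then obtain n where n: "v = real_of_int n + 1 / 2" "v > 0" by blast
    then have "n \<ge> 0" by linarith
    then show ?thesis using n(1) by (intro exI[of _ "nat n"]) simp
  qed
  have P: "vs ! (D - i) = real (P i) + 1 / 2" if "1 \<le> i" "i \<le> D" for i
  proof -
    have "vs ! (D - i) \<in> set vs" using that len by simp
    then obtain n :: nat where "vs ! (D - i) = real n + 1 / 2" using vhalf by blast
    then show ?thesis by (simp add: P_def)
  qed
  have par_hs: "even D \<longleftrightarrow> hs = []" using len by (auto simp: vs_def hs_def)
  have D_hs: "D = length hs + 2 * length ys" using len by (simp add: vs_def)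
  have pair: "vs ! (D - (i + 1)) = ys ! ((D - (i + 1)) div 2) - 1 \<and> vs ! (D - i) = ys ! ((D - (i + 1)) div 2)
      \<and> (D - (i + 1)) div 2 < length ys"
    if i: "odd i" "i + 1 \<le> D" for i
  proof -
    define t where "t = (D - (i + 1)) div 2"
    have hl: "length hs \<le> 1" by (simp add: hs_def)
    obtain m where m: "i = 2 * m + 1" using i(1) by (auto elim: oddE)
    have ml: "m + 1 \<le> length ys" using i(2) D_hs hl m by linarith
    have d: "D - (i + 1) = length hs + 2 * (length ys - (m + 1))" using D_hs m ml by simp
    have "t = length ys - (m + 1)"
      using hl unfolding t_def d by simp
    then have "D - (i + 1) = length hs + 2 * t" "t < length ys" "D - i = length hs + (2 * t + 1)"
      using d m ml D_hs by simp_all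
    then show ?thesis
      using paired_points_nth[of t ys] unfolding t_def[symmetric] vs_def by (simp only: nth_append_length_plus simp_thms)
  qed
  obtain \<nu> where \<nu>: "frob_length (double_rows \<nu>) = D"
    "\<And>i. 1 \<le> i \<Longrightarrow> i \<le> D \<Longrightarrow> frob_P (double_rows \<nu>) i = P i"
    "\<And>i. 1 \<le> i \<Longrightarrow> i \<le> D \<Longrightarrow> frob_Q (double_rows \<nu>) i = Q i"
  proof (rule frobenius_coordinates_exist[of D P Q])
    show "P k < P i" if "1 \<le> i" "i < k" "k \<le> D" for i k
    proof -
      have "vs ! (D - k) < vs ! (D - i)" using svs len that by (intro sorted_wrt_nth_less[of "(<)"]) auto
      then show ?thesis using P[of i] P[of k] that by simp
    qed
    show "Q k < Q i" if "1 \<le> i" "i < k" "k \<le> D" for i k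
    proof -
      have "ns ! (i - 1) < ns ! (k - 1)" using srt(1) that by (intro sorted_wrt_nth_less[of "(<)"]) (auto simp: D_def)
      then show ?thesis using Q[of i] Q[of k] that by simp
    qed
    show "P i = Suc (P (i + 1))" if "odd i" "i + 1 \<le> D" for i
    proof -
      have "1 \<le> i" using that(1) by (auto intro: Suc_leI odd_pos)
      then have "real (P i) = real (P (i + 1)) + 1"
        using pair[OF that] P[of i] P[of "i + 1"] that by simp
      then show ?thesis by linarith
    qed
    show "P D = 0" if "odd D"
    proof -
      have "vs ! 0 = 1 / 2" using par_hs that by (auto simp: vs_def hs_def split: if_splits)
      then show ?thesis by (simp add: P_def)
    qed
    show "even (Q i) = even i" if "1 \<le> i" "i \<le> D" for i
    proof -
      have "(\<not> even_point ((ns @ hs) ! (i - 1))) = even (i - 1)"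
        using that by (intro alternating_nth[OF alt]) (simp add: D_def)
      moreover have "i - 1 < length ns" using that unfolding D_def by linarith
      then have "(ns @ hs) ! (i - 1) = - real (Q i) - 1 / 2" using Q[OF that] by (simp only: nth_append if_True)
      ultimately have "odd (Q i) = even (i - 1)" by (simp only: even_point_neg)
      then show ?thesis using that by (cases i) auto
    qed
  qed (rule that)
  have "config_minus \<nu> = (\<lambda>i. ns ! (i - 1)) ` {1..D}"
    unfolding config_minus_image \<nu>(1) using \<nu>(3) Q by (intro image_cong refl) auto
  also have "\<dots> = set ns"
    unfolding D_def image_Suc_lessThan[symmetric] image_image by (auto simp: set_conv_nth)
  finally have m: "config_minus \<nu> = set ns" .
  have "(\<lambda>i. real (frob_P (double_rows \<nu>) i) + 1 / 2) ` {i. odd i \<and> i + 1 \<le> D} = set ys"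
  proof (intro equalityI subsetI)
    fix x assume "x \<in> (\<lambda>i. real (frob_P (double_rows \<nu>) i) + 1 / 2) ` {i. odd i \<and> i + 1 \<le> D}"
    then obtain i where i: "odd i" "i + 1 \<le> D" "x = real (frob_P (double_rows \<nu>) i) + 1 / 2" by auto
    have "1 \<le> i" using i(1) by (auto intro: Suc_leI odd_pos)
    then have "x = ys ! ((D - (i + 1)) div 2)" using i pair[OF i(1,2)] P[of i] \<nu>(2)[of i] by simp
    then show "x \<in> set ys" using pair[OF i(1,2)] by simp
  next
    fix x assume "x \<in> set ys"
    then obtain t where t: "t < length ys" "x = ys ! t" by (auto simp: in_set_conv_nth)
    define i where "i = 2 * (length ys - t) - 1"
    have i: "odd i" "i + 1 \<le> D" "1 \<le> i" using t D_hs by (auto simp: i_def)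
    have "(D - (i + 1)) div 2 = t"
    proof -
      have "i + 1 = 2 * (length ys - t)" using t by (simp add: i_def)
      moreover have "length hs \<le> 1" by (simp add: hs_def)
      ultimately show ?thesis using D_hs t by simp
    qed
    then have "x = real (frob_P (double_rows \<nu>) i) + 1 / 2"
      using pair[OF i(1,2)] P[of i] \<nu>(2)[of i] i t by simp
    then show "x \<in> (\<lambda>i. real (frob_P (double_rows \<nu>) i) + 1 / 2) ` {i. odd i \<and> i + 1 \<le> D}" using i by blast
  qed
  then have "config_plus \<nu> = set hs \<union> set ys"
    unfolding config_plus_image \<nu>(1) using par_hs by (auto simp: hs_def split: if_splits)
  then have "config \<nu> = X" unfolding config_def m set_X[symmetric] by simp
  then show ?thesis by blast
qed

section \<open>Level sums\<close>

text \<open>Row functions on a fixed number N of rows: adding a box is a function update, and the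
  weights become products over a fixed index set. All values outside the rows, including the one at
  0, are set to 0, so that equal partitions are equal functions.\<close>

definition partitions :: "nat \<Rightarrow> nat \<Rightarrow> (nat \<Rightarrow> nat) set" where
  "partitions N n = {f. (\<forall>i k. 1 \<le> i \<longrightarrow> i \<le> k \<longrightarrow> f k \<le> f i) \<and> (\<forall>i. i \<notin> {1..N} \<longrightarrow> f i = 0) \<and> (\<Sum>i=1..N. f i) = n}"

lemma finite_partitions: "finite (partitions N n)"
proof (rule finite_subset)
  show "partitions N n \<subseteq> {f. \<forall>i. (i \<in> {1..N} \<longrightarrow> f i \<in> {..n}) \<and> (i \<notin> {1..N} \<longrightarrow> f i = 0)}"
    by (auto simp: partitions_def intro: member_le_sum)
  show "finite {f. \<forall>i. (i \<in> {1..N} \<longrightarrow> f i \<in> {..n}) \<and> (i \<notin> {1..N} \<longrightarrow> f i = (0::nat))}"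
    by (rule finite_set_of_finite_funs) auto
qed

definition shifted_row :: "nat \<Rightarrow> (nat \<Rightarrow> nat) \<Rightarrow> nat \<Rightarrow> nat" where
  "shifted_row N f i = f i + 2 * (N - i)"

text \<open>The product (d - 1) d d (d + 1) of the four differences of shifted rows between two
  pairs of equal rows in the doubled diagram.\<close>

definition pair_weight :: "real \<Rightarrow> real" where
  "pair_weight d = d\<^sup>2 * (d\<^sup>2 - 1)"

lemma pair_weight_minus: "pair_weight (a - b) = pair_weight (b - a)"
  by (simp add: pair_weight_def power2_commute)

text \<open>The reciprocal of H H' at theta = 2 in terms of shifted rows, see
  \<open>hook_row_weight\<close>. The two factorials belong to the two copies of a row.\<close>

definition row_weight :: "nat \<Rightarrow> (nat \<Rightarrow> nat) \<Rightarrow> real" where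
  "row_weight N f = (\<Prod>(a, b)\<in>{(a, b). a \<in> {1..N} \<and> b \<in> {1..N} \<and> a < b}. pair_weight (real (shifted_row N f a) - real (shifted_row N f b)))
     / (\<Prod>i=1..N. fact (shifted_row N f i) * fact (shifted_row N f i + 1))"

definition content_weight :: "(int \<Rightarrow> complex) \<Rightarrow> nat \<Rightarrow> (nat \<Rightarrow> nat) \<Rightarrow> complex" where
  "content_weight g N f = (\<Prod>i=1..N. \<Prod>j=1..f i. g (int j - 1 - 2 * (int i - 1)))"

lemma sum_shifted_row: "(\<Sum>i=1..N. real (shifted_row N f i)) = real (\<Sum>i=1..N. f i) + real N * (real N - 1)"
proof -
  have "(\<Sum>i=1..N. real (2 * (N - i))) = real N * (real N - 1)"
  proof (induction N)
    case (Suc N)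
    have "(\<Sum>i=1..Suc N. real (2 * (Suc N - i))) = (\<Sum>i=1..N. real (2 * (N - i)) + 2)"
      by (auto simp: Suc_diff_le intro!: sum.cong)
    also have "\<dots> = real N * (real N - 1) + 2 * real N" unfolding sum.distrib Suc by simp
    finally show ?case by (simp add: algebra_simps)
  qed simp
  then show ?thesis by (simp add: shifted_row_def sum.distrib)
qed

lemma shifted_row_less:
  assumes "f \<in> partitions N n" "1 \<le> i" "i < k" "k \<le> N"
  shows "shifted_row N f k < shifted_row N f i"
proof -
  have "f k \<le> f i" using assms by (auto simp: partitions_def)
  then show ?thesis using assms by (simp add: shifted_row_def)
qed

lemma inj_shifted_row:
  assumes "f \<in> partitions N n"
  shows "inj_on (\<lambda>i. real (shifted_row N f i)) {1..N}"
proof (rule inj_onI)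
  fix i k assume "i \<in> {1..N}" "k \<in> {1..N}" "real (shifted_row N f i) = real (shifted_row N f k)"
  then show "i = k" using shifted_row_less[OF assms, of i k] shifted_row_less[OF assms, of k i]
    by (cases i k rule: linorder_cases) auto
qed

text \<open>
  On a partition of $n$ these are $n$ times the probability of removing a box from row $i$ and the
  probability of adding one there, for the Plancherel growth with $\theta = 2$. Both vanish if the
  changed row lengths are no longer decreasing.
\<close>

definition down_coeff :: "nat \<Rightarrow> (nat \<Rightarrow> nat) \<Rightarrow> nat \<Rightarrow> real" where
  "down_coeff N f i = real (shifted_row N f i) * (\<Prod>k\<in>{1..N} - {i}.
     (real (shifted_row N f i) - real (shifted_row N f k) - 2) / (real (shifted_row N f i) - real (shifted_row N f k)))"

definition up_coeff :: "nat \<Rightarrow> (nat \<Rightarrow> nat) \<Rightarrow> nat \<Rightarrow> real" where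
  "up_coeff N f i = 2 / (real (shifted_row N f i) + 2) * (\<Prod>k\<in>{1..N} - {i}.
     (real (shifted_row N f i) - real (shifted_row N f k) + 2) / (real (shifted_row N f i) - real (shifted_row N f k)))"

lemma divided_difference_image:
  assumes "inj_on L I"
  shows "divided_difference (L ` I) F = (\<Sum>i\<in>I. F (L i) / (\<Prod>k\<in>I - {i}. L i - L k))"
  unfolding divided_difference_def sum.reindex[OF assms] comp_def
proof (intro sum.cong refl arg_cong2[where f = "(/)"])
  fix i assume i: "i \<in> I"
  then have "L ` I - {L i} = L ` (I - {i})" using assms by (auto dest: inj_onD)
  then show "(\<Prod>y\<in>L ` I - {L i}. L i - y) = (\<Prod>k\<in>I - {i}. L i - L k)"
    using assms by (simp add: prod.reindex inj_on_diff)
qed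

text \<open>Consider u times the product of all u - (L j + 2) at the N nodes L i. At L i the factor
  j = i is -2, so the term of this node is -2 times \<open>down_coeff\<close>. The degree N + 1 is
  the case of \<open>divided_difference_prod_h2\<close>, with differences of power sums -2N and -4
  (sum of the L i) - 4N.\<close>

lemma sum_down_coeff:
  assumes f: "f \<in> partitions N n" and N: "1 \<le> N"
  shows "(\<Sum>i=1..N. down_coeff N f i) = real n"
proof -
  define L where "L = (\<lambda>i. real (shifted_row N f i))"
  have inj: "inj_on L {1..N}" unfolding L_def by (rule inj_shifted_row[OF f])
  have SL: "(\<Sum>i=1..N. L i) = real n + real N * (real N - 1)"
    using f unfolding L_def sum_shifted_row by (simp add: partitions_def)
  let ?F = "\<lambda>u. u ^ 1 * (\<Prod>j\<in>{1..N}. u - (L j + 2))"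
  have "2 * divided_difference (L ` {1..N}) ?F
    = ((\<Sum>x\<in>L ` {1..N}. x) - (\<Sum>j\<in>{1..N}. L j + 2))\<^sup>2 + ((\<Sum>x\<in>L ` {1..N}. x\<^sup>2) - (\<Sum>j\<in>{1..N}. (L j + 2)\<^sup>2))"
    using inj N by (intro divided_difference_prod_h2) (auto simp: card_image)
  also have "\<dots> = (2 * real N)\<^sup>2 - 4 * (\<Sum>i=1..N. L i) - 4 * real N"
    using inj by (simp add: sum.reindex power2_sum sum.distrib sum_distrib_left[symmetric] sum_distrib_right[symmetric])
  also have "\<dots> = - 4 * real n" unfolding SL by (simp add: power2_eq_square algebra_simps)
  finally have DD: "divided_difference (L ` {1..N}) ?F = - 2 * real n" by simp
  have "?F (L i) / (\<Prod>k\<in>{1..N} - {i}. L i - L k) = - 2 * down_coeff N f i" if "i \<in> {1..N}" for i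
  proof -
    have "(\<Prod>j\<in>{1..N}. L i - (L j + 2)) = (L i - (L i + 2)) * (\<Prod>j\<in>{1..N} - {i}. L i - (L j + 2))"
      using that by (intro prod.remove) auto
    then show ?thesis by (simp add: down_coeff_def L_def prod_dividef diff_diff_eq)
  qed
  then have "divided_difference (L ` {1..N}) ?F = (\<Sum>i=1..N. - 2 * down_coeff N f i)"
    unfolding divided_difference_image[OF inj] by (intro sum.cong refl)
  then show ?thesis using DD by (simp add: sum_distrib_left[symmetric] sum_negf)
qed

text \<open>The extra node -2 produces the denominator L i + 2 of \<open>up_coeff\<close>. Its own
  term vanishes: the empty last row has L N = 0, and the factor u - (L N - 2) is zero at -2.\<close>

lemma sum_up_coeff_power:
  fixes L :: "nat \<Rightarrow> real"
  assumes f: "f \<in> partitions N n" and N: "1 \<le> N" "f N = 0" and L: "L = (\<lambda>i. real (shifted_row N f i))"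
  shows "(\<Sum>i=1..N. L i ^ k * up_coeff N f i) = divided_difference (insert (- 2) (L ` {1..N})) (\<lambda>u. u ^ k * (\<Prod>j\<in>{1..N}. u - (L j - 2)))"
proof -
  have inj: "inj_on L {1..N}" unfolding L by (rule inj_shifted_row[OF f])
  have L0: "L i \<ge> 0" for i by (simp add: L)
  have LN: "L N = 0" using N by (simp add: L shifted_row_def)
  define L' where "L' = (\<lambda>i. if i = 0 then - 2 else L i)"
  have inj': "inj_on L' {0..N}"
  proof (rule inj_onI)
    fix i k assume "i \<in> {0..N}" "k \<in> {0..N}" "L' i = L' k"
    then show "i = k" using inj_onD[OF inj, of i k] L0[of i] L0[of k] by (auto simp: L'_def split: if_splits)
  qed
  have s: "{0..N} = insert 0 {1..N}" by auto
  have img: "insert (- 2) (L ` {1..N}) = L' ` {0..N}"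
    unfolding s image_insert by (intro arg_cong2[where f = insert] image_cong) (auto simp: L'_def)
  let ?F = "\<lambda>u. u ^ k * (\<Prod>j\<in>{1..N}. u - (L j - 2))"
  have "divided_difference (L' ` {0..N}) ?F = ?F (- 2) / (\<Prod>k\<in>{0..N} - {0}. L' 0 - L' k)
      + (\<Sum>i=1..N. ?F (L i) / (\<Prod>k\<in>{0..N} - {i}. L' i - L' k))"
    unfolding divided_difference_image[OF inj'] by (subst (1) s) (simp add: L'_def)
  also have "?F (- 2) = 0" using LN N(1) by auto
  also have "(\<Sum>i=1..N. ?F (L i) / (\<Prod>k\<in>{0..N} - {i}. L' i - L' k)) = (\<Sum>i=1..N. L i ^ k * up_coeff N f i)"
  proof (intro sum.cong refl)
    fix i assume i: "i \<in> {1..N}"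
    have "{0..N} - {i} = insert 0 ({1..N} - {i})" using i by auto
    then have d: "(\<Prod>k\<in>{0..N} - {i}. L' i - L' k) = (L i + 2) * (\<Prod>k\<in>{1..N} - {i}. L i - L k)"
      using i by (simp add: L'_def)
    have "(\<Prod>j\<in>{1..N}. L i - (L j - 2)) = (L i - (L i - 2)) * (\<Prod>j\<in>{1..N} - {i}. L i - (L j - 2))"
      using i by (intro prod.remove) auto
    also have "(\<Prod>j\<in>{1..N} - {i}. L i - (L j - 2)) = (\<Prod>j\<in>{1..N} - {i}. L i - L j + 2)"
      by (intro prod.cong) auto
    finally show "?F (L i) / (\<Prod>k\<in>{0..N} - {i}. L' i - L' k) = L i ^ k * up_coeff N f i"
      unfolding d by (simp add: up_coeff_def L prod_dividef)
  qed
  finally show ?thesis unfolding img by simp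
qed

text \<open>On N + 1 nodes the polynomial of \<open>sum_up_coeff_power\<close> has degree N + k, so
  k = 0, 1, 2 lead to complete homogeneous polynomials of degree 0, 1, 2. \<open>x i\<close> is the
  content of the box to be added in row i and equals L i - 2 (N - 1).\<close>

lemma sum_up_coeff:
  assumes f: "f \<in> partitions N n" and N: "1 \<le> N" "f N = 0"
  defines "x \<equiv> \<lambda>i. real (f i) - 2 * (real i - 1)"
  shows "(\<Sum>i=1..N. up_coeff N f i) = 1" "(\<Sum>i=1..N. x i * up_coeff N f i) = 0"
    "(\<Sum>i=1..N. (x i)\<^sup>2 * up_coeff N f i) = 2 * real n"
proof -
  define L where "L = (\<lambda>i. real (shifted_row N f i))"
  define X where "X = insert (- 2) (L ` {1..N})"
  have inj: "inj_on L {1..N}" unfolding L_def by (rule inj_shifted_row[OF f])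
  have L0: "L i \<ge> 0" for i by (simp add: L_def)
  have notin: "- 2 \<notin> L ` {1..N}" using L0 by (metis imageE neg_0_le_iff_le not_numeral_le_zero)
  have SL: "(\<Sum>i=1..N. L i) = real n + real N * (real N - 1)"
    using f unfolding L_def sum_shifted_row by (simp add: partitions_def)
  have cX: "card X = N + 1" "finite X" "X \<noteq> {}" using inj notin by (auto simp: X_def card_image)
  have sX: "(\<Sum>x\<in>X. x) = - 2 + (\<Sum>i=1..N. L i)" "(\<Sum>x\<in>X. x\<^sup>2) = 4 + (\<Sum>i=1..N. (L i)\<^sup>2)"
    using inj notin by (simp_all add: X_def sum.reindex)
  note P = sum_up_coeff_power[OF f N L_def, folded X_def]
  have m0: "(\<Sum>i=1..N. up_coeff N f i) = 1"
    using P[of 0] divided_difference_prod_eq[of "{1..N}" X 0 "\<lambda>j. L j - 2"] cX by simp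
  have m1: "(\<Sum>i=1..N. L i * up_coeff N f i) = 2 * real N - 2"
    using P[of 1] divided_difference_prod_h1[of "{1..N}" X 1 "\<lambda>j. L j - 2"] cX sX(1) by (simp add: sum_subtractf)
  have "2 * (\<Sum>i=1..N. (L i)\<^sup>2 * up_coeff N f i) = ((\<Sum>x\<in>X. x) - (\<Sum>j\<in>{1..N}. L j - 2))\<^sup>2 + ((\<Sum>x\<in>X. x\<^sup>2) - (\<Sum>j\<in>{1..N}. (L j - 2)\<^sup>2))"
    unfolding P[of 2] using cX by (intro divided_difference_prod_h2) auto
  also have "(\<Sum>j\<in>{1..N}. (L j - 2)\<^sup>2) = (\<Sum>i=1..N. (L i)\<^sup>2) - 4 * (\<Sum>i=1..N. L i) + 4 * real N"
    by (simp add: power2_diff sum.distrib sum_subtractf sum_distrib_left[symmetric] sum_distrib_right[symmetric])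
  also have "((\<Sum>x\<in>X. x) - (\<Sum>j\<in>{1..N}. L j - 2))\<^sup>2 + ((\<Sum>x\<in>X. x\<^sup>2) - ((\<Sum>i=1..N. (L i)\<^sup>2) - 4 * (\<Sum>i=1..N. L i) + 4 * real N))
    = (2 * real N - 2)\<^sup>2 + 4 + 4 * (real n + real N * (real N - 1)) - 4 * real N"
  proof -
    have "(\<Sum>x\<in>X. x) - (\<Sum>j\<in>{1..N}. L j - 2) = 2 * real N - 2"
      unfolding sX by (simp add: sum_subtractf)
    then show ?thesis unfolding sX(2) SL by simp
  qed
  finally have m2: "(\<Sum>i=1..N. (L i)\<^sup>2 * up_coeff N f i) = 4 * (real N - 1)\<^sup>2 + 2 * real n"
    by (simp add: power2_eq_square algebra_simps)
  have xL: "x i = L i - 2 * (real N - 1)" if "i \<in> {1..N}" for i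
    using that by (simp add: x_def L_def shifted_row_def of_nat_diff)
  show "(\<Sum>i=1..N. up_coeff N f i) = 1" by (rule m0)
  have "(\<Sum>i=1..N. x i * up_coeff N f i) = (\<Sum>i=1..N. L i * up_coeff N f i - 2 * (real N - 1) * up_coeff N f i)"
  proof (intro sum.cong refl)
    fix i assume "i \<in> {1..N}"
    then show "x i * up_coeff N f i = L i * up_coeff N f i - 2 * (real N - 1) * up_coeff N f i"
      by (simp only: xL) (simp add: algebra_simps)
  qed
  then show "(\<Sum>i=1..N. x i * up_coeff N f i) = 0"
    by (simp only: sum_subtractf sum_distrib_left[symmetric] m0 m1) simp
  have "(\<Sum>i=1..N. (x i)\<^sup>2 * up_coeff N f i) = (\<Sum>i=1..N. (L i)\<^sup>2 * up_coeff N f i - 4 * (real N - 1) * (L i * up_coeff N f i) + 4 * (real N - 1)\<^sup>2 * up_coeff N f i)"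
  proof (intro sum.cong refl)
    fix i assume "i \<in> {1..N}"
    then show "(x i)\<^sup>2 * up_coeff N f i = (L i)\<^sup>2 * up_coeff N f i - 4 * (real N - 1) * (L i * up_coeff N f i) + 4 * (real N - 1)\<^sup>2 * up_coeff N f i"
      by (simp only: xL) (simp add: power2_eq_square algebra_simps)
  qed
  then show "(\<Sum>i=1..N. (x i)\<^sup>2 * up_coeff N f i) = 2 * real n"
    by (simp only: sum_subtractf sum.distrib sum_distrib_left[symmetric] m0 m1 m2) (simp add: power2_eq_square algebra_simps)
qed

lemma row_weight_remove:
  assumes "i \<in> {1..N}"
  shows "row_weight N f = (\<Prod>(a, b)\<in>{(a, b). a \<in> {1..N} - {i} \<and> b \<in> {1..N} - {i} \<and> a < b}.
        pair_weight (real (shifted_row N f a) - real (shifted_row N f b)))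
      * (\<Prod>k\<in>{1..N} - {i}. pair_weight (real (shifted_row N f i) - real (shifted_row N f k)))
     / (fact (shifted_row N f i) * fact (shifted_row N f i + 1)
      * (\<Prod>k\<in>{1..N} - {i}. fact (shifted_row N f k) * fact (shifted_row N f k + 1)))"
proof -
  have "(\<Prod>i=1..N. fact (shifted_row N f i) * fact (shifted_row N f i + 1) :: real)
    = fact (shifted_row N f i) * fact (shifted_row N f i + 1) * (\<Prod>k\<in>{1..N} - {i}. fact (shifted_row N f k) * fact (shifted_row N f k + 1))"
    using assms by (intro prod.remove) auto
  moreover have "(\<Prod>(a, b)\<in>{(a, b). a \<in> {1..N} \<and> b \<in> {1..N} \<and> a < b}. pair_weight (real (shifted_row N f a) - real (shifted_row N f b)))
    = (\<Prod>(a, b)\<in>{(a, b). a \<in> {1..N} - {i} \<and> b \<in> {1..N} - {i} \<and> a < b}.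
        pair_weight (real (shifted_row N f a) - real (shifted_row N f b)))
      * (\<Prod>k\<in>{1..N} - {i}. pair_weight (real (shifted_row N f i) - real (shifted_row N f k)))"
    by (rule prod_pairs_remove) (use assms in \<open>auto intro: pair_weight_minus\<close>)
  ultimately show ?thesis unfolding row_weight_def by (simp only:)
qed

text \<open>Reversibility of the two walks. Only factors involving row i change: for a difference d
  of shifted rows both sides carry (d - 1) d (d + 1) (d + 2), and the factorials contribute (m +
  1)(m + 2), where m is the shifted row i.\<close>

lemma row_weight_add_box:
  assumes f: "f \<in> partitions N n" and f': "f(i := f i + 1) \<in> partitions N (n + 1)" and i: "i \<in> {1..N}"
  shows "2 * down_coeff N (f(i := f i + 1)) i * row_weight N (f(i := f i + 1)) = up_coeff N f i * row_weight N f"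
proof -
  let ?f' = "f(i := f i + 1)"
  define L where "L = (\<lambda>k. real (shifted_row N f k))"
  define L' where "L' = (\<lambda>k. real (shifted_row N ?f' k))"
  let ?J = "{1..N} - {i}"
  have Li: "L' i = L i + 1" and Lk: "\<And>k. k \<noteq> i \<Longrightarrow> L' k = L k" by (auto simp: L_def L'_def shifted_row_def)
  have inj: "inj_on L {1..N}" "inj_on L' {1..N}"
    unfolding L_def L'_def by (rule inj_shifted_row[OF f], rule inj_shifted_row[OF f'])
  define R where "R = (\<Prod>(a, b)\<in>{(a, b). a \<in> ?J \<and> b \<in> ?J \<and> a < b}. pair_weight (L a - L b))"
  define E where "E = (\<Prod>k\<in>?J. fact (shifted_row N f k) * fact (shifted_row N f k + 1) :: real)"
  define m where "m = shifted_row N f i"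
  have m': "shifted_row N ?f' i = m + 1" by (simp add: m_def shifted_row_def)
  have Lm: "L i = real m" by (simp add: L_def m_def)
  have W: "row_weight N f = R * (\<Prod>k\<in>?J. pair_weight (L i - L k)) / (fact m * fact (m + 1) * E)"
    unfolding R_def E_def m_def L_def by (rule row_weight_remove[OF i])
  have R': "(\<Prod>(a, b)\<in>{(a, b). a \<in> ?J \<and> b \<in> ?J \<and> a < b}. pair_weight (L' a - L' b)) = R"
    unfolding R_def by (intro prod.cong refl) (auto simp: Lk)
  have E': "(\<Prod>k\<in>?J. fact (shifted_row N ?f' k) * fact (shifted_row N ?f' k + 1) :: real) = E"
    unfolding E_def by (intro prod.cong refl) (auto simp: shifted_row_def)
  have "row_weight N ?f' = (\<Prod>(a, b)\<in>{(a, b). a \<in> ?J \<and> b \<in> ?J \<and> a < b}. pair_weight (L' a - L' b)) * (\<Prod>k\<in>?J. pair_weight (L' i - L' k))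
     / (fact (m + 1) * fact (m + 2) * (\<Prod>k\<in>?J. fact (shifted_row N ?f' k) * fact (shifted_row N ?f' k + 1)))"
    unfolding L'_def using row_weight_remove[OF i, of ?f'] unfolding m' by (simp only: add.assoc one_add_one)
  then have W': "row_weight N ?f' = R * (\<Prod>k\<in>?J. pair_weight (L i + 1 - L k)) / (fact (m + 1) * fact (m + 2) * E)"
  proof -
    have "(\<Prod>k\<in>?J. pair_weight (L' i - L' k)) = (\<Prod>k\<in>?J. pair_weight (L i + 1 - L k))"
      unfolding Li by (intro prod.cong refl) (auto simp: Lk)
    then show ?thesis using \<open>row_weight N ?f' = _\<close> unfolding R' E' by (simp only:)
  qed
  have D: "down_coeff N ?f' i = (L i + 1) * (\<Prod>k\<in>?J. (L i + 1 - L k - 2) / (L i + 1 - L k))"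
  proof -
    have "down_coeff N ?f' i = L' i * (\<Prod>k\<in>?J. (L' i - L' k - 2) / (L' i - L' k))"
      unfolding down_coeff_def L'_def by (rule refl)
    also have "(\<Prod>k\<in>?J. (L' i - L' k - 2) / (L' i - L' k)) = (\<Prod>k\<in>?J. (L i + 1 - L k - 2) / (L i + 1 - L k))"
      unfolding Li by (intro prod.cong refl) (auto simp: Lk)
    finally show ?thesis unfolding Li .
  qed
  have U: "up_coeff N f i = 2 / (L i + 2) * (\<Prod>k\<in>?J. (L i - L k + 2) / (L i - L k))"
    by (simp add: up_coeff_def L_def)
  have key: "(\<Prod>k\<in>?J. (L i + 1 - L k - 2) / (L i + 1 - L k)) * (\<Prod>k\<in>?J. pair_weight (L i + 1 - L k))
     = (\<Prod>k\<in>?J. (L i - L k + 2) / (L i - L k)) * (\<Prod>k\<in>?J. pair_weight (L i - L k))"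
    unfolding prod.distrib[symmetric]
  proof (intro prod.cong refl)
    fix k assume k: "k \<in> ?J"
    define d where "d = L i - L k"
    have "d \<noteq> 0" using inj_onD[OF inj(1), of i k] k i by (auto simp: d_def)
    moreover have "d + 1 \<noteq> 0" using inj_onD[OF inj(2), of i k] k i Li Lk[of k] by (auto simp: d_def)
    ultimately have "(d - 1) / (d + 1) * pair_weight (d + 1) = (d + 2) / d * pair_weight d"
      by (simp add: pair_weight_def field_simps power2_eq_square)
    moreover have "L i + 1 - L k - 2 = d - 1" "L i + 1 - L k = d + 1" by (simp_all add: d_def)
    ultimately show "(L i + 1 - L k - 2) / (L i + 1 - L k) * pair_weight (L i + 1 - L k) = (L i - L k + 2) / (L i - L k) * pair_weight (L i - L k)"
      by (simp only: d_def[symmetric])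
  qed
  have "2 * down_coeff N ?f' i * row_weight N ?f'
     = 2 * (L i + 1) * R * ((\<Prod>k\<in>?J. (L i + 1 - L k - 2) / (L i + 1 - L k)) * (\<Prod>k\<in>?J. pair_weight (L i + 1 - L k))) / (fact (m + 1) * fact (m + 2) * E)"
    unfolding D W' by simp
  also have "fact (m + 1) * fact (m + 2) = (real m + 1) * (real m + 2) * (fact m * fact (m + 1))"
    by (simp add: algebra_simps)
  finally have *: "2 * down_coeff N ?f' i * row_weight N ?f' = 2 * (L i + 1) * R * ((\<Prod>k\<in>?J. (L i - L k + 2) / (L i - L k)) * (\<Prod>k\<in>?J. pair_weight (L i - L k)))
     / ((real m + 1) * (real m + 2) * (fact m * fact (m + 1)) * E)" unfolding key .
  have cancel: "2 * (x + 1) * R * (u * v) / ((x + 1) * (x + 2) * K * E) = 2 / (x + 2) * u * (R * v / (K * E))"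
    if "x \<ge> 0" for x u v K :: real
  proof -
    have "2 * (x + 1) * R * (u * v) / ((x + 1) * (x + 2) * K * E) = (x + 1) * (2 * R * (u * v)) / ((x + 1) * ((x + 2) * K * E))"
      by (simp only: mult_ac)
    also have "\<dots> = 2 * R * (u * v) / ((x + 2) * K * E)"
      using that by (subst mult_divide_mult_cancel_left) auto
    finally show ?thesis by (simp add: mult_ac)
  qed
  show ?thesis unfolding * W U Lm by (rule cancel) simp
qed

text \<open>Shifted rows are at least 2 apart, while \<open>pair_weight\<close> vanishes only at -1,
  0 and 1.\<close>

lemma row_weight_nonzero:
  assumes f: "f \<in> partitions N n"
  shows "row_weight N f \<noteq> 0"
proof -
  have "pair_weight (real (shifted_row N f a) - real (shifted_row N f b)) \<noteq> 0" if "a \<in> {1..N}" "b \<in> {1..N}" "a < b" for a b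
  proof -
    define d where "d = real (shifted_row N f a) - real (shifted_row N f b)"
    have "f b \<le> f a" using f that by (auto simp: partitions_def)
    then have "shifted_row N f b + 2 \<le> shifted_row N f a" using that by (auto simp: shifted_row_def)
    then have "2 \<le> d" by (simp add: d_def)
    then have "d\<^sup>2 \<noteq> 0" "1 < d\<^sup>2" by (auto intro: one_less_power)
    then show ?thesis unfolding d_def[symmetric] pair_weight_def by simp
  qed
  moreover have "finite {(a, b). a \<in> {1..N} \<and> b \<in> {1..N} \<and> a < b}"
    by (rule finite_subset[of _ "{1..N} \<times> {1..N}"]) auto
  ultimately show ?thesis unfolding row_weight_def by (auto simp: prod_zero_iff)
qed

lemma content_weight_add_box:
  assumes "i \<in> {1..N}"
  shows "content_weight g N (f(i := f i + 1)) = g (int (f i) - 2 * (int i - 1)) * content_weight g N f"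
proof -
  have "content_weight g N (f(i := f i + 1)) = (\<Prod>j=1..f i + 1. g (int j - 1 - 2 * (int i - 1))) * (\<Prod>k\<in>{1..N} - {i}. \<Prod>j=1..f k. g (int j - 1 - 2 * (int k - 1)))"
  proof -
    let ?f' = "f(i := f i + 1)"
    have "content_weight g N ?f' = (\<Prod>j=1..?f' i. g (int j - 1 - 2 * (int i - 1))) * (\<Prod>k\<in>{1..N} - {i}. \<Prod>j=1..?f' k. g (int j - 1 - 2 * (int k - 1)))"
      unfolding content_weight_def using assms by (intro prod.remove) auto
    moreover have "(\<Prod>k\<in>{1..N} - {i}. \<Prod>j=1..?f' k. g (int j - 1 - 2 * (int k - 1))) = (\<Prod>k\<in>{1..N} - {i}. \<Prod>j=1..f k. g (int j - 1 - 2 * (int k - 1)))"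
      by (intro prod.cong refl) auto
    ultimately show ?thesis by simp
  qed
  moreover have "content_weight g N f = (\<Prod>j=1..f i. g (int j - 1 - 2 * (int i - 1))) * (\<Prod>k\<in>{1..N} - {i}. \<Prod>j=1..f k. g (int j - 1 - 2 * (int k - 1)))"
    unfolding content_weight_def using assms by (intro prod.remove) auto
  moreover have "(\<Prod>j=1..f i + 1. g (int j - 1 - 2 * (int i - 1))) = g (int (f i) - 2 * (int i - 1)) * (\<Prod>j=1..f i. g (int j - 1 - 2 * (int i - 1)))"
  proof -
    have "{1..f i + 1} = insert (f i + 1) {1..f i}" by auto
    then have "(\<Prod>j=1..f i + 1. g (int j - 1 - 2 * (int i - 1)))
        = g (int (f i + 1) - 1 - 2 * (int i - 1)) * (\<Prod>j=1..f i. g (int j - 1 - 2 * (int i - 1)))"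
      by (simp only:) (subst prod.insert, auto)
    moreover have "int (f i + 1) - 1 - 2 * (int i - 1) = int (f i) - 2 * (int i - 1)" by simp
    ultimately show ?thesis by (simp only:)
  qed
  ultimately show ?thesis by (simp only: mult.assoc)
qed

lemma partitionsI:
  assumes "\<And>i k. 1 \<le> i \<Longrightarrow> i \<le> k \<Longrightarrow> f k \<le> f i" "\<And>i. i \<notin> {1..N} \<Longrightarrow> f i = 0" "(\<Sum>i=1..N. f i) = n"
  shows "f \<in> partitions N n"
  using assms by (simp add: partitions_def)

lemma partitionsD:
  assumes "f \<in> partitions N n"
  shows "1 \<le> i \<Longrightarrow> i \<le> k \<Longrightarrow> f k \<le> f i" "i \<notin> {1..N} \<Longrightarrow> f i = 0" "(\<Sum>i=1..N. f i) = n"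
  using assms unfolding partitions_def by blast+

lemma sum_fun_upd:
  fixes f :: "nat \<Rightarrow> nat" and i N :: nat
  assumes "i \<in> {1..N}"
  shows "(\<Sum>k=1..N. (f(i := v)) k) + f i = (\<Sum>k=1..N. f k) + (v :: nat)"
proof -
  have "(\<Sum>k=1..N. (f(i := v)) k) = v + (\<Sum>k\<in>{1..N} - {i}. (f(i := v)) k)"
    using assms by (subst sum.remove[of _ i]) auto
  also have "(\<Sum>k\<in>{1..N} - {i}. (f(i := v)) k) = (\<Sum>k\<in>{1..N} - {i}. f k)"
    by (intro sum.cong) auto
  moreover have "(\<Sum>k=1..N. f k) = f i + (\<Sum>k\<in>{1..N} - {i}. f k)"
    using assms by (intro sum.remove) auto
  ultimately show ?thesis by simp
qed

text \<open>If rows i and i + 1 are equal, their shifted difference is 2 and a numerator vanishes;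
  for i = N the prefactor is the row length itself. A nonzero coefficient thus guarantees a
  removable box.\<close>

lemma lower_row_partition:
  assumes f: "f \<in> partitions N (n + 1)" and i: "i \<in> {1..N}" and nz: "down_coeff N f i \<noteq> 0"
  shows "f i > 0 \<and> f(i := f i - 1) \<in> partitions N n"
proof -
  have less: "f b < f i" if "i < b" for b
  proof (cases "i = N")
    case True
    then have "f i \<noteq> 0" using nz by (auto simp: down_coeff_def shifted_row_def)
    then show ?thesis using partitionsD(2)[OF f, of b] that True by simp
  next
    case False
    then have iN: "i + 1 \<in> {1..N} - {i}" using i by auto
    have "real (shifted_row N f i) - real (shifted_row N f (i + 1)) - 2 \<noteq> 0"
      using nz iN unfolding down_coeff_def by (auto simp: prod_zero_iff)
    then have "f i \<noteq> f (i + 1)" using iN by (auto simp: shifted_row_def of_nat_diff)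
    then have "f (i + 1) < f i" using partitionsD(1)[OF f, of i "i + 1"] i by simp
    moreover have "f b \<le> f (i + 1)" using that by (intro partitionsD(1)[OF f]) auto
    ultimately show ?thesis by simp
  qed
  have pos: "f i > 0" using less[of "Suc i"] by simp
  moreover have "f(i := f i - 1) \<in> partitions N n"
  proof (rule partitionsI)
    show "(f(i := f i - 1)) k \<le> (f(i := f i - 1)) a" if "1 \<le> a" "a \<le> k" for a k
      using less[of k] partitionsD(1)[OF f that] that by auto
    show "(f(i := f i - 1)) k = 0" if "k \<notin> {1..N}" for k using that i partitionsD(2)[OF f that] by auto
    show "(\<Sum>k=1..N. (f(i := f i - 1)) k) = n"
      using sum_fun_upd[OF i, of f "f i - 1"] partitionsD(3)[OF f] pos by simp
  qed
  ultimately show ?thesis by simp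
qed

text \<open>Equal rows i - 1 and i have the shifted difference -2 seen from row i, which makes a
  numerator zero.\<close>

lemma raise_row_partition:
  assumes f: "f \<in> partitions N n" and i: "i \<in> {1..N}" and nz: "up_coeff N f i \<noteq> 0"
  shows "f(i := f i + 1) \<in> partitions N (n + 1)"
proof (rule partitionsI)
  have less: "f i < f a" if "1 \<le> a" "a < i" for a
  proof -
    have iN: "i - 1 \<in> {1..N} - {i}" using i that by auto
    have "real (shifted_row N f i) - real (shifted_row N f (i - 1)) + 2 \<noteq> 0"
      using nz iN unfolding up_coeff_def by (auto simp: prod_zero_iff)
    moreover have "2 * (N - (i - 1)) = 2 * (N - i) + 2" using i that by auto
    ultimately have "f i \<noteq> f (i - 1)" by (auto simp: shifted_row_def)
    moreover have "f i \<le> f (i - 1)" using that by (intro partitionsD(1)[OF f]) auto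
    ultimately have "f i < f (i - 1)" by simp
    moreover have "f (i - 1) \<le> f a" using that by (intro partitionsD(1)[OF f]) auto
    ultimately show ?thesis by simp
  qed
  show "(f(i := f i + 1)) k \<le> (f(i := f i + 1)) a" if "1 \<le> a" "a \<le> k" for a k
    using less[of a] partitionsD(1)[OF f that] that by auto
  show "(f(i := f i + 1)) k = 0" if "k \<notin> {1..N}" for k using that i partitionsD(2)[OF f that] by auto
  show "(\<Sum>k=1..N. (f(i := f i + 1)) k) = n + 1"
    using sum_fun_upd[OF i, of f "f i + 1"] partitionsD(3)[OF f] by simp
qed

text \<open>
  Kerov's argument: the transition coefficients of the up and down walks on partitions are
  related by \<open>row_weight_add_box\<close>, so summing over all edges between levels \<open>n\<close> and \<open>n + 1\<close>
  in two ways gives a two-term recursion for the level sums.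
\<close>

lemma partition_sum_step:
  assumes g: "\<And>c. g c = \<alpha> + \<beta> * of_int c + \<gamma> * (of_int c)\<^sup>2" and nN: "n < N"
  defines "W \<equiv> \<lambda>f. of_real (row_weight N f) * content_weight g N f"
  shows "of_nat (n + 1) * (\<Sum>f\<in>partitions N (n + 1). W f) = (\<alpha> / 2 + of_nat n * \<gamma>) * (\<Sum>f\<in>partitions N n. W f)"
proof -
  let ?x = "\<lambda>f i. int (f i) - 2 * (int i - 1)"
  have N: "1 \<le> N" using nN by simp
  have "of_nat (n + 1) * (\<Sum>f\<in>partitions N (n + 1). W f) = (\<Sum>f\<in>partitions N (n + 1). \<Sum>i=1..N. of_real (down_coeff N f i) * W f)"
    unfolding sum_distrib_left
  proof (intro sum.cong refl)
    fix f assume "f \<in> partitions N (n + 1)"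
    then have "(\<Sum>i=1..N. of_real (down_coeff N f i)) = (of_nat (n + 1) :: complex)"
      using sum_down_coeff[OF _ N, of f "n + 1"] unfolding of_real_sum[symmetric] by simp
    then show "of_nat (n + 1) * W f = (\<Sum>i=1..N. of_real (down_coeff N f i) * W f)"
      by (simp only: sum_distrib_right[symmetric])
  qed
  also have "\<dots> = (\<Sum>(f, i)\<in>partitions N (n + 1) \<times> {1..N}. of_real (down_coeff N f i) * W f)"
    by (rule sum.cartesian_product)
  also have "\<dots> = (\<Sum>(f, i)\<in>partitions N n \<times> {1..N}. of_real (up_coeff N f i) / 2 * g (?x f i) * W f)"
  proof -
    let ?S = "partitions N n \<times> {1..N}" and ?T = "partitions N (n + 1) \<times> {1..N}"
    \<comment> \<open>On the edges with nonzero coefficient, adding and removing a box are inverse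
      bijections; all other pairs contribute zero.\<close>
    let ?S' = "{(f, i) \<in> ?S. up_coeff N f i \<noteq> 0}" and ?T' = "{(f, i) \<in> ?T. down_coeff N f i \<noteq> 0}"
    let ?g = "\<lambda>(f, i). of_real (up_coeff N f i) / 2 * g (?x f i) * W f" and ?h = "\<lambda>(f, i). of_real (down_coeff N f i) * W f"
    have fin: "finite ?S" "finite ?T" by (simp_all add: finite_partitions)
    have "sum ?h ?T = sum ?h ?T'" by (rule sum.mono_neutral_right[OF fin(2)]) auto
    also have "\<dots> = sum ?g ?S'"
    proof (rule sum.reindex_bij_witness[where i = "\<lambda>(f, i). (f(i := f i + 1), i)" and j = "\<lambda>(f, i). (f(i := f i - 1), i)"])
      fix p assume p: "p \<in> ?S'"
      obtain f i where fi: "p = (f, i)" by (metis surj_pair)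
      have a: "f \<in> partitions N n" "i \<in> {1..N}" "up_coeff N f i \<noteq> 0" using p fi by auto
      note f' = raise_row_partition[OF a]
      have "down_coeff N (f(i := f i + 1)) i \<noteq> 0"
        using row_weight_add_box[OF a(1) f' a(2)] a(3) row_weight_nonzero[OF a(1)] by auto
      then show "(case p of (f, i) \<Rightarrow> (f(i := f i + 1), i)) \<in> ?T'" using f' a(2) by (simp add: fi)
      show "(case (case p of (f, i) \<Rightarrow> (f(i := f i + 1), i)) of (f, i) \<Rightarrow> (f(i := f i - 1), i)) = p" by (simp add: fi)
    next
      fix p assume p: "p \<in> ?T'"
      obtain f i where fi: "p = (f, i)" by (metis surj_pair)
      have a: "f \<in> partitions N (n + 1)" "i \<in> {1..N}" "down_coeff N f i \<noteq> 0" using p fi by auto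
      define f0 where "f0 = f(i := f i - 1)"
      have f0: "f i > 0" "f0 \<in> partitions N n" using lower_row_partition[OF a] by (auto simp: f0_def)
      have f: "f = f0(i := f0 i + 1)" using f0(1) by (auto simp: f0_def)
      have E: "2 * down_coeff N f i * row_weight N f = up_coeff N f0 i * row_weight N f0"
        using row_weight_add_box[OF f0(2) _ a(2)] a(1) unfolding f[symmetric] by simp
      have "up_coeff N f0 i \<noteq> 0" using E a(3) row_weight_nonzero[OF a(1)] by auto
      then show "(case p of (f, i) \<Rightarrow> (f(i := f i - 1), i)) \<in> ?S'" using f0(2) a(2) by (simp add: fi f0_def)
      show "(case (case p of (f, i) \<Rightarrow> (f(i := f i - 1), i)) of (f, i) \<Rightarrow> (f(i := f i + 1), i)) = p"
        using f0(1) by (simp add: fi)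
      have C: "content_weight g N f = g (?x f0 i) * content_weight g N f0"
        by (subst f) (rule content_weight_add_box[OF a(2)])
      have E': "of_real (down_coeff N f i) * of_real (row_weight N f) = of_real (up_coeff N f0 i) / 2 * (of_real (row_weight N f0) :: complex)"
      proof -
        have "down_coeff N f i * row_weight N f = up_coeff N f0 i / 2 * row_weight N f0" using E by simp
        then have "complex_of_real (down_coeff N f i * row_weight N f) = of_real (up_coeff N f0 i / 2 * row_weight N f0)" by (rule arg_cong)
        then show ?thesis by simp
      qed
      have "of_real (up_coeff N f0 i) / 2 * g (?x f0 i) * W f0 = of_real (down_coeff N f i) * W f"
        unfolding W_def C mult.assoc[symmetric] E' by (simp only: mult_ac)
      then show "?g (case p of (f, i) \<Rightarrow> (f(i := f i - 1), i)) = ?h p" by (simp only: fi prod.case f0_def)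
    qed
    also have "\<dots> = sum ?g ?S" by (rule sum.mono_neutral_left[OF fin(1)]) auto
    finally show ?thesis .
  qed
  also have "\<dots> = (\<Sum>f\<in>partitions N n. \<Sum>i=1..N. of_real (up_coeff N f i) / 2 * g (?x f i) * W f)"
    by (rule sum.cartesian_product[symmetric])
  also have "\<dots> = (\<Sum>f\<in>partitions N n. (\<alpha> / 2 + of_nat n * \<gamma>) * W f)"
  proof (intro sum.cong refl)
    fix f assume f: "f \<in> partitions N n"
    \<comment> \<open>Since n < N, not all N rows can be occupied; the empty last row is what the
      moment formulas require.\<close>
    have "f N = 0"
    proof (rule ccontr)
      assume "f N \<noteq> 0"
      then have "1 \<le> f i" if "i \<in> {1..N}" for i using partitionsD(1)[OF f, of i N] that by simp
      then have "(\<Sum>i=1..N. 1) \<le> (\<Sum>i=1..N. f i)" by (intro sum_mono) auto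
      then show False using partitionsD(3)[OF f] nN by simp
    qed
    note S = sum_up_coeff[OF f N this]
    have "(\<Sum>i=1..N. of_real (up_coeff N f i) / 2 * g (?x f i) * W f)
       = (\<Sum>i=1..N. (\<alpha> * of_real (up_coeff N f i) + \<beta> * of_real ((real (f i) - 2 * (real i - 1)) * up_coeff N f i)
          + \<gamma> * of_real ((real (f i) - 2 * (real i - 1))\<^sup>2 * up_coeff N f i)) * (W f / 2))"
      unfolding g by (intro sum.cong refl) (simp add: field_simps)
    also have "\<dots> = (\<alpha> * of_real (\<Sum>i=1..N. up_coeff N f i) + \<beta> * of_real (\<Sum>i=1..N. (real (f i) - 2 * (real i - 1)) * up_coeff N f i)
          + \<gamma> * of_real (\<Sum>i=1..N. (real (f i) - 2 * (real i - 1))\<^sup>2 * up_coeff N f i)) * (W f / 2)"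
      by (simp only: of_real_sum sum_distrib_left sum_distrib_right[symmetric] sum.distrib)
    \<comment> \<open>The moments 1, 0 and 2n are inserted, and the common factor 1/2 leaves alpha/2
      + n gamma.\<close>
    also have "\<dots> = (\<alpha> / 2 + of_nat n * \<gamma>) * W f"
      unfolding S by (simp add: field_simps)
    finally show "(\<Sum>i=1..N. of_real (up_coeff N f i) / 2 * g (?x f i) * W f) = (\<alpha> / 2 + of_nat n * \<gamma>) * W f" .
  qed
  finally show ?thesis by (simp only: sum_distrib_left)
qed

section \<open>From row functions back to diagrams\<close>

lemma length_row_lengths_le: "length (row_lengths \<nu>) \<le> num_boxes \<nu>"
proof -
  have "(\<lambda>i. (i, 1)) ` {1..length (row_lengths \<nu>)} \<subseteq> boxes \<nu>"
  proof -
    have "1 \<le> row \<nu> i" if "1 \<le> i" "i \<le> length (row_lengths \<nu>)" for i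
      using row_lengths_nth[of "i - 1" \<nu>] that by (cases i) auto
    then show ?thesis by (auto simp: boxes_def)
  qed
  then have "card ((\<lambda>i. (i, 1 :: nat)) ` {1..length (row_lengths \<nu>)}) \<le> num_boxes \<nu>"
    unfolding num_boxes_def by (intro card_mono) auto
  then show ?thesis by (simp add: card_image inj_on_def)
qed

lemma boxes_Sigma:
  assumes "length (row_lengths \<nu>) \<le> N"
  shows "boxes \<nu> = (SIGMA i:{1..N}. {1..row \<nu> i})"
proof -
  have "i \<le> N" if "1 \<le> j" "j \<le> row \<nu> i" for i j
    using row_eq_0(1)[of \<nu> i] that assms by (cases "i \<le> length (row_lengths \<nu>)") auto
  then show ?thesis by (auto simp: boxes_def)
qed

lemma row_in_partitions:
  assumes "num_boxes \<nu> \<le> N"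
  shows "row \<nu> \<in> partitions N (num_boxes \<nu>)"
proof (rule partitionsI)
  have len: "length (row_lengths \<nu>) \<le> N" using assms length_row_lengths_le[of \<nu>] by simp
  show "row \<nu> i = 0" if "i \<notin> {1..N}" for i
    using that len row_eq_0[of \<nu>] by (cases "i = 0") auto
  show "(\<Sum>i=1..N. row \<nu> i) = num_boxes \<nu>"
    unfolding num_boxes_def boxes_Sigma[OF len] by simp
qed (rule row_antimono)

lemma bij_betw_row_partitions:
  assumes "n \<le> N"
  shows "bij_betw row {\<nu>. num_boxes \<nu> = n} (partitions N n)"
  unfolding bij_betw_def
proof
  show "inj_on row {\<nu>. num_boxes \<nu> = n}" by (rule inj_onI) (auto intro: young_diagram_eqI)
  show "row ` {\<nu>. num_boxes \<nu> = n} = partitions N n"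
  proof (intro equalityI subsetI)
    fix f assume f: "f \<in> partitions N n"
    obtain \<nu> where \<nu>: "\<And>i. 1 \<le> i \<Longrightarrow> row \<nu> i = f i"
      by (rule young_diagram_exists[of f N]) (use partitionsD[OF f] in auto)
    have "row \<nu> i = f i" for i using \<nu>[of i] partitionsD(2)[OF f, of 0] by (cases "i = 0") (auto simp: row_eq_0)
    then have row: "row \<nu> = f" by auto
    have "row \<nu> (Suc N) = 0" using row partitionsD(2)[OF f, of "Suc N"] by simp
    then have "length (row_lengths \<nu>) \<le> N"
      using row_lengths_nth[of N \<nu>] by (cases "N < length (row_lengths \<nu>)") auto
    then have "num_boxes \<nu> = n" unfolding num_boxes_def boxes_Sigma[OF \<open>length (row_lengths \<nu>) \<le> N\<close>]
      using partitionsD(3)[OF f] row by simp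
    then show "f \<in> row ` {\<nu>. num_boxes \<nu> = n}" using row by blast
  qed (use row_in_partitions assms in auto)
qed

lemma prod_pairs_from: "k \<le> N \<Longrightarrow> (\<Prod>i=2 * k + 1..2 * N. F i) = (\<Prod>a=k+1..N. F (2 * a - 1) * F (2 * a :: nat) :: 'a::comm_monoid_mult)"
proof (induction N)
  case (Suc N)
  show ?case
  proof (cases "k \<le> N")
    case True
    then have "{2 * k + 1..2 * Suc N} = insert (2 * N + 2) (insert (2 * N + 1) {2 * k + 1..2 * N})" "{k + 1..Suc N} = insert (Suc N) {k + 1..N}" by auto
    then show ?thesis using Suc.IH[OF True] by (simp add: mult_ac)
  next
    case False
    then have "k = Suc N" using Suc.prems by simp
    then show ?thesis by simp
  qed
qed simp

text \<open>\<open>hook_row_product\<close> is applied to the 2N rows of the doubled diagram, where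
  rows 2a - 1 and 2a have shifted lengths l + 1 and l. The difference inside such a pair is 1; two
  different pairs give the four factors of \<open>pair_weight\<close>.\<close>

lemma hook_row_weight:
  assumes "length (row_lengths \<nu>) \<le> N"
  shows "1 / (hook_H \<nu> 2 * hook_H' \<nu> 2) = row_weight N (row \<nu>)"
proof -
  let ?r = "row (double_rows \<nu>)" and ?c = "col (double_rows \<nu>)" and ?l = "shifted_row N (row \<nu>)"
  have rr: "?r (2 * k - 1) = row \<nu> k" "?r (2 * k) = row \<nu> k" if "1 \<le> k" for k
    using that by (simp_all add: row_double_rows)
  define H where "H = (\<Prod>(i, j)\<in>boxes (double_rows \<nu>). (?r i - j) + (?c j - i) + 1)"
  have r0: "?r i = 0" if "2 * N < i" for i
    using that assms row_eq_0(1)[of \<nu> "(i + 1) div 2"] by (simp add: row_double_rows)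
  have B: "boxes (double_rows \<nu>) = (SIGMA i:{1..2 * N}. {1..?r i})"
  proof -
    have "i \<le> 2 * N" if "1 \<le> j" "j \<le> ?r i" for i j using r0[of i] that by (cases "i \<le> 2 * N") auto
    then show ?thesis by (auto simp: boxes_def)
  qed
  have c: "?c j \<le> 2 * N" if "1 \<le> j" for j
  proof (rule ccontr)
    assume "\<not> ?c j \<le> 2 * N"
    then show False using le_col_iff[of "2 * N + 1" j "double_rows \<nu>"] r0[of "2 * N + 1"] that by simp
  qed
  let ?G = "\<lambda>i k. (?r i - ?r k) + (k - i)"
  have "H * (\<Prod>i=1..2 * N. \<Prod>k=i+1..2 * N. ?G i k) = (\<Prod>i=1..2 * N. fact (?r i + 2 * N - i))"
  proof -
    have "H = (\<Prod>i=1..2 * N. \<Prod>j=1..?r i. (?r i - j) + (?c j - i) + 1)"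
      unfolding H_def B by (subst prod.Sigma) auto
    then have "H * (\<Prod>i=1..2 * N. \<Prod>k=i+1..2 * N. ?G i k)
      = (\<Prod>i=1..2 * N. (\<Prod>j=1..?r i. (?r i - j) + (?c j - i) + 1) * (\<Prod>k=i+1..2 * N. ?G i k))"
      by (simp only: prod.distrib)
    also have "\<dots> = (\<Prod>i=1..2 * N. fact (?r i + 2 * N - i))"
      by (intro prod.cong refl hook_row_product) (use c le_col_iff in auto)
    finally show ?thesis .
  qed
  also have "(\<Prod>i=1..2 * N. fact (?r i + 2 * N - i)) = (\<Prod>k=1..N. fact (?l k + 1) * fact (?l k) :: nat)"
    unfolding prod_pairs
  proof (intro prod.cong refl)
    fix k assume k: "k \<in> {1..N}"
    have "?r (2 * k - 1) = row \<nu> k" "?r (2 * k) = row \<nu> k" using rr k by auto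
    moreover have "row \<nu> k + 2 * N - (2 * k - 1) = ?l k + 1" "row \<nu> k + 2 * N - 2 * k = ?l k"
      using k by (auto simp: shifted_row_def)
    ultimately show "fact (?r (2 * k - 1) + 2 * N - (2 * k - 1)) * fact (?r (2 * k) + 2 * N - 2 * k) = (fact (?l k + 1) * fact (?l k) :: nat)"
      by (simp only:)
  qed
  finally have "H * (\<Prod>i=1..2 * N. \<Prod>k=i+1..2 * N. ?G i k) = (\<Prod>k=1..N. fact (?l k + 1) * fact (?l k))" .
  then have "real H * real (\<Prod>i=1..2 * N. \<Prod>k=i+1..2 * N. ?G i k) = real (\<Prod>k=1..N. fact (?l k + 1) * fact (?l k))"
    unfolding of_nat_mult[symmetric] by (rule arg_cong)
  also have "\<dots> = (\<Prod>k=1..N. fact (?l k) * fact (?l k + 1))"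
    by (simp only: of_nat_prod of_nat_mult of_nat_fact mult.commute)
  finally have "real H * real (\<Prod>i=1..2 * N. \<Prod>k=i+1..2 * N. ?G i k) = (\<Prod>k=1..N. fact (?l k) * fact (?l k + 1))" .
  moreover have "real (\<Prod>i=1..2 * N. \<Prod>k=i+1..2 * N. ?G i k)
     = (\<Prod>(a, b)\<in>{(a, b). a \<in> {1..N} \<and> b \<in> {1..N} \<and> a < b}. pair_weight (real (?l a) - real (?l b)))"
  proof -
    have "real (\<Prod>i=1..2 * N. \<Prod>k=i+1..2 * N. ?G i k) = (\<Prod>i=1..2 * N. \<Prod>k=i+1..2 * N. real (?G i k))" by simp
    also have "\<dots> = (\<Prod>a=1..N. \<Prod>b=a+1..N. pair_weight (real (?l a) - real (?l b)))"
      unfolding prod_pairs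
    proof (intro prod.cong refl)
      fix a assume a: "a \<in> {1..N}"
      have "{2 * a - 1 + 1..2 * N} = insert (2 * a) {2 * a + 1..2 * N}" using a by auto
      then have "(\<Prod>k=2 * a - 1 + 1..2 * N. real (?G (2 * a - 1) k)) = real (?G (2 * a - 1) (2 * a)) * (\<Prod>k=2 * a + 1..2 * N. real (?G (2 * a - 1) k))"
        by (simp only:) (subst prod.insert, auto)
      moreover have "real (?G (2 * a - 1) (2 * a)) = 1" using a rr[of a] by auto
      ultimately have "(\<Prod>k=2 * a - 1 + 1..2 * N. real (?G (2 * a - 1) k)) * (\<Prod>k=2 * a + 1..2 * N. real (?G (2 * a) k))
        = (\<Prod>k=2 * a + 1..2 * N. real (?G (2 * a - 1) k) * real (?G (2 * a) k))"
        by (simp only: prod.distrib mult_1_left)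
      also have "\<dots> = (\<Prod>b=a+1..N. (real (?G (2 * a - 1) (2 * b - 1)) * real (?G (2 * a) (2 * b - 1))) * (real (?G (2 * a - 1) (2 * b)) * real (?G (2 * a) (2 * b))))"
        using a by (intro prod_pairs_from) auto
      also have "\<dots> = (\<Prod>b=a+1..N. pair_weight (real (?l a) - real (?l b)))"
      proof (intro prod.cong refl)
        fix b assume b: "b \<in> {a + 1..N}"
        define d where "d = real (?l a) - real (?l b)"
        have le: "row \<nu> b \<le> row \<nu> a" using a b by (intro row_antimono) auto
        have rs: "?r (2 * a - 1) = row \<nu> a" "?r (2 * a) = row \<nu> a" "?r (2 * b - 1) = row \<nu> b" "?r (2 * b) = row \<nu> b"
          using rr a b by auto
        have "real (?G (2 * a - 1) (2 * b - 1)) = d" "real (?G (2 * a) (2 * b - 1)) = d - 1"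
          "real (?G (2 * a - 1) (2 * b)) = d + 1" "real (?G (2 * a) (2 * b)) = d"
          unfolding rs using le a b by (auto simp: d_def shifted_row_def of_nat_diff)
        then show "(real (?G (2 * a - 1) (2 * b - 1)) * real (?G (2 * a) (2 * b - 1))) * (real (?G (2 * a - 1) (2 * b)) * real (?G (2 * a) (2 * b))) = pair_weight (real (?l a) - real (?l b))"
          unfolding d_def[symmetric] by (simp only:) (simp add: pair_weight_def power2_eq_square algebra_simps)
      qed
      finally show "(\<Prod>k=2 * a - 1 + 1..2 * N. real (?G (2 * a - 1) k)) * (\<Prod>k=2 * a + 1..2 * N. real (?G (2 * a) k)) = (\<Prod>b=a+1..N. pair_weight (real (?l a) - real (?l b)))" .
    qed
    also have "\<dots> = (\<Prod>(a, b)\<in>(SIGMA a:{1..N}. {a+1..N}). pair_weight (real (?l a) - real (?l b)))"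
      by (subst prod.Sigma) auto
    also have "(SIGMA a:{1..N}. {a+1..N}) = {(a, b). a \<in> {1..N} \<and> b \<in> {1..N} \<and> a < b}" by auto
    finally show ?thesis .
  qed
  moreover have "real H = hook_H \<nu> 2 * hook_H' \<nu> 2" unfolding H_def by (rule hook_H_double_rows[symmetric])
  moreover have "real H \<noteq> 0" unfolding H_def by (auto simp: prod_zero_iff)
  ultimately have "hook_H \<nu> 2 * hook_H' \<nu> 2 * (\<Prod>(a, b)\<in>{(a, b). a \<in> {1..N} \<and> b \<in> {1..N} \<and> a < b}. pair_weight (real (?l a) - real (?l b)))
      = (\<Prod>k=1..N. fact (?l k) * fact (?l k + 1))" "hook_H \<nu> 2 * hook_H' \<nu> 2 \<noteq> 0"
    by (simp_all only: not_False_eq_True)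
  moreover have "(\<Prod>k=1..N. fact (?l k) * fact (?l k + 1) :: real) \<noteq> 0" by (simp only: prod_zero_iff finite_atLeastAtMost mult_eq_0_iff fact_nonzero) simp
  moreover have "1 / X = V / F" if "X * V = F" "X \<noteq> 0" "F \<noteq> 0" for X V F :: real
    using that by (auto simp: field_simps)
  ultimately show ?thesis unfolding row_weight_def by blast
qed

lemma box_weight_row:
  assumes "length (row_lengths \<nu>) \<le> N"
  shows "box_weight g \<nu> = of_real (row_weight N (row \<nu>)) * content_weight g N (row \<nu>)"
proof -
  have "(\<Prod>(i, j)\<in>boxes \<nu>. g (int j - 1 - 2 * (int i - 1))) = content_weight g N (row \<nu>)"
    unfolding content_weight_def boxes_Sigma[OF assms] by (subst prod.Sigma) auto
  then show ?thesis unfolding box_weight_def hook_row_weight[OF assms, symmetric] by simp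
qed

lemma finite_level: "finite {\<nu>. num_boxes \<nu> = n}"
  using bij_betw_finite[OF bij_betw_row_partitions[of n n]] finite_partitions by simp

text \<open>With n + 1 rows both levels fit, and at level n one row stays empty, as
  \<open>partition_sum_step\<close> requires.\<close>

theorem box_weight_level_step:
  assumes g: "\<And>c. g c = \<alpha> + \<beta> * of_int c + \<gamma> * (of_int c)\<^sup>2"
  shows "of_nat (n + 1) * (\<Sum>\<nu> | num_boxes \<nu> = n + 1. box_weight g \<nu>) = (\<alpha> / 2 + of_nat n * \<gamma>) * (\<Sum>\<nu> | num_boxes \<nu> = n. box_weight g \<nu>)"
proof -
  have "(\<Sum>\<nu> | num_boxes \<nu> = m. box_weight g \<nu>) = (\<Sum>f\<in>partitions (n + 1) m. of_real (row_weight (n + 1) f) * content_weight g (n + 1) f)"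
    if "m \<le> n + 1" for m
  proof -
    have "(\<Sum>\<nu> | num_boxes \<nu> = m. box_weight g \<nu>) = (\<Sum>\<nu> | num_boxes \<nu> = m. of_real (row_weight (n + 1) (row \<nu>)) * content_weight g (n + 1) (row \<nu>))"
      using that length_row_lengths_le by (intro sum.cong refl box_weight_row) (auto intro: order_trans)
    also have "\<dots> = (\<Sum>f\<in>partitions (n + 1) m. of_real (row_weight (n + 1) f) * content_weight g (n + 1) f)"
      by (rule sum.reindex_bij_betw[OF bij_betw_row_partitions[OF that]])
    finally show ?thesis .
  qed
  then show ?thesis using partition_sum_step[OF g, of n "n + 1"] by simp
qed

lemma box_weight_level_0: "(\<Sum>\<nu> | num_boxes \<nu> = 0. box_weight g \<nu>) = 1"
proof -
  have empty: "boxes \<nu> = {}" if "num_boxes \<nu> = 0" for \<nu> using that by (simp add: num_boxes_def)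
  have w: "box_weight g \<nu> = 1" if "num_boxes \<nu> = 0" for \<nu>
    using empty[OF that] by (simp add: box_weight_def hook_H_def hook_H'_def)
  have "card {\<nu>. num_boxes \<nu> = 0} = card (partitions 0 0)"
    by (rule bij_betw_same_card[OF bij_betw_row_partitions]) simp
  also have "partitions 0 0 = {\<lambda>_. 0}" by (auto simp: partitions_def)
  finally show ?thesis using w by simp
qed

section \<open>The L-ensembles\<close>

lemma prod_nonneg_Reals:
  fixes f :: "'a \<Rightarrow> complex"
  shows "(\<And>x. x \<in> A \<Longrightarrow> f x \<in> \<real>\<^sub>\<ge>\<^sub>0) \<Longrightarrow> prod f A \<in> \<real>\<^sub>\<ge>\<^sub>0"
  by (induction A rule: infinite_finite_induct) auto

lemma hook_product_pos: "hook_H \<nu> 2 * hook_H' \<nu> 2 > 0"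
  unfolding hook_H_double_rows of_nat_0_less_iff by (rule prod_pos) auto

lemma box_weight_nonneg:
  assumes "(\<Prod>(i, j)\<in>boxes \<nu>. g (int j - 1 - 2 * (int i - 1))) \<in> \<real>\<^sub>\<ge>\<^sub>0"
  shows "box_weight g \<nu> \<in> \<real>\<^sub>\<ge>\<^sub>0"
  unfolding box_weight_def
  by (rule nonneg_Reals_divide_I[OF assms]) (simp only: nonneg_Reals_of_real_iff less_imp_le[OF hook_product_pos])

text \<open>Every finite set lies in a finite union of levels, so by nonnegativity the finite sums
  are bounded by the limit of the partial sums over levels, and conversely.\<close>

lemma has_sum_by_levels:
  fixes w :: "'a \<Rightarrow> real" and size :: "'a \<Rightarrow> nat"
  assumes nonneg: "\<And>x. w x \<ge> 0" and fin: "\<And>n. finite {x. size x = n}"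
    and sums: "(\<lambda>n. \<Sum>x | size x = n. w x) sums S"
  shows "(w has_sum S) UNIV"
proof -
  define U where "U = (\<lambda>n. \<Union>k<n. {x. size x = k})"
  have finU: "finite (U n)" for n using fin by (simp add: U_def)
  have sumU: "sum w (U n) = (\<Sum>k<n. \<Sum>x | size x = k. w x)" for n
    unfolding U_def using fin by (intro sum.UNION_disjoint) auto
  have lim: "(\<lambda>n. sum w (U n)) \<longlonglongrightarrow> S" using sums unfolding sums_def sumU .
  have mono: "incseq (\<lambda>n. sum w (U n))"
    by (intro incseq_SucI sum_mono2 finU) (auto simp: U_def nonneg less_Suc_eq)
  have le: "sum w F \<le> S" if "finite F" for F
  proof -
    have "finite (size ` F)" using that by simp
    then obtain n where n: "\<forall>k\<in>size ` F. k < n" unfolding finite_nat_set_iff_bounded by (elim exE)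
    then have "F \<subseteq> U n" by (auto simp: U_def)
    then have "sum w F \<le> sum w (U n)" by (intro sum_mono2 finU) (auto simp: nonneg)
    also have "\<dots> \<le> S" using incseq_le[OF mono lim] .
    finally show ?thesis .
  qed
  have summ: "w summable_on UNIV"
    by (rule nonneg_bdd_above_summable_on) (use nonneg le in \<open>auto intro!: bdd_aboveI2[of _ _ S]\<close>)
  have "infsum w UNIV \<le> S" using summ le by (intro infsum_le_finite_sums) auto
  moreover have "S \<le> infsum w UNIV"
  proof (rule LIMSEQ_le_const2[OF lim])
    have "sum w (U n) \<le> infsum w UNIV" for n using summ finU nonneg by (intro finite_sum_le_infsum) auto
    then show "\<exists>N. \<forall>n\<ge>N. sum w (U n) \<le> infsum w UNIV" by blast
  qed
  ultimately show ?thesis using summ by (simp add: has_sum_iff)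
qed

lemma pmf_of_has_sum_exists:
  fixes w :: "'a \<Rightarrow> real"
  assumes nonneg: "\<And>x. w x \<ge> 0" and sum: "(w has_sum S) UNIV" and S: "S > 0"
  obtains M where "\<And>x. pmf M x = w x / S"
proof -
  let ?f = "\<lambda>x. w x / S"
  have f: "?f x \<ge> 0" for x using nonneg[of x] S by simp
  have hs: "(?f has_sum 1) UNIV"
    using has_sum_cmult_left[OF sum, of "1 / S"] S by simp
  then have "?f summable_on UNIV" by (auto simp: summable_on_def)
  moreover have "(\<lambda>x. norm (?f x)) = ?f" using f by (simp only: real_norm_def abs_of_nonneg)
  ultimately have "Infinite_Sum.abs_summable_on ?f UNIV" by (simp only:)
  then have abs: "Infinite_Set_Sum.abs_summable_on ?f UNIV" by (simp only: abs_summable_equivalent)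
  have "(\<integral>\<^sup>+x. ennreal (?f x) \<partial>count_space UNIV) = ennreal (infsetsum ?f UNIV)"
    using abs f by (rule nn_integral_conv_infsetsum)
  also have "\<dots> = 1" using infsetsum_infsum[OF abs] infsumI[OF hs] by simp
  finally have "(\<integral>\<^sup>+x. ennreal (?f x) \<partial>count_space UNIV) = 1" .
  then have "pmf (embed_pmf ?f) x = ?f x" for x using f by (intro pmf_embed_pmf) auto
  then show ?thesis by (rule that)
qed

lemma countable_half_integers: "countable half_integers"
proof -
  have "half_integers = range (\<lambda>n::int. real_of_int n + 1 / 2)" by (auto simp: half_integers_def)
  then show ?thesis by (metis countable_image countableI_type)
qed

text \<open>Nonnegative terms force Z to be real, and being nonzero it is positive, so the weights
  can be normalised to a pmf. The Pfaffian sum over finite subsets reduces to the sum over diagrams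
  because \<open>config\<close> is injective and the Pfaffian vanishes off its range.\<close>

theorem L_ensemble_of_box_weight:
  assumes hP: "\<And>n. h (real n + 1 / 2) = arm_product g n / fact n * of_real (q powr ((real n + 1 / 2) / 2))"
    and hQ: "\<And>n. h (- real n - 1 / 2) = leg_product g n / fact n * of_real (q powr ((real n + 1 / 2) / 2))"
    and q: "q > 0"
    and nonneg: "\<And>\<nu>. box_weight g \<nu> \<in> \<real>\<^sub>\<ge>\<^sub>0"
    and sums: "(\<lambda>n. of_real (q ^ n) * (\<Sum>\<nu> | num_boxes \<nu> = n. box_weight g \<nu>)) sums Z" and Z: "Z \<noteq> 0"
  shows "(\<exists>M. is_measure_with_weights M (\<lambda>\<nu>. of_real (q ^ num_boxes \<nu>) * box_weight g \<nu> / Z) \<and>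
      is_pfaffian_L_ensemble half_integers (L_matrix h) (point_process M)) \<and>
    pf_J_plus half_integers (L_matrix h) = Z"
proof -
  define w where "w = (\<lambda>\<nu>. Re (of_real (q ^ num_boxes \<nu>) * box_weight g \<nu>))"
  have wN: "of_real (q ^ num_boxes \<nu>) * box_weight g \<nu> \<in> \<real>\<^sub>\<ge>\<^sub>0" for \<nu>
    using nonneg[of \<nu>] q by (intro nonneg_Reals_mult_I) auto
  then have w0: "w \<nu> \<ge> 0" and w: "of_real (q ^ num_boxes \<nu>) * box_weight g \<nu> = of_real (w \<nu>)" for \<nu>
    by (auto simp: w_def complex_nonneg_Reals_iff complex_eq_iff simp del: of_real_power)
  have level: "of_real (q ^ n) * (\<Sum>\<nu> | num_boxes \<nu> = n. box_weight g \<nu>) = of_real (\<Sum>\<nu> | num_boxes \<nu> = n. w \<nu>)" for n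
    unfolding of_real_sum w[symmetric] sum_distrib_left by (intro sum.cong) auto
  have "(\<lambda>n. of_real (\<Sum>\<nu> | num_boxes \<nu> = n. w \<nu>)) sums Z" using sums unfolding level .
  then have "(\<lambda>n. Re (of_real (\<Sum>\<nu> | num_boxes \<nu> = n. w \<nu>))) sums Re Z" "(\<lambda>n. Im (of_real (\<Sum>\<nu> | num_boxes \<nu> = n. w \<nu>))) sums Im Z"
    by (rule sums_Re, rule sums_Im)
  then have Re: "(\<lambda>n. \<Sum>\<nu> | num_boxes \<nu> = n. w \<nu>) sums Re Z" and "(\<lambda>n::nat. 0) sums Im Z"
    by simp_all
  then have "Im Z = 0" using sums_unique2[OF sums_zero] by metis
  then have ZR: "Z = of_real (Re Z)" by (simp add: complex_eq_iff)
  have hs: "(w has_sum Re Z) UNIV" by (rule has_sum_by_levels[OF w0 finite_level Re])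
  have "Re Z \<ge> 0" using has_sum_nonneg[OF hs] w0 by blast
  then have Rpos: "Re Z > 0" using Z ZR by (metis of_real_0 order.not_eq_order_implies_strict)
  obtain M where M: "\<And>\<nu>. pmf M \<nu> = w \<nu> / Re Z" using pmf_of_has_sum_exists[OF w0 hs Rpos] by blast
  have pf: "pf_submatrix (L_matrix h) (config \<nu>) = of_real (w \<nu>)" for \<nu>
    unfolding w[symmetric] by (rule pf_submatrix_config[OF hP hQ q])
  have pf0: "pf_submatrix (L_matrix h) X = 0" if "X \<in> Fpow half_integers" "X \<notin> range config" for X
    using pf_submatrix_nonzero_imp_config[of X h] that by (auto simp: Fpow_def)
  have sub: "range config \<subseteq> Fpow half_integers" using config_subset by (auto simp: Fpow_def)
  have "((\<lambda>\<nu>. complex_of_real (w \<nu>)) has_sum of_real (Re Z)) UNIV" using hs by (rule has_sum_of_real)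
  then have "((pf_submatrix (L_matrix h) \<circ> config) has_sum Z) UNIV" unfolding comp_def pf ZR[symmetric] .
  then have "(pf_submatrix (L_matrix h) has_sum Z) (range config)"
    using has_sum_reindex[OF inj_config] by blast
  then have pfsum: "(pf_submatrix (L_matrix h) has_sum Z) (Fpow half_integers)"
    by (subst has_sum_cong_neutral[where T = "range config" and g = "pf_submatrix (L_matrix h)"]) (use pf0 sub in auto)
  then have J: "pf_J_plus half_integers (L_matrix h) = Z" unfolding pf_J_plus_def by (rule infsumI)
  have "is_pfaffian_L_ensemble half_integers (L_matrix h) (point_process M)"
    unfolding is_pfaffian_L_ensemble_def J
  proof (intro conjI ballI)
    show "countable half_integers" by (rule countable_half_integers)
    show "skew_block_matrix half_integers (L_matrix h)"
      unfolding skew_block_matrix_def using L_matrix_skew by blast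
    show "pf_submatrix (L_matrix h) X \<in> \<real>\<^sub>\<ge>\<^sub>0" if "X \<in> Fpow half_integers" for X
      using pf pf0[OF that] w0 by (cases "X \<in> range config") auto
    show "pf_submatrix (L_matrix h) summable_on Fpow half_integers" using pfsum by (auto simp: summable_on_def)
    show "set_pmf (point_process M) \<subseteq> Fpow half_integers" using sub by (auto simp: point_process_def)
    show "complex_of_real (pmf (point_process M) X) = pf_submatrix (L_matrix h) X / Z" if X: "X \<in> Fpow half_integers" for X
    proof (cases "X \<in> range config")
      case True
      then obtain \<nu> where X: "X = config \<nu>" by blast
      have "complex_of_real (pmf (point_process M) X) = of_real (w \<nu> / Re Z)"
        unfolding X point_process_def pmf_map_inj'[OF inj_config] M ..
      also have "\<dots> = pf_submatrix (L_matrix h) X / Z" unfolding X pf by (subst (2) ZR) simp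
      finally show ?thesis .
    next
      case False
      then have "pmf (point_process M) X = 0" unfolding point_process_def by (intro pmf_map_outside) auto
      then show ?thesis using pf0[OF X False] by simp
    qed
  qed
  moreover have "is_measure_with_weights M (\<lambda>\<nu>. of_real (q ^ num_boxes \<nu>) * box_weight g \<nu> / Z)"
    unfolding is_measure_with_weights_def w M by (subst ZR) simp
  ultimately show ?thesis using J by blast
qed

section \<open>The functions h as arm and leg products\<close>

lemma arm_product_mult: "arm_product (\<lambda>c. f c * g c) n = arm_product f n * arm_product g n"
  by (simp add: arm_product_def prod.distrib)

lemma leg_product_mult: "leg_product (\<lambda>c. f c * g c) n = leg_product f n * leg_product g n"
  by (simp add: leg_product_def prod.distrib)

lemma bracket_symbol_arm: "bracket_symbol (z + 1) n = arm_product (\<lambda>c. z + of_int c) n"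
proof (cases "even n")
  case True
  then obtain m where m: "n = 2 * m" by blast
  have "bracket_symbol (z + 1) n = (\<Prod>k<m. z + of_int (int (2 * k + 2)))"
    unfolding bracket_symbol_def m by (auto intro!: prod.cong simp: algebra_simps)
  also have "\<dots> = arm_product (\<lambda>c. z + of_int c) n"
    unfolding arm_product_def m
    by (rule prod.reindex_bij_witness[where i = "\<lambda>k. k div 2 - 1" and j = "\<lambda>k. 2 * k + 2"]) (auto elim!: evenE)
  finally show ?thesis .
next
  case False
  then obtain m where m: "n = 2 * m + 1" by (auto elim: oddE)
  have "bracket_symbol (z + 1) n = (\<Prod>k<m + 1. z + of_int (int (2 * k + 1)))"
    unfolding bracket_symbol_def m by (auto intro!: prod.cong simp: algebra_simps)
  also have "\<dots> = arm_product (\<lambda>c. z + of_int c) n"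
    unfolding arm_product_def m
    by (rule prod.reindex_bij_witness[where i = "\<lambda>k. k div 2" and j = "\<lambda>k. 2 * k + 1"]) (auto elim!: oddE)
  finally show ?thesis .
qed

lemma bracket_symbol_leg: "bracket_symbol (- z) n = leg_product (\<lambda>c. - (z + of_int c)) n"
proof (cases "even n")
  case True
  then obtain m where m: "n = 2 * m" by blast
  have "bracket_symbol (- z) n = (\<Prod>k<m. - (z + of_int (- int (2 * k + 1))))"
    unfolding bracket_symbol_def m by (auto intro!: prod.cong simp: algebra_simps)
  also have "\<dots> = leg_product (\<lambda>c. - (z + of_int c)) n"
    unfolding leg_product_def m
    by (rule prod.reindex_bij_witness[where i = "\<lambda>k. k div 2" and j = "\<lambda>k. 2 * k + 1"]) (auto elim!: oddE)
  finally show ?thesis .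
next
  case False
  then obtain m where m: "n = 2 * m + 1" by (auto elim: oddE)
  have "bracket_symbol (- z) n = (\<Prod>k<m + 1. - (z + of_int (- int (2 * k))))"
    unfolding bracket_symbol_def m by (auto intro!: prod.cong simp: algebra_simps)
  also have "\<dots> = leg_product (\<lambda>c. - (z + of_int c)) n"
    unfolding leg_product_def m
    by (rule prod.reindex_bij_witness[where i = "\<lambda>k. k div 2" and j = "\<lambda>k. 2 * k"]) (auto elim!: evenE)
  finally show ?thesis .
qed

lemma h_z_pos:
  "h_z z z' \<xi> (real n + 1 / 2) = arm_product (\<lambda>c. (z + of_int c) * (z' + of_int c)) n / fact n * of_real (\<xi> powr ((real n + 1 / 2) / 2))"
proof -
  have "Gamma (real n + 1 / 2 + 1 / 2) = fact n" by (simp add: Gamma_fact[symmetric] add.commute)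
  then show ?thesis by (simp add: h_z_def bracket_symbol_arm arm_product_mult)
qed

text \<open>The factors for z and z' run over the same contents, so the minus signs in
  \<open>bracket_symbol_leg\<close> cancel in pairs.\<close>

lemma h_z_neg:
  "h_z z z' \<xi> (- real n - 1 / 2) = leg_product (\<lambda>c. (z + of_int c) * (z' + of_int c)) n / fact n * of_real (\<xi> powr ((real n + 1 / 2) / 2))"
proof -
  have "(\<lambda>c. (z + of_int c) * (z' + of_int c)) = (\<lambda>c. - (z + of_int c) * - (z' + of_int c))" by (simp add: fun_eq_iff algebra_simps)
  then have L: "leg_product (\<lambda>c. (z + of_int c) * (z' + of_int c)) n = bracket_symbol (- z) n * bracket_symbol (- z') n"
    by (simp only: leg_product_mult bracket_symbol_leg)
  have "Gamma (- (- real n - 1 / 2) + 1 / 2) = fact n" by (simp add: Gamma_fact[symmetric] add.commute)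
  moreover have "- (- real n - 1 / 2) - 1 / 2 = real n" "- (- real n - 1 / 2) = real n + 1 / 2" "\<not> - real n - 1 / 2 > 0" by simp_all
  ultimately show ?thesis unfolding h_z_def L by (simp only: if_False floor_of_nat nat_int) simp
qed

lemma h_Pl_pos:
  "h_Pl \<eta> (real n + 1 / 2) = arm_product (\<lambda>c. 1) n / fact n * of_real ((2 * \<eta>) powr ((real n + 1 / 2) / 2))"
proof -
  have "Gamma (real n + 1 / 2 + 1 / 2) = fact n" by (simp add: Gamma_fact[symmetric] add.commute)
  then show ?thesis by (simp add: h_Pl_def arm_product_def)
qed

lemma h_Pl_neg:
  "h_Pl \<eta> (- real n - 1 / 2) = leg_product (\<lambda>c. 1) n / fact n * of_real ((2 * \<eta>) powr ((real n + 1 / 2) / 2))"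
proof -
  have "\<bar>- real n - 1 / 2\<bar> = real n + 1 / 2" by simp
  moreover have "Gamma (real n + 1 / 2 + 1 / 2) = fact n" by (simp add: Gamma_fact[symmetric] add.commute)
  ultimately show ?thesis unfolding h_Pl_def by (simp only:) (simp add: leg_product_def)
qed

lemma level_sum_z:
  "(\<Sum>\<nu> | num_boxes \<nu> = n. box_weight (\<lambda>c. (z + of_int c) * (z' + of_int c)) \<nu>) = pochhammer (z * z' / 2) n / fact n"
proof (induction n)
  case 0
  show ?case by (simp add: box_weight_level_0)
next
  case (Suc n)
  let ?S = "\<lambda>n. \<Sum>\<nu> | num_boxes \<nu> = n. box_weight (\<lambda>c. (z + of_int c) * (z' + of_int c)) \<nu>"
  \<comment> \<open>The content function expands as z z' + (z + z') c + c^2, so alpha = z z' and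
    gamma = 1.\<close>
  have "of_nat (n + 1) * ?S (n + 1) = (z * z' / 2 + of_nat n * 1) * ?S n"
    by (rule box_weight_level_step[where \<beta> = "z + z'"]) (simp add: power2_eq_square algebra_simps)
  then have "?S (Suc n) = (z * z' / 2 + of_nat n) * ?S n / of_nat (Suc n)"
    by (simp add: field_simps del: of_nat_Suc)
  then show ?case unfolding Suc by (simp add: pochhammer_Suc field_simps)
qed

lemma level_sum_Plancherel:
  "(\<Sum>\<nu> | num_boxes \<nu> = n. box_weight (\<lambda>c. 1) \<nu>) = 1 / (2 ^ n * fact n)"
proof (induction n)
  case 0
  show ?case by (simp add: box_weight_level_0)
next
  case (Suc n)
  let ?S = "\<lambda>n. \<Sum>\<nu> | num_boxes \<nu> = n. box_weight (\<lambda>c. 1) \<nu>"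
  have "of_nat (n + 1) * ?S (n + 1) = (1 / 2 + of_nat n * 0) * ?S n"
    by (rule box_weight_level_step[where \<beta> = 0]) simp
  then have "?S (Suc n) = 1 / 2 * ?S n / of_nat (Suc n)"
    by (simp add: field_simps del: of_nat_Suc)
  then show ?case unfolding Suc by (simp add: field_simps)
qed

text \<open>Principal series: each factor is |z + c|^2. Complementary series: at theta = 2 the
  lattice is the set of integers, so -c lies outside the interval and z + c, z' + c have the same
  sign. Degenerate series: either the diagram contains a box that annihilates the product, or it is
  confined to m rows or m columns, where the two factors never have opposite signs.\<close>

lemma content_product_nonneg:
  assumes "admissible 2 z z'"
  shows "(\<Prod>(i, j)\<in>boxes \<nu>. (z + of_int (int j - 1 - 2 * (int i - 1))) * (z' + of_int (int j - 1 - 2 * (int i - 1)))) \<in> \<real>\<^sub>\<ge>\<^sub>0"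
    (is "?prod z z' \<in> _")
proof -
  have real_case: "?prod z z' \<in> \<real>\<^sub>\<ge>\<^sub>0"
    if "z \<in> \<real>" "z' \<in> \<real>" "\<And>i j. (i, j) \<in> boxes \<nu> \<Longrightarrow>
      (Re z + of_int (int j - 1 - 2 * (int i - 1))) * (Re z' + of_int (int j - 1 - 2 * (int i - 1))) \<ge> 0" for z z'
  proof (rule prod_nonneg_Reals)
    fix p assume p: "p \<in> boxes \<nu>"
    obtain i j where ij: "p = (i, j)" by (metis surj_pair)
    have "z = of_real (Re z)" "z' = of_real (Re z')" using that by simp_all
    then have "(z + of_int (int j - 1 - 2 * (int i - 1))) * (z' + of_int (int j - 1 - 2 * (int i - 1)))
       = of_real ((Re z + of_int (int j - 1 - 2 * (int i - 1))) * (Re z' + of_int (int j - 1 - 2 * (int i - 1))))"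
      by (metis of_real_add of_real_mult of_real_of_int_eq)
    then show "(case p of (i, j) \<Rightarrow> (z + of_int (int j - 1 - 2 * (int i - 1))) * (z' + of_int (int j - 1 - 2 * (int i - 1)))) \<in> \<real>\<^sub>\<ge>\<^sub>0"
      using that(3)[of i j] p by (simp only: ij prod.case nonneg_Reals_of_real_iff)
  qed
  have zero_case: "?prod z z' \<in> \<real>\<^sub>\<ge>\<^sub>0" if "(i, j) \<in> boxes \<nu>" "z + of_int (int j - 1 - 2 * (int i - 1)) = 0" for z z' i j
  proof -
    have "?prod z z' = 0" using that by (intro prod_zero) (auto intro!: bexI[of _ "(i, j)"])
    then show ?thesis by (simp only: nonneg_Reals_zero_I)
  qed
  have deg1: "?prod z z' \<in> \<real>\<^sub>\<ge>\<^sub>0" if R: "z \<in> \<real>" "z' \<in> \<real>" and m: "m \<ge> 1" and z: "Re z = real m * 2" and z': "Re z' > (real m - 1) * 2" for z z' and m :: nat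
  proof (cases "(m + 1, 1) \<in> boxes \<nu>")
    case True
    \<comment> \<open>The first box of row m + 1 has content -2m = -z.\<close>
    have "z + of_int (int 1 - 1 - 2 * (int (m + 1) - 1)) = 0" using R(1) z by (simp add: complex_eq_iff complex_is_Real_iff)
    then show ?thesis by (rule zero_case[OF True])
  next
    case False
    show ?thesis
    proof (rule real_case[OF R])
      fix i j assume ij: "(i, j) \<in> boxes \<nu>"
      have "i \<le> m"
      proof (rule ccontr)
        assume "\<not> i \<le> m"
        then have "row \<nu> i \<le> row \<nu> (m + 1)" by (intro row_antimono) auto
        then show False using ij False by (auto simp: boxes_def)
      qed
      then have c: "int j - 1 - 2 * (int i - 1) \<ge> - 2 * (int m - 1)" using ij by (auto simp: boxes_def)
      then have "real_of_int (int j - 1 - 2 * (int i - 1)) \<ge> of_int (- 2 * (int m - 1))" by (simp only: of_int_le_iff)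
      then show "(Re z + of_int (int j - 1 - 2 * (int i - 1))) * (Re z' + of_int (int j - 1 - 2 * (int i - 1))) \<ge> 0"
        using z z' by (intro mult_nonneg_nonneg) (simp_all add: algebra_simps)
    qed
  qed
  have deg2: "?prod z z' \<in> \<real>\<^sub>\<ge>\<^sub>0" if R: "z \<in> \<real>" "z' \<in> \<real>" and m: "m \<ge> 1" and z: "Re z = - real m" and z': "Re z' < - real m + 1" for z z' and m :: nat
  proof (cases "(1, m + 1) \<in> boxes \<nu>")
    case True
    \<comment> \<open>Box m + 1 of the first row has content m = -z.\<close>
    have "z + of_int (int (m + 1) - 1 - 2 * (int 1 - 1)) = 0" using R(1) z by (simp add: complex_eq_iff complex_is_Real_iff)
    then show ?thesis by (rule zero_case[OF True])
  next
    case False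
    show ?thesis
    proof (rule real_case[OF R])
      fix i j assume ij: "(i, j) \<in> boxes \<nu>"
      have "j \<le> m"
      proof (rule ccontr)
        assume "\<not> j \<le> m"
        moreover have "row \<nu> i \<le> row \<nu> 1" using ij by (intro row_antimono) (auto simp: boxes_def)
        ultimately show False using ij False by (auto simp: boxes_def)
      qed
      then have c: "int j - 1 - 2 * (int i - 1) \<le> int m - 1" using ij by (auto simp: boxes_def)
      then have "real_of_int (int j - 1 - 2 * (int i - 1)) \<le> of_int (int m - 1)" by (simp only: of_int_le_iff)
      then show "(Re z + of_int (int j - 1 - 2 * (int i - 1))) * (Re z' + of_int (int j - 1 - 2 * (int i - 1))) \<ge> 0"
        using z z' by (intro mult_nonpos_nonpos) (simp_all add: algebra_simps)
    qed
  qed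
  have comm: "?prod z z' = ?prod z' z" for z z' by (simp only: mult.commute)
  consider "principal_series 2 z z'" | "complementary_series 2 z z'" | "degenerate_series 2 z z'"
    using assms by (auto simp: admissible_def)
  then show ?thesis
  proof cases
    case 1
    then have z': "z' = cnj z" by (simp add: principal_series_def)
    show ?thesis
    proof (rule prod_nonneg_Reals)
      fix p assume "p \<in> boxes \<nu>"
      obtain i j where ij: "p = (i, j)" by (metis surj_pair)
      have "(z + of_int c) * (z' + of_int c) \<in> \<real>\<^sub>\<ge>\<^sub>0" for c
      proof -
        have "z' + of_int c = cnj (z + of_int c)" by (simp add: z')
        then have "(z + of_int c) * (z' + of_int c) = of_real ((cmod (z + of_int c))\<^sup>2)"
          by (simp only: complex_norm_square)
        then show ?thesis by (simp only: nonneg_Reals_of_real_iff) simp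
      qed
      then show "(case p of (i, j) \<Rightarrow> (z + of_int (int j - 1 - 2 * (int i - 1))) * (z' + of_int (int j - 1 - 2 * (int i - 1)))) \<in> \<real>\<^sub>\<ge>\<^sub>0"
        by (simp only: ij prod.case)
    qed
  next
    case 2
    then obtain a b where R: "z \<in> \<real>" "z' \<in> \<real>" and ab: "{a<..<b} \<inter> theta_lattice 2 = {}" "Re z \<in> {a<..<b}" "Re z' \<in> {a<..<b}"
      by (auto simp: complementary_series_def)
    show ?thesis
    proof (rule real_case[OF R])
      fix i j
      define c where "c = int j - 1 - 2 * (int i - 1)"
      have "real_of_int (- c) = of_int (- c) + of_int 0 * 2" by simp
      then have "real_of_int (- c) \<in> theta_lattice 2" unfolding theta_lattice_def by blast
      then have "\<not> (a < real_of_int (- c) \<and> real_of_int (- c) < b)" using ab(1) by auto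
      then consider "real_of_int (- c) \<le> a" | "b \<le> real_of_int (- c)" by linarith
      then have "(Re z + of_int c) * (Re z' + of_int c) \<ge> 0"
      proof cases
        case 1
        then show ?thesis using ab(2,3) by (intro mult_nonneg_nonneg) auto
      next
        case 2
        then show ?thesis using ab(2,3) by (intro mult_nonpos_nonpos) auto
      qed
      then show "(Re z + of_int (int j - 1 - 2 * (int i - 1))) * (Re z' + of_int (int j - 1 - 2 * (int i - 1))) \<ge> 0"
        unfolding c_def .
    qed
  next
    case 3
    then obtain m :: nat where R: "z \<in> \<real>" "z' \<in> \<real>" and m: "m \<ge> 1" and
      d: "(Re z = real m * 2 \<and> Re z' > (real m - 1) * 2) \<or> (Re z' = real m * 2 \<and> Re z > (real m - 1) * 2) \<or>
         (Re z = - real m \<and> Re z' < - real m + 1) \<or> (Re z' = - real m \<and> Re z < - real m + 1)"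
      by (auto simp: degenerate_series_def)
    from d show ?thesis
      using deg1[OF R m] deg1[OF R(2,1) m] deg2[OF R m] deg2[OF R(2,1) m] comm[of z z'] by auto
  qed
qed

lemma mixed_z_weight_eq:
  "mixed_z_weight z z' \<xi> 2 \<nu> = of_real (\<xi> ^ num_boxes \<nu>) * box_weight (\<lambda>c. (z + of_int c) * (z' + of_int c)) \<nu>
     / complex_of_real (1 - \<xi>) powr (- (z * z' / 2))"
proof -
  have J: "jack_poch z \<nu> 2 = (\<Prod>(i, j)\<in>boxes \<nu>. z + of_int (int j - 1 - 2 * (int i - 1)))" for z
    unfolding jack_poch_def by (intro prod.cong refl) (auto simp: algebra_simps)
  have "jack_poch z \<nu> 2 * jack_poch z' \<nu> 2 = (\<Prod>(i, j)\<in>boxes \<nu>. (z + of_int (int j - 1 - 2 * (int i - 1))) * (z' + of_int (int j - 1 - 2 * (int i - 1))))"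
    unfolding J prod.distrib[symmetric] by (intro prod.cong refl) auto
  then show ?thesis
    unfolding mixed_z_weight_def box_weight_def of_real_numeral powr_minus
    by (simp only: divide_inverse inverse_inverse_eq mult_ac)
qed

lemma poissonized_plancherel_weight_eq:
  "of_real (poissonized_plancherel_weight \<eta> 2 \<nu>) = of_real ((2 * \<eta>) ^ num_boxes \<nu>) * box_weight (\<lambda>c. 1) \<nu> / of_real (exp \<eta>)"
  unfolding poissonized_plancherel_weight_def box_weight_def
  by (simp add: exp_minus divide_inverse power_mult_distrib mult_ac split_def)

theorem theorem4p1:
  fixes z z' :: complex and \<xi> \<eta> :: real
  assumes "admissible 2 z z'"
    and "0 < \<xi>" and "\<xi> < 1"
    and "\<eta> > 0"
  shows
    "(\<exists>M. is_measure_with_weights M (mixed_z_weight z z' \<xi> 2) \<and>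
          is_pfaffian_L_ensemble half_integers (L_matrix (h_z z z' \<xi>)) (point_process M)) \<and>
     pf_J_plus half_integers (L_matrix (h_z z z' \<xi>))
       = complex_of_real (1 - \<xi>) powr (- (z * z' / 2)) \<and>
     (\<exists>M. is_measure_with_weights M (\<lambda>\<nu>. of_real (poissonized_plancherel_weight \<eta> 2 \<nu>)) \<and>
          is_pfaffian_L_ensemble half_integers (L_matrix (h_Pl \<eta>)) (point_process M)) \<and>
     pf_J_plus half_integers (L_matrix (h_Pl \<eta>)) = complex_of_real (exp \<eta>)"
proof -
  let ?g = "\<lambda>c. (z + of_int c) * (z' + of_int c)" and ?Z = "complex_of_real (1 - \<xi>) powr (- (z * z' / 2))"
  have "(\<lambda>n. of_real (\<xi> ^ n) * (\<Sum>\<nu> | num_boxes \<nu> = n. box_weight ?g \<nu>)) sums ?Z"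
  proof -
    \<comment> \<open>The level sums are the Taylor coefficients of (1 - u)^(-z z'/2). The binomial
      series is taken at -\<xi>, whose sign cancels the one relating \<open>gchoose\<close> to
      \<open>pochhammer\<close>.\<close>
    have "(\<lambda>n. (- (z * z' / 2) gchoose n) * (- of_real \<xi>) ^ n) sums (1 + - of_real \<xi>) powr (- (z * z' / 2))"
      by (rule gen_binomial_complex) (use assms in simp)
    moreover have "(- (z * z' / 2) gchoose n) * (- of_real \<xi>) ^ n = of_real (\<xi> ^ n) * (\<Sum>\<nu> | num_boxes \<nu> = n. box_weight ?g \<nu>)" for n
    proof -
      have "(- 1 :: complex) ^ n * (- of_real \<xi>) ^ n = of_real (\<xi> ^ n)"
        unfolding power_mult_distrib[symmetric] by simp
      then show ?thesis unfolding level_sum_z gbinomial_pochhammer by (simp add: mult_ac)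
    qed
    ultimately show ?thesis by simp
  qed
  then have A: "(\<exists>M. is_measure_with_weights M (\<lambda>\<nu>. of_real (\<xi> ^ num_boxes \<nu>) * box_weight ?g \<nu> / ?Z) \<and>
      is_pfaffian_L_ensemble half_integers (L_matrix (h_z z z' \<xi>)) (point_process M)) \<and>
    pf_J_plus half_integers (L_matrix (h_z z z' \<xi>)) = ?Z"
    by (intro L_ensemble_of_box_weight h_z_pos h_z_neg box_weight_nonneg content_product_nonneg assms) (use assms in auto)
  have "(\<lambda>n. of_real ((2 * \<eta>) ^ n) * (\<Sum>\<nu> | num_boxes \<nu> = n. box_weight (\<lambda>c. 1) \<nu>)) sums complex_of_real (exp \<eta>)"
  proof -
    \<comment> \<open>The powers of 2 in q = 2 \<eta> cancel those in the denominators of the level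
      sums, which leaves the exponential series.\<close>
    have "(\<lambda>n. of_real \<eta> ^ n /\<^sub>R fact n) sums exp (complex_of_real \<eta>)" by (rule exp_converges)
    moreover have "of_real \<eta> ^ n /\<^sub>R fact n = complex_of_real ((2 * \<eta>) ^ n) * (\<Sum>\<nu> | num_boxes \<nu> = n. box_weight (\<lambda>c. 1) \<nu>)" for n
      unfolding level_sum_Plancherel by (simp add: power_mult_distrib scaleR_conv_of_real field_simps)
    ultimately show ?thesis by (simp add: exp_of_real)
  qed
  then have "(\<exists>M. is_measure_with_weights M (\<lambda>\<nu>. of_real ((2 * \<eta>) ^ num_boxes \<nu>) * box_weight (\<lambda>c. 1) \<nu> / of_real (exp \<eta>)) \<and>
      is_pfaffian_L_ensemble half_integers (L_matrix (h_Pl \<eta>)) (point_process M)) \<and>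
    pf_J_plus half_integers (L_matrix (h_Pl \<eta>)) = of_real (exp \<eta>)"
    by (intro L_ensemble_of_box_weight h_Pl_pos h_Pl_neg box_weight_nonneg) (use assms in \<open>auto intro!: prod_nonneg_Reals\<close>)
  then show ?thesis
    using A unfolding mixed_z_weight_eq[abs_def] poissonized_plancherel_weight_eq by blast
qed

end
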